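(* Let $V$ and $W$ be optimal computers, and let $f\colon\mathbb{N}^+\to\mathbb{N}$ be a total recursive function. Then the following two conditions are equivalent: (i) There exist an oracle deterministic Turing machine $M$ and $c\in\mathbb{N}$ such that, for all $n\in\mathbb{N}^+$, $M^{\{\Omega_V\restriction n\}}(n)=\mathrm{Dom}\,W\restriction(n+f(n)-c)$, where the finite set $\mathrm{Dom}\,W\restriction(n+f(n)-c)$ is represented as a finite binary string in a fixed format. (ii) The function $f$ is bounded from above.
   Context: $\{0,1\}^*$ is the set of finite binary strings. A computer is a partial recursive function $C\colon\{0,1\}^*\to\{0,1\}^*$ whose domain $\mathrm{Dom}\,C$ is prefix-free. A computer $U$ is optimal if for every computer $C$ there is $d\in\mathbb{N}$ such that for every $p\in\mathrm{Dom}\,C$ there is $q$ with $U(q)=C(p)$ and $|q|\le|p|+d$. $\Omega_V=\sum_{p\in\mathrm{Dom}\,V}2^{-|p|}$. For $S\subseteq\{0,1\}^*$ and $n\in\mathbb{Z}$, $S\restriction n=\{s\in S:|s|\le n\}$ (empty if $n<0$). For a real $\alpha$ and $n\in\mathbb{N}^+$, $\alpha\restriction n$ is the string of the first $n$ bits of the base-two expansion of $\alpha-\lfloor\alpha\rfloor$ (with infinitely many zeros when there is a choice). $M^{\{s\}}(n)$ is the output of oracle machine $M$ on input $n$ with oracle the one-element set $\{s\}$. *)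

theory Defs
  imports "HOL-Analysis.Analysis" "HOL-Library.Sublist"
begin

section \<open>Partial recursive functions\<close>

text \<open>
  Kleene's schemes. The relation \<open>evals g xs y\<close> says that \<open>g\<close> is defined at the argument tuple
  \<open>xs\<close> with value \<open>y\<close>; an application with a wrong number of arguments is undefined, except that
  \<open>Zero\<close> is the constant zero function of every arity.
\<close>

datatype recf =
    Zero
  | Succ
  | Proj nat
  | Comp recf "recf list"
  | PrimRec recf recf
  | Mu recf

inductive evals :: "recf \<Rightarrow> nat list \<Rightarrow> nat \<Rightarrow> bool" where
  evals_Zero: "evals Zero xs 0"
| evals_Succ: "evals Succ [x] (Suc x)"
| evals_Proj: "i < length xs \<Longrightarrow> evals (Proj i) xs (xs ! i)"
| evals_Comp: "\<lbrakk>list_all2 (\<lambda>g y. evals g xs y) gs ys; evals h ys z\<rbrakk> \<Longrightarrow> evals (Comp h gs) xs z"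
| evals_PrimRec_0: "evals g xs y \<Longrightarrow> evals (PrimRec g h) (0 # xs) y"
| evals_PrimRec_Suc: "\<lbrakk>evals (PrimRec g h) (n # xs) r; evals h (n # r # xs) y\<rbrakk>
    \<Longrightarrow> evals (PrimRec g h) (Suc n # xs) y"
| evals_Mu: "\<lbrakk>evals g (n # xs) 0; \<forall>m<n. \<exists>z. evals g (m # xs) (Suc z)\<rbrakk> \<Longrightarrow> evals (Mu g) xs n"

definition partial_recursive :: "(nat \<rightharpoonup> nat) \<Rightarrow> bool" where
  "partial_recursive F \<longleftrightarrow> (\<exists>g. \<forall>x y. F x = Some y \<longleftrightarrow> evals g [x] y)"

text \<open>
  Strings are identified with numbers by bijective base-two numeration, with digits
  1 (for \<open>False\<close>) and 2 (for \<open>True\<close>), least significant digit first.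
\<close>

fun nat_of_str :: "bool list \<Rightarrow> nat" where
  "nat_of_str [] = 0"
| "nat_of_str (b # s) = 2 * nat_of_str s + (if b then 2 else 1)"

definition str_of_nat :: "nat \<Rightarrow> bool list" where
  "str_of_nat = inv nat_of_str"

lemma bij_nat_of_str: "bij nat_of_str"
proof (rule bijI)
  show "inj nat_of_str"
  proof (rule injI)
    fix s t
    assume "nat_of_str s = nat_of_str t"
    then show "s = t"
    proof (induction s arbitrary: t)
      case Nil
      then show ?case by (cases t) (auto split: if_splits)
    next
      case (Cons b s)
      then obtain c u where t: "t = c # u"
        by (cases t) (auto split: if_splits)
      have eq: "2 * nat_of_str s + (if b then 2 else 1) = 2 * nat_of_str u + (if c then 2 else 1)"
        using Cons.prems t by simp
      have bc: "b = c"
      proof -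
        have "even (2 * nat_of_str s + (if b then 2 else 1)) \<longleftrightarrow> b"
          "even (2 * nat_of_str u + (if c then 2 else 1)) \<longleftrightarrow> c" by auto
        then show ?thesis using eq by metis
      qed
      with eq have "nat_of_str s = nat_of_str u" by simp
      with Cons.IH bc t show ?case by simp
    qed
  qed
next
  have "\<exists>s. nat_of_str s = n" for n
  proof (induction n rule: less_induct)
    case (less n)
    show ?case
    proof (cases "n = 0")
      case True
      then have "nat_of_str [] = n" by simp
      then show ?thesis ..
    next
      case False
      then have "(n - 1) div 2 < n" by linarith
      with less obtain s where s: "nat_of_str s = (n - 1) div 2" by blast
      have "nat_of_str (even n # s) = n"
        using s False by (auto elim!: evenE oddE)
      then show ?thesis ..
    qed
  qed
  then show "surj nat_of_str" by (metis surjI)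
qed

definition partial_recursive_str :: "(bool list \<rightharpoonup> bool list) \<Rightarrow> bool" where
  "partial_recursive_str C \<longleftrightarrow>
     partial_recursive (\<lambda>x. map_option nat_of_str (C (str_of_nat x)))"


section \<open>Computers and halting probabilities\<close>

definition prefix_free :: "bool list set \<Rightarrow> bool" where
  "prefix_free S \<longleftrightarrow> (\<forall>s\<in>S. \<forall>t\<in>S. prefix s t \<longrightarrow> s = t)"

definition computer :: "(bool list \<rightharpoonup> bool list) \<Rightarrow> bool" where
  "computer C \<longleftrightarrow> partial_recursive_str C \<and> prefix_free (dom C)"

definition optimal :: "(bool list \<rightharpoonup> bool list) \<Rightarrow> bool" where
  "optimal U \<longleftrightarrow> computer U \<and>
     (\<forall>C. computer C \<longrightarrow>
        (\<exists>d. \<forall>p\<in>dom C. \<exists>q. U q = C p \<and> length q \<le> length p + d))"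

text \<open>
  For a computer the series below converges by Kraft's inequality, so the default value that
  \<open>infsum\<close> takes on non-summable families plays no role.
\<close>

definition Omega :: "(bool list \<rightharpoonup> bool list) \<Rightarrow> real" where
  "Omega V = (\<Sum>\<^sub>\<infinity>p\<in>dom V. (1 / 2) ^ length p)"

definition restrict_length :: "bool list set \<Rightarrow> int \<Rightarrow> bool list set" where
  "restrict_length S n = {s \<in> S. int (length s) \<le> n}"

text \<open>
  The \<open>i\<close>-th binary digit of the fractional part, \<open>i \<ge> 1\<close>. Taking floors selects the
  expansion with infinitely many zeros, see \<open>bin_digit_sums\<close> and
  \<open>infinite_zero_digits\<close>.
\<close>

definition bin_digit :: "real \<Rightarrow> nat \<Rightarrow> bool" where
  "bin_digit \<alpha> i \<longleftrightarrow> odd \<lfloor>2 ^ i * frac \<alpha>\<rfloor>"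

definition bin_prefix :: "real \<Rightarrow> nat \<Rightarrow> bool list" where
  "bin_prefix \<alpha> n = map (bin_digit \<alpha>) [1..<Suc n]"

lemma floor_double: "\<lfloor>2 * x\<rfloor> = 2 * \<lfloor>x\<rfloor> + of_bool (odd \<lfloor>2 * x\<rfloor>)" for x :: real
proof -
  have "\<lfloor>2 * x\<rfloor> = 2 * \<lfloor>x\<rfloor> \<or> \<lfloor>2 * x\<rfloor> = 2 * \<lfloor>x\<rfloor> + 1"
    by linarith
  then show ?thesis by auto
qed

lemma bin_digit_sums: "(\<lambda>i. of_bool (bin_digit \<alpha> (Suc i)) / 2 ^ Suc i) sums frac \<alpha>"
proof -
  let ?x = "frac \<alpha>"
  have partial: "(\<Sum>i<n. of_bool (bin_digit \<alpha> (Suc i)) / 2 ^ Suc i) = \<lfloor>2 ^ n * ?x\<rfloor> / 2 ^ n" for n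
  proof (induction n)
    case 0
    show ?case by (simp add: floor_eq_iff frac_lt_1)
  next
    case (Suc n)
    have "real_of_int \<lfloor>2 ^ Suc n * ?x\<rfloor> = 2 * \<lfloor>2 ^ n * ?x\<rfloor> + of_bool (bin_digit \<alpha> (Suc n))"
      using arg_cong[OF floor_double[of "2 ^ n * ?x"], of real_of_int]
      by (simp add: bin_digit_def mult.assoc)
    with Suc show ?case by (simp add: field_simps)
  qed
  have lim: "(\<lambda>n. 1 / 2 ^ n :: real) \<longlonglongrightarrow> 0"
    using LIMSEQ_power_zero[of "1 / 2 :: real"] by (simp add: power_one_over)
  have "(\<lambda>n. \<lfloor>2 ^ n * ?x\<rfloor> / 2 ^ n) \<longlonglongrightarrow> ?x"
  proof (rule tendsto_sandwich[of "\<lambda>n. ?x - 1 / 2 ^ n" _ _ "\<lambda>n. ?x"])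
    show "\<forall>\<^sub>F n in sequentially. ?x - 1 / 2 ^ n \<le> \<lfloor>2 ^ n * ?x\<rfloor> / 2 ^ n"
    proof (rule always_eventually, rule allI)
      fix n
      have "2 ^ n * ?x - 1 \<le> \<lfloor>2 ^ n * ?x\<rfloor>" by linarith
      then have "(2 ^ n * ?x - 1) / 2 ^ n \<le> \<lfloor>2 ^ n * ?x\<rfloor> / 2 ^ n"
        by (rule divide_right_mono) simp
      then show "?x - 1 / 2 ^ n \<le> \<lfloor>2 ^ n * ?x\<rfloor> / 2 ^ n" by (simp add: diff_divide_distrib)
    qed
    show "\<forall>\<^sub>F n in sequentially. \<lfloor>2 ^ n * ?x\<rfloor> / 2 ^ n \<le> ?x"
    proof (rule always_eventually, rule allI)
      fix n
      have "\<lfloor>2 ^ n * ?x\<rfloor> \<le> 2 ^ n * ?x" by linarith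
      then have "\<lfloor>2 ^ n * ?x\<rfloor> / 2 ^ n \<le> 2 ^ n * ?x / 2 ^ n"
        by (rule divide_right_mono) simp
      then show "\<lfloor>2 ^ n * ?x\<rfloor> / 2 ^ n \<le> ?x" by simp
    qed
    show "(\<lambda>n. ?x - 1 / 2 ^ n) \<longlonglongrightarrow> ?x"
      using tendsto_diff[OF tendsto_const lim, of ?x] by simp
  qed simp
  then show ?thesis unfolding sums_def partial .
qed

lemma infinite_zero_digits: "infinite {i. \<not> bin_digit \<alpha> i}"
proof
  let ?x = "frac \<alpha>"
  assume "finite {i. \<not> bin_digit \<alpha> i}"
  then obtain N where "\<forall>i \<in> {i. \<not> bin_digit \<alpha> i}. i < N"
    by (meson finite_nat_set_iff_bounded)
  then have N: "bin_digit \<alpha> i" if "i \<ge> N" for i using that by fastforce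
  define y where "y n = 1 - frac (2 ^ n * ?x)" for n
  have step: "y (Suc n) = 2 * y n" if "n \<ge> N" for n
  proof -
    have "odd \<lfloor>2 ^ Suc n * ?x\<rfloor>" using N[of "Suc n"] that by (simp add: bin_digit_def)
    then have "real_of_int \<lfloor>2 ^ Suc n * ?x\<rfloor> = 2 * \<lfloor>2 ^ n * ?x\<rfloor> + 1"
      using arg_cong[OF floor_double[of "2 ^ n * ?x"], of real_of_int]
      by (simp add: mult.assoc)
    then show ?thesis by (simp add: y_def frac_def)
  qed
  have pow: "y (N + k) = 2 ^ k * y N" for k
    by (induction k) (simp_all add: step)
  have "y N > 0" by (simp add: y_def frac_lt_1)
  then obtain k where "1 / y N < 2 ^ k" using real_arch_pow[of 2 "1 / y N"] by auto
  with \<open>y N > 0\<close> have "1 < y (N + k)" by (simp add: pow field_simps)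
  moreover have "y (N + k) \<le> 1" by (simp add: y_def)
  ultimately show False by simp
qed

text \<open>
  A finite set is written down by listing its elements in increasing order of their number,
  coding each string \<open>b\<^sub>1 \<dots> b\<^sub>m\<close> as \<open>1 b\<^sub>1 1 b\<^sub>2 \<dots> 1 b\<^sub>m 0\<close>.
\<close>

definition code_str :: "bool list \<Rightarrow> bool list" where
  "code_str s = concat (map (\<lambda>b. [True, b]) s) @ [False]"

definition code_set :: "bool list set \<Rightarrow> bool list" where
  "code_set A = concat (map (code_str \<circ> str_of_nat) (sorted_list_of_set (nat_of_str ` A)))"


section \<open>Oracle deterministic Turing machines\<close>

text \<open>
  Multi-tape machines over a finite alphabet \<open>{0, \<dots>, symbols - 1}\<close> containing the blank 0 and the
  bits 1 and 2. Tapes are infinite in both directions; a tape is a pair of lists, the cells to the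
  left of the head (nearest first) and the cells from the head on, all other cells being blank.
\<close>

datatype move = MoveL | Stay | MoveR

type_synonym tape = "nat list \<times> nat list"

definition bit_sym :: "bool \<Rightarrow> nat" where
  "bit_sym b = (if b then 2 else 1)"

definition cell :: "nat list \<Rightarrow> nat" where
  "cell xs = (case xs of [] \<Rightarrow> 0 | x # _ \<Rightarrow> x)"

definition read_tape :: "tape \<Rightarrow> nat" where
  "read_tape t = cell (snd t)"

definition write_tape :: "nat \<Rightarrow> tape \<Rightarrow> tape" where
  "write_tape x t = (fst t, x # tl (snd t))"

fun move_tape :: "move \<Rightarrow> tape \<Rightarrow> tape" where
  "move_tape MoveL (ls, rs) = (tl ls, cell ls # rs)"
| "move_tape Stay (ls, rs) = (ls, rs)"
| "move_tape MoveR (ls, rs) = (cell rs # ls, tl rs)"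

text \<open>The word on a tape: the bits from the head to the right, up to the first non-bit.\<close>

definition tape_word :: "tape \<Rightarrow> bool list" where
  "tape_word t = map (\<lambda>x. x = 2) (takeWhile (\<lambda>x. x = 1 \<or> x = 2) (snd t))"

text \<open>
  Tape 0 carries the input and, on halting, the output; tape 1 is the query tape. In the query
  state the machine asks whether the word on the query tape belongs to the oracle, and continues in
  the state \<open>yes\<close> or \<open>no\<close> accordingly.
\<close>

record otm =
  states :: nat
  symbols :: nat
  tapes :: nat
  start :: nat
  halt :: nat
  query :: nat
  yes :: nat
  no :: nat
  delta :: "nat \<Rightarrow> nat list \<Rightarrow> nat \<times> (nat \<times> move) list"

definition oracle_tm :: "otm \<Rightarrow> bool" where
  "oracle_tm M \<longleftrightarrow>
     {start M, halt M, query M, yes M, no M} \<subseteq> {..<states M} \<and>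
     halt M \<noteq> query M \<and> 3 \<le> symbols M \<and> 2 \<le> tapes M \<and>
     (\<forall>q<states M. \<forall>xs. length xs = tapes M \<and> set xs \<subseteq> {..<symbols M} \<longrightarrow>
        (case delta M q xs of (q', acts) \<Rightarrow>
           q' < states M \<and> length acts = tapes M \<and> fst ` set acts \<subseteq> {..<symbols M}))"

type_synonym config = "nat \<times> tape list"

definition step :: "otm \<Rightarrow> bool list set \<Rightarrow> config \<Rightarrow> config" where
  "step M X c = (case c of (q, ts) \<Rightarrow>
     if q = halt M then (q, ts)
     else if q = query M then (if tape_word (ts ! 1) \<in> X then yes M else no M, ts)
     else (case delta M q (map read_tape ts) of (q', acts) \<Rightarrow>
       (q', map2 (\<lambda>(x, m) t. move_tape m (write_tape x t)) acts ts)))"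

definition init_config :: "otm \<Rightarrow> bool list \<Rightarrow> config" where
  "init_config M w = (start M, ([], map bit_sym w) # replicate (tapes M - 1) ([], []))"

definition otm_output :: "otm \<Rightarrow> bool list set \<Rightarrow> bool list \<Rightarrow> bool list \<Rightarrow> bool" where
  "otm_output M X w v \<longleftrightarrow>
     (\<exists>k ts. (step M X ^^ k) (init_config M w) = (halt M, ts) \<and> tape_word (ts ! 0) = v)"

lemma otm_output_unique:
  assumes "otm_output M X w v" "otm_output M X w v'"
  shows "v = v'"
proof -
  let ?run = "\<lambda>k. (step M X ^^ k) (init_config M w)"
  have stay: "?run (j + k) = (halt M, ts)" if "?run k = (halt M, ts)" for j k ts
    using that by (induction j) (auto simp: step_def)
  from assms obtain k ts k' ts' where
    r: "?run k = (halt M, ts)" "tape_word (ts ! 0) = v"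
       "?run k' = (halt M, ts')" "tape_word (ts' ! 0) = v'"
    unfolding otm_output_def by blast
  from stay[OF r(1), of k'] stay[OF r(3), of k] have "ts = ts'"
    by (simp add: add.commute)
  with r show ?thesis by simp
qed

end

theory Submission
  imports Defs "HOL-Library.Nat_Bijection"
begin

text \<open>
  Write \<open>\<Omega>\<^sub>V\<restriction>n\<close> for the first \<open>n\<close> bits of \<open>\<Omega>\<^sub>V\<close>.

  If \<open>f\<close> is bounded by \<open>B\<close>: once the programs of \<open>V\<close> found so far have total weight more than
  the dyadic rational \<open>\<Omega>\<^sub>V\<restriction>n\<close> minus \<open>2\<^sup>-\<^sup>n\<close>, every program of length below \<open>n\<close> has been found.
  Since \<open>V\<close> is optimal, it has for every \<open>p\<close> in \<open>Dom W\<close> a program of length at most \<open>|p| + d\<close> that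
  outputs the time at which \<open>W\<close> halts on \<open>p\<close>. So the outputs of \<open>V\<close> found so far bound the halting
  times of all programs of \<open>W\<close> of length below \<open>n - d\<close>, and \<open>c = B + d + 1\<close> works.

  If \<open>f\<close> is unbounded: the least \<open>n\<close> with \<open>f n \<ge> 2 k\<close> is computable from \<open>k\<close>, so a computer that is
  given \<open>1\<^sup>k 0\<close> followed by \<open>\<Omega>\<^sub>V\<restriction>n\<close> can run \<open>M\<close>, obtain all outputs of \<open>W\<close> on programs of length at
  most \<open>n + f n - c\<close>, and print a different string. That string has a description of length
  \<open>n + k + 1\<close>, hence by optimality a \<open>W\<close>-description of length at most \<open>n + k + 1 + d\<close>. This is
  at most \<open>n + f n - c\<close> for large \<open>k\<close>, a contradiction.
\<close>

section \<open>Total recursive functions\<close>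

definition trec :: "nat \<Rightarrow> (nat list \<Rightarrow> nat) \<Rightarrow> bool" where
  "trec n F \<longleftrightarrow> (\<exists>g. \<forall>xs. length xs = n \<longrightarrow> evals g xs (F xs))"

named_theorems trec_intros

lemma trec_cong: "trec n F \<Longrightarrow> (\<And>xs. length xs = n \<Longrightarrow> F xs = G xs) \<Longrightarrow> trec n G"
  unfolding trec_def by metis

lemma trec_comp:
  assumes "trec (length fs) F" "\<And>f. f \<in> set fs \<Longrightarrow> trec n f"
  shows "trec n (\<lambda>xs. F (map (\<lambda>f. f xs) fs))"
proof -
  obtain g where g: "\<And>xs. length xs = length fs \<Longrightarrow> evals g xs (F xs)"
    using assms(1) unfolding trec_def by blast
  have "\<forall>f\<in>set fs. \<exists>g. \<forall>xs. length xs = n \<longrightarrow> evals g xs (f xs)"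
    using assms(2) unfolding trec_def by blast
  then obtain \<gamma> where \<gamma>: "\<And>f xs. f \<in> set fs \<Longrightarrow> length xs = n \<Longrightarrow> evals (\<gamma> f) xs (f xs)"
    by metis
  have "evals (Comp g (map \<gamma> fs)) xs (F (map (\<lambda>f. f xs) fs))" if "length xs = n" for xs
  proof (rule evals_Comp)
    show "list_all2 (\<lambda>g y. evals g xs y) (map \<gamma> fs) (map (\<lambda>f. f xs) fs)"
      by (auto simp: list_all2_conv_all_nth intro!: \<gamma> that)
    show "evals g (map (\<lambda>f. f xs) fs) (F (map (\<lambda>f. f xs) fs))"
      by (rule g) simp
  qed
  then show ?thesis unfolding trec_def by blast
qed

lemma trec_nth [trec_intros]: "i < n \<Longrightarrow> trec n (\<lambda>xs. xs ! i)"
  unfolding trec_def using evals_Proj by blast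

lemma trec_nth_drop [trec_intros]: "a + i < n \<Longrightarrow> trec n (\<lambda>xs. drop a xs ! i)"
  by (rule trec_cong[OF trec_nth[of "a + i"]]) auto

lemma trec_comp1:
  assumes "trec 1 (\<lambda>xs. F (xs ! 0))" "trec n f"
  shows "trec n (\<lambda>xs. F (f xs))"
  using trec_comp[of "[f]" "\<lambda>xs. F (xs ! 0)" n] assms by simp

lemma trec_comp2:
  assumes "trec 2 (\<lambda>xs. F (xs ! 0) (xs ! 1))" "trec n f" "trec n g"
  shows "trec n (\<lambda>xs. F (f xs) (g xs))"
proof -
  have "trec n h" if "h \<in> set [f, g]" for h using that assms by auto
  with trec_comp[of "[f, g]" "\<lambda>xs. F (xs ! 0) (xs ! 1)" n] assms show ?thesis
    by (simp add: numeral_2_eq_2)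
qed

lemma trec_comp3:
  assumes "trec 3 (\<lambda>xs. F (xs ! 0) (xs ! 1) (xs ! 2))" "trec n f" "trec n g" "trec n h"
  shows "trec n (\<lambda>xs. F (f xs) (g xs) (h xs))"
proof -
  have "trec n k" if "k \<in> set [f, g, h]" for k using that assms by auto
  with trec_comp[of "[f, g, h]" "\<lambda>xs. F (xs ! 0) (xs ! 1) (xs ! 2)" n] assms show ?thesis
    by (simp add: numeral_3_eq_3)
qed

lemma trec_append_params:
  assumes F: "trec (length fs + n) F" and fs: "\<And>f. f \<in> set fs \<Longrightarrow> trec (k + n) f"
  shows "trec (k + n) (\<lambda>ys. F (map (\<lambda>f. f ys) fs @ drop k ys))"
proof -
  let ?ps = "map (\<lambda>i ys. ys ! i) [k..<k + n]"
  have "trec (k + n) (\<lambda>ys. F (map (\<lambda>f. f ys) (fs @ ?ps)))"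
    by (rule trec_comp) (auto simp: F intro: fs trec_nth)
  then show ?thesis
  proof (rule trec_cong)
    fix ys :: "nat list" assume "length ys = k + n"
    then have "map ((\<lambda>f. f ys) \<circ> (\<lambda>i ys. ys ! i)) [k..<k + n] = drop k ys"
      by (intro nth_equalityI) auto
    then show "F (map (\<lambda>f. f ys) (fs @ ?ps)) = F (map (\<lambda>f. f ys) fs @ drop k ys)"
      by simp
  qed
qed

lemma trec_Suc [trec_intros]: "trec n f \<Longrightarrow> trec n (\<lambda>xs. Suc (f xs))"
proof (rule trec_comp1[where F = Suc])
  have "evals Succ xs (Suc (xs ! 0))" if "length xs = 1" for xs
    using that evals_Succ[of "xs ! 0"] by (cases xs) auto
  then show "trec 1 (\<lambda>xs. Suc (xs ! 0))" unfolding trec_def by blast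
qed

lemma trec_const [trec_intros]: "trec n (\<lambda>xs. c)"
proof (induction c)
  case 0
  show ?case unfolding trec_def using evals_Zero by blast
qed (rule trec_Suc)

lemma trec_rec [trec_intros]:
  assumes k: "trec n k" and g: "trec n g"
    and h: "trec (Suc (Suc n)) (\<lambda>ys. h (ys ! 0) (ys ! 1) (drop 2 ys))"
  shows "trec n (\<lambda>xs. rec_nat (g xs) (\<lambda>m r. h m r xs) (k xs))"
proof -
  obtain g' where g': "\<And>xs. length xs = n \<Longrightarrow> evals g' xs (g xs)"
    using g unfolding trec_def by blast
  obtain h' where h': "\<And>ys. length ys = Suc (Suc n) \<Longrightarrow> evals h' ys (h (ys ! 0) (ys ! 1) (drop 2 ys))"
    using h unfolding trec_def by blast
  let ?F = "\<lambda>ys. rec_nat (g (drop 1 ys)) (\<lambda>m r. h m r (drop 1 ys)) (ys ! 0)"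
  have "evals (PrimRec g' h') (m # xs) (rec_nat (g xs) (\<lambda>m r. h m r xs) m)" if "length xs = n" for m xs
  proof (induction m)
    case 0
    show ?case using that by (auto intro: evals_PrimRec_0 g')
  next
    case (Suc m)
    show ?case using h'[of "m # _ # xs"] that by (auto intro: evals_PrimRec_Suc[OF Suc])
  qed
  then have "evals (PrimRec g' h') ys (?F ys)" if "length ys = Suc n" for ys
    using that by (cases ys) auto
  then have "trec (length [k] + n) ?F" unfolding trec_def by auto
  from trec_append_params[of "[k]" n ?F 0, OF this] k show ?thesis by simp
qed

lemma trec_add [trec_intros]: "trec n f \<Longrightarrow> trec n g \<Longrightarrow> trec n (\<lambda>xs. f xs + g xs)"
proof (rule trec_comp2[where F = "(+)"])
  have "trec 2 (\<lambda>xs. rec_nat (xs ! 1) (\<lambda>m r. Suc r) (xs ! 0))"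
    by (intro trec_intros) simp_all
  moreover have "rec_nat b (\<lambda>m r. Suc r) a = a + b" for a b by (induction a) auto
  ultimately show "trec 2 (\<lambda>xs. xs ! 0 + xs ! 1)" by simp
qed

lemma trec_mult [trec_intros]: "trec n f \<Longrightarrow> trec n g \<Longrightarrow> trec n (\<lambda>xs. f xs * g xs)"
proof (rule trec_comp2[where F = "(*)"])
  have "trec 2 (\<lambda>xs. rec_nat 0 (\<lambda>m r. r + xs ! 1) (xs ! 0))"
    by (intro trec_intros) simp_all
  moreover have "rec_nat 0 (\<lambda>m r. r + b) a = a * b" for a b :: nat by (induction a) auto
  ultimately show "trec 2 (\<lambda>xs. xs ! 0 * xs ! 1)" by simp
qed

lemma trec_power [trec_intros]: "trec n f \<Longrightarrow> trec n g \<Longrightarrow> trec n (\<lambda>xs. f xs ^ g xs)"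
proof (rule trec_comp2[where F = "(^)"])
  have "trec 2 (\<lambda>xs. rec_nat 1 (\<lambda>m r. r * xs ! 0) (xs ! 1))"
    by (intro trec_intros) simp_all
  moreover have "rec_nat 1 (\<lambda>m r. r * b) a = b ^ a" for a b :: nat by (induction a) auto
  ultimately show "trec 2 (\<lambda>xs. xs ! 0 ^ xs ! 1)" by simp
qed

lemma trec_diff [trec_intros]: "trec n f \<Longrightarrow> trec n g \<Longrightarrow> trec n (\<lambda>xs. f xs - g xs)"
proof (rule trec_comp2[where F = "(-)"])
  have "trec 1 (\<lambda>xs. rec_nat 0 (\<lambda>m r. m) (xs ! 0))"
    by (intro trec_intros) simp_all
  moreover have "rec_nat 0 (\<lambda>m r. m) a = a - 1" for a :: nat by (cases a) auto
  ultimately have "trec 1 (\<lambda>xs. xs ! 0 - 1)" by simp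
  then have "trec n (\<lambda>xs. f xs - 1)" if "trec n f" for n f by (rule trec_comp1[where F = "\<lambda>a. a - 1", OF _ that])
  then have "trec 2 (\<lambda>xs. rec_nat (xs ! 0) (\<lambda>m r. r - 1) (xs ! 1))"
    by (intro trec_rec trec_intros) (simp_all add: trec_nth)
  moreover have "rec_nat a (\<lambda>m r. r - 1) b = a - b" for a b :: nat by (induction b) auto
  ultimately show "trec 2 (\<lambda>xs. xs ! 0 - xs ! 1)" by simp
qed

definition trecp :: "nat \<Rightarrow> (nat list \<Rightarrow> bool) \<Rightarrow> bool" where
  "trecp n P \<longleftrightarrow> trec n (\<lambda>xs. of_bool (P xs))"

lemma trec_of_bool [trec_intros]: "trecp n P \<Longrightarrow> trec n (\<lambda>xs. of_bool (P xs))"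
  by (simp add: trecp_def)

lemma trec_if [trec_intros]:
  assumes "trecp n P" "trec n f" "trec n g"
  shows "trec n (\<lambda>xs. if P xs then f xs else g xs)"
proof -
  have "trec n (\<lambda>xs. of_bool (P xs) * f xs + (1 - of_bool (P xs)) * g xs)"
    by (intro trec_intros assms)
  then show ?thesis by (rule trec_cong) auto
qed

lemma trecp_le [trec_intros]: "trec n f \<Longrightarrow> trec n g \<Longrightarrow> trecp n (\<lambda>xs. f xs \<le> g xs)"
  unfolding trecp_def
  by (rule trec_cong[of _ "\<lambda>xs. 1 - (f xs - g xs)"]) (auto intro!: trec_intros)

lemma trecp_less [trec_intros]: "trec n f \<Longrightarrow> trec n g \<Longrightarrow> trecp n (\<lambda>xs. f xs < g xs)"
  using trecp_le[of n "\<lambda>xs. Suc (f xs)" g] by (auto intro: trec_Suc simp: Suc_le_eq)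

lemma trecp_not [trec_intros]: "trecp n P \<Longrightarrow> trecp n (\<lambda>xs. \<not> P xs)"
  unfolding trecp_def
  by (rule trec_cong[of _ "\<lambda>xs. 1 - of_bool (P xs)"]) (auto intro!: trec_intros simp: trecp_def)

lemma trecp_conj [trec_intros]: "trecp n P \<Longrightarrow> trecp n Q \<Longrightarrow> trecp n (\<lambda>xs. P xs \<and> Q xs)"
  unfolding trecp_def
  by (rule trec_cong[of _ "\<lambda>xs. of_bool (P xs) * of_bool (Q xs)"])
    (auto intro!: trec_intros simp: trecp_def)

lemma trecp_disj [trec_intros]: "trecp n P \<Longrightarrow> trecp n Q \<Longrightarrow> trecp n (\<lambda>xs. P xs \<or> Q xs)"
  using trecp_not[OF trecp_conj[OF trecp_not trecp_not], of n P Q] by simp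

lemma trecp_eq [trec_intros]: "trec n f \<Longrightarrow> trec n g \<Longrightarrow> trecp n (\<lambda>xs. f xs = g xs)"
  using trecp_conj[OF trecp_le trecp_le, of n f g g f] by (simp add: eq_iff)

lemma rec_nat_eq_foldr: "rec_nat a (\<lambda>j. h (K - Suc j)) K = foldr h [0..<K] a"
proof -
  have "j \<le> K \<Longrightarrow> rec_nat a (\<lambda>j. h (K - Suc j)) j = foldr h [K - j..<K] a" for j
  proof (induction j)
    case (Suc j)
    then have "[K - Suc j..<K] = (K - Suc j) # [K - j..<K]"
      by (simp add: upt_conv_Cons Suc_diff_Suc)
    with Suc show ?case by simp
  qed simp
  from this[of K] show ?thesis by simp
qed

lemma trec_foldr [trec_intros]:
  assumes k: "trec n k" and a: "trec n a"
    and h: "trec (Suc (Suc n)) (\<lambda>ys. h (ys ! 0) (ys ! 1) (drop 2 ys))"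
  shows "trec n (\<lambda>xs. foldr (\<lambda>i acc. h i acc xs) [0..<k xs] (a xs))"
proof -
  have k2: "trec (2 + n) (\<lambda>ys. k (drop 2 ys))"
    using trec_append_params[of "[]" n k 2] k by simp
  have "trec (2 + n) (\<lambda>ys. (\<lambda>ys. h (ys ! 0) (ys ! 1) (drop 2 ys))
       (map (\<lambda>f. f ys) [\<lambda>ys. k (drop 2 ys) - Suc (ys ! 0), \<lambda>ys. ys ! 1] @ drop 2 ys))"
    by (rule trec_append_params) (use h in \<open>auto intro!: trec_intros k2[simplified]\<close>)
  then have "trec (Suc (Suc n)) (\<lambda>ys. h (k (drop 2 ys) - Suc (ys ! 0)) (ys ! 1) (drop 2 ys))"
    by (simp add: numeral_2_eq_2)
  from trec_rec[OF k a, of "\<lambda>m r xs. h (k xs - Suc m) r xs", OF this]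
  have "trec n (\<lambda>xs. rec_nat (a xs) (\<lambda>m r. h (k xs - Suc m) r xs) (k xs))" .
  moreover have "rec_nat (a xs) (\<lambda>m r. h (k xs - Suc m) r xs) (k xs)
      = foldr (\<lambda>i acc. h i acc xs) [0..<k xs] (a xs)" for xs
    by (rule rec_nat_eq_foldr)
  ultimately show ?thesis by simp
qed

lemma trec_sum [trec_intros]:
  assumes k: "trec n k"
    and h: "trec (Suc (Suc n)) (\<lambda>ys. h (ys ! 0) (drop 2 ys))"
  shows "trec n (\<lambda>xs. \<Sum>i<k xs. h i xs)"
proof -
  have "trec n (\<lambda>xs. rec_nat 0 (\<lambda>m r. r + h m xs) (k xs))"
    using k h by (intro trec_intros) auto
  moreover have "rec_nat 0 (\<lambda>m r. r + h m xs) j = (\<Sum>i<j. h i xs)" for j xs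
    by (induction j) auto
  ultimately show ?thesis by simp
qed

lemma trec_div [trec_intros]: "trec n f \<Longrightarrow> trec n g \<Longrightarrow> trec n (\<lambda>xs. f xs div g xs)"
proof (rule trec_comp2[where F = "(div)"])
  have "trec 2 (\<lambda>xs. \<Sum>i<xs ! 0. of_bool (0 < xs ! 1 \<and> Suc i * xs ! 1 \<le> xs ! 0))"
    by (intro trec_intros) simp_all
  moreover have "(\<Sum>i<a. of_bool (0 < b \<and> Suc i * b \<le> a)) = a div b" for a b :: nat
  proof (cases "b = 0")
    case False
    have "{i. i < a \<and> Suc i * b \<le> a} = {..<a div b}"
    proof (intro set_eqI iffI; clarsimp)
      fix i assume "b + i * b \<le> a"
      then have "Suc i * b \<le> a" by simp
      then have "Suc i \<le> a div b" using False by (simp add: less_eq_div_iff_mult_less_eq)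
      then show "i < a div b" by simp
    next
      fix i assume "i < a div b"
      then have "Suc i \<le> a div b" by simp
      then have *: "Suc i * b \<le> a" using False by (simp add: less_eq_div_iff_mult_less_eq)
      moreover have "Suc i * 1 \<le> Suc i * b" using False by (intro mult_le_mono) auto
      ultimately show "i < a \<and> b + i * b \<le> a" by simp
    qed
    moreover have "(\<Sum>i<a. of_bool (0 < b \<and> Suc i * b \<le> a)) = card {i. i < a \<and> Suc i * b \<le> a}"
      using False by (simp add: of_bool_def sum.If_cases Int_def)
    ultimately show ?thesis by simp
  qed simp
  ultimately show "trec 2 (\<lambda>xs. xs ! 0 div xs ! 1)" by simp
qed

lemma trec_mod [trec_intros]: "trec n f \<Longrightarrow> trec n g \<Longrightarrow> trec n (\<lambda>xs. f xs mod g xs)"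
  by (rule trec_cong[of _ "\<lambda>xs. f xs - g xs * (f xs div g xs)"])
    (intro trec_intros minus_mult_div_eq_mod | assumption)+

lemma trecp_even [trec_intros]: "trec n f \<Longrightarrow> trecp n (\<lambda>xs. even (f xs))"
  using trecp_eq[OF trec_mod[OF _ trec_const] trec_const, of n f 2 0]
  by (simp add: even_iff_mod_2_eq_zero)

lemma trec_funpow:
  assumes "trec n k" "trec n a" "trec (Suc (Suc n)) (\<lambda>ys. h (ys ! 1) (drop 2 ys))"
  shows "trec n (\<lambda>xs. ((\<lambda>r. h r xs) ^^ k xs) (a xs))"
proof -
  have "trec n (\<lambda>xs. rec_nat (a xs) (\<lambda>m r. h r xs) (k xs))"
    using assms by (intro trec_intros)
  moreover have "rec_nat (a xs) (\<lambda>m r. h r xs) j = ((\<lambda>r. h r xs) ^^ j) (a xs)" for j xs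
    by (induction j) auto
  ultimately show ?thesis by simp
qed

lemma trec_table:
  fixes F :: "nat \<Rightarrow> nat"
  assumes "trec n f"
  shows "trec n (\<lambda>xs. if f xs < N then F (f xs) else 0)"
proof (induction N)
  case (Suc N)
  have "trec n (\<lambda>xs. if f xs = N then F N else (if f xs < N then F (f xs) else 0))"
    by (intro trec_if trecp_eq trec_const assms Suc)
  then show ?case by (rule trec_cong) auto
qed (simp add: trec_const)

section \<open>Recursive functions on strings and codes\<close>

lemma trec_nth_drop_drop [trec_intros]: "a + b + i < n \<Longrightarrow> trec n (\<lambda>xs. drop a (drop b xs) ! i)"
  using trec_nth_drop[of "a + b" i n] by (simp add: add.commute)

lemma nat_of_str_inverse [simp]: "str_of_nat (nat_of_str s) = s"
  unfolding str_of_nat_def using bij_nat_of_str by (simp add: bij_is_inj)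

lemma str_of_nat_inverse [simp]: "nat_of_str (str_of_nat n) = n"
  unfolding str_of_nat_def using bij_nat_of_str by (simp add: bij_is_surj surj_f_inv_f)

lemma nat_of_str_eq_iff [simp]: "nat_of_str s = nat_of_str t \<longleftrightarrow> s = t"
  using bij_nat_of_str by (metis nat_of_str_inverse)

lemma str_of_nat_eq_iff [simp]: "str_of_nat m = str_of_nat n \<longleftrightarrow> m = n"
  by (metis str_of_nat_inverse)

lemma nat_of_str_append: "nat_of_str (s @ t) = nat_of_str s + 2 ^ length s * nat_of_str t"
  by (induction s) auto

lemma nat_of_str_drop: "nat_of_str (drop i s) = (nat_of_str s + 1) div 2 ^ i - 1"
proof (induction i arbitrary: s)
  case (Suc i)
  show ?case
  proof (cases s)
    case Nil
    then show ?thesis by (simp add: div_greater_zero_iff)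
  next
    case (Cons b s')
    have "(nat_of_str s + 1) div 2 ^ Suc i = ((nat_of_str s + 1) div 2) div 2 ^ i"
      by (simp add: div_mult2_eq)
    also have "(nat_of_str s + 1) div 2 = nat_of_str s' + 1"
      using Cons by auto
    finally show ?thesis using Suc[of s'] Cons by simp
  qed
qed simp

lemma length_le_nat_of_str: "length s \<le> nat_of_str s"
  by (induction s) auto

lemma length_less_iff_nat_of_str: "length s < k \<longleftrightarrow> nat_of_str s + 1 < 2 ^ k"
proof (induction s arbitrary: k)
  case Nil
  show ?case
  proof (cases k)
    case (Suc m)
    have "1 \<le> (2 :: nat) ^ m" by simp
    then have "nat_of_str [] + 1 < 2 ^ Suc m"
      unfolding nat_of_str.simps power_Suc by linarith
    with Suc show ?thesis by simp
  qed simp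
next
  case (Cons b s)
  show ?case using Cons[of "k - 1"] by (cases k) auto
qed

lemma foldr_bits:
  assumes "length s \<le> K"
  shows "foldr (\<lambda>i acc. if Suc (nat_of_str s) div 2 ^ i \<le> 1 then a
      else h (even (Suc (nat_of_str s) div 2 ^ i - 1)) acc) [0..<K] a = foldr h s a"
  using assms
proof (induction s arbitrary: K)
  case Nil
  have *: "1 div 2 ^ i \<le> (1 :: nat)" for i by (simp add: div_le_dividend)
  then show ?case by (cases K) (simp_all add: upt_conv_Cons del: upt_Suc)
next
  case (Cons b s)
  then obtain K' where K: "K = Suc K'" "length s \<le> K'" by (cases K) auto
  let ?x = "nat_of_str (b # s)"
  have half: "Suc ?x div 2 ^ Suc i = Suc (nat_of_str s) div 2 ^ i" for i
  proof -
    have "Suc ?x div 2 ^ Suc i = (Suc ?x div 2) div 2 ^ i" by (simp add: div_mult2_eq)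
    also have "Suc ?x div 2 = Suc (nat_of_str s)" by auto
    finally show ?thesis .
  qed
  have upt: "[0..<K] = 0 # map Suc [0..<K']"
    by (simp add: K upt_conv_Cons map_Suc_upt del: upt_Suc)
  have "even ?x = b" by auto
  moreover have "\<not> Suc ?x \<le> 1" by auto
  ultimately show ?case
    unfolding upt foldr.simps foldr_map comp_def half
    using Cons.IH[OF K(2)] by (simp del: nat_of_str.simps)
qed

lemma trec_str_foldr [trec_intros]:
  assumes k: "trec n k" and a: "trec n a"
    and h: "trec (Suc (Suc n)) (\<lambda>ys. h (ys ! 0 = 1) (ys ! 1) (drop 2 ys))"
  shows "trec n (\<lambda>xs. foldr (\<lambda>b acc. h b acc xs) (str_of_nat (k xs)) (a xs))"
proof -
  define e where "e ys = Suc (k (drop 2 ys)) div 2 ^ (ys ! 0) - 1" for ys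
  have k2: "trec (2 + n) (\<lambda>ys. k (drop 2 ys))"
    using trec_append_params[of "[]" n k 2] k by simp
  have lift: "trec (Suc (Suc n)) (\<lambda>ys. f (drop 2 ys))" if "trec n f" for f
    using trec_append_params[of "[]" n f 2] that by simp
  have "trec (2 + n) (\<lambda>ys. (\<lambda>ys. h (ys ! 0 = 1) (ys ! 1) (drop 2 ys))
       (map (\<lambda>f. f ys) [\<lambda>ys. of_bool (even (e ys)), \<lambda>ys. ys ! 1] @ drop 2 ys))"
  proof (rule trec_append_params)
    have "trec (2 + n) (\<lambda>ys. of_bool (even (e ys)))"
      "trec (2 + n) (\<lambda>ys. ys ! 1)"
      unfolding e_def by (intro trec_intros k2; simp)+
    then show "trec (2 + n) f"
      if "f \<in> set [\<lambda>ys. of_bool (even (e ys)), \<lambda>ys. ys ! 1]" for f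
      using that by (auto simp only: set_simps insert_iff empty_iff)
  qed (use h in simp)
  then have "trec (Suc (Suc n)) (\<lambda>ys. h (even (e ys)) (ys ! 1) (drop 2 ys))"
    by (simp add: of_bool_eq_1_iff[where 'a = nat, unfolded One_nat_def])
  note this[unfolded e_def]
  then have "trec n (\<lambda>xs. foldr (\<lambda>i acc. if Suc (k xs) div 2 ^ i \<le> 1 then a xs
      else h (even (Suc (k xs) div 2 ^ i - 1)) acc xs) [0..<k xs] (a xs))"
    by (intro trec_intros k a) (auto intro!: trec_intros lift k a)
  moreover have "foldr (\<lambda>i acc. if Suc (k xs) div 2 ^ i \<le> 1 then a xs
      else h (even (Suc (k xs) div 2 ^ i - 1)) acc xs) [0..<k xs] (a xs)
    = foldr (\<lambda>b acc. h b acc xs) (str_of_nat (k xs)) (a xs)" for xs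
    using foldr_bits[of "str_of_nat (k xs)" "k xs" "a xs" "\<lambda>b acc. h b acc xs"]
      length_le_nat_of_str[of "str_of_nat (k xs)"] unfolding str_of_nat_inverse by simp
  ultimately show ?thesis by simp
qed

lemma trec_length_str [trec_intros]: "trec n k \<Longrightarrow> trec n (\<lambda>xs. length (str_of_nat (k xs)))"
proof -
  assume "trec n k"
  then have "trec n (\<lambda>xs. foldr (\<lambda>b acc. Suc acc) (str_of_nat (k xs)) 0)"
    by (intro trec_intros) auto
  moreover have "foldr (\<lambda>b acc. Suc acc) s 0 = length s" for s :: "bool list"
    by (induction s) auto
  ultimately show ?thesis by simp
qed

lemma trec_drop_str [trec_intros]:
  "trec n k \<Longrightarrow> trec n i \<Longrightarrow> trec n (\<lambda>xs. nat_of_str (drop (i xs) (str_of_nat (k xs))))"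
  unfolding nat_of_str_drop by (intro trec_intros)
    (auto intro: trec_intros)

lemma length_code_str: "length (code_str s) = 2 * length s + 1"
  unfolding code_str_def by (induction s) auto

lemma nat_of_str_code_str:
  "nat_of_str (code_str s) = foldr (\<lambda>b acc. 4 * acc + (if b then 6 else 4)) s 1"
  unfolding code_str_def by (induction s) auto

lemma trec_code_str [trec_intros]:
  "trec n k \<Longrightarrow> trec n (\<lambda>xs. nat_of_str (code_str (str_of_nat (k xs))))"
  unfolding nat_of_str_code_str by (intro trec_intros) auto

lemma code_set_Collect:
  "code_set {s. nat_of_str s < K \<and> p (nat_of_str s)}
     = concat (map (code_str \<circ> str_of_nat) (filter p [0..<K]))"
proof -
  have "nat_of_str ` {s. nat_of_str s < K \<and> p (nat_of_str s)} = {x. x < K \<and> p x}"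
    by (force intro: image_eqI[of _ _ "str_of_nat _"])
  then have "nat_of_str ` {s. nat_of_str s < K \<and> p (nat_of_str s)} = set (filter p [0..<K])"
    by auto
  moreover have "sorted_list_of_set (set (filter p [0..<K])) = filter p [0..<K]"
    by (rule sorted_list_of_set.idem_if_sorted_distinct) (auto intro: sorted_wrt_filter)
  ultimately show ?thesis unfolding code_set_def by metis
qed

lemma length_code_set_Collect:
  "length (code_set {s. nat_of_str s < K \<and> p (nat_of_str s)})
     = (\<Sum>x<K. if p x then 2 * length (str_of_nat x) + 1 else 0)"
  unfolding code_set_Collect by (induction K) (auto simp: length_code_str)

lemma nat_of_str_code_set_Collect:
  "nat_of_str (code_set {s. nat_of_str s < K \<and> p (nat_of_str s)})
     = foldr (\<lambda>x acc. if p x then nat_of_str (code_str (str_of_nat x))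
         + 2 ^ (2 * length (str_of_nat x) + 1) * acc else acc) [0..<K] 0"
proof -
  have "nat_of_str (concat (map (code_str \<circ> str_of_nat) (filter p l)))
    = foldr (\<lambda>x acc. if p x then nat_of_str (code_str (str_of_nat x))
         + 2 ^ (2 * length (str_of_nat x) + 1) * acc else acc) l 0" for l
    by (induction l) (auto simp: nat_of_str_append length_code_str)
  then show ?thesis unfolding code_set_Collect .
qed

lemma trec_prod_encode [trec_intros]:
  "trec n f \<Longrightarrow> trec n g \<Longrightarrow> trec n (\<lambda>xs. prod_encode (f xs, g xs))"
  unfolding prod_encode_def triangle_def by (simp, intro trec_intros)

lemma sum_of_bool_eq_mult: "finite A \<Longrightarrow> a \<in> A \<Longrightarrow> (\<Sum>x\<in>A. of_bool (x = a) * g x) = (g a :: nat)"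
  by (simp add: of_bool_def if_distrib[of "\<lambda>c. c * _"] cong: if_cong)

lemma trec_prod_decode [trec_intros]:
  assumes "trec n f"
  shows "trec n (\<lambda>xs. fst (prod_decode (f xs)))" "trec n (\<lambda>xs. snd (prod_decode (f xs)))"
proof -
  have sum: "(\<Sum>a<Suc z. \<Sum>b<Suc z. of_bool (prod_encode (a, b) = z) * h a b)
      = h (fst (prod_decode z)) (snd (prod_decode z))" for z and h :: "nat \<Rightarrow> nat \<Rightarrow> nat"
  proof -
    obtain a b where ab: "prod_decode z = (a, b)" by force
    then have z: "z = prod_encode (a, b)" by (metis prod_decode_inverse)
    have "(\<Sum>p\<in>{..<Suc z} \<times> {..<Suc z}. of_bool (p = (a, b)) * h (fst p) (snd p)) = h a b"
      using sum_of_bool_eq_mult[of "{..<Suc z} \<times> {..<Suc z}" "(a, b)" "\<lambda>p. h (fst p) (snd p)"]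
        le_prod_encode_1[of a b] le_prod_encode_2[of b a] z by (simp add: less_Suc_eq_le)
    moreover have "(\<Sum>x<Suc z. \<Sum>y<Suc z. of_bool (prod_encode (x, y) = z) * h x y)
        = (\<Sum>p\<in>{..<Suc z} \<times> {..<Suc z}. of_bool (p = (a, b)) * h (fst p) (snd p))"
      unfolding sum.cartesian_product by (rule sum.cong) (auto simp: z)
    ultimately show ?thesis unfolding ab by simp
  qed
  have "trec 1 (\<lambda>xs. \<Sum>a<Suc (xs ! 0). \<Sum>b<Suc (xs ! 0). of_bool (prod_encode (a, b) = xs ! 0) * a)"
    "trec 1 (\<lambda>xs. \<Sum>a<Suc (xs ! 0). \<Sum>b<Suc (xs ! 0). of_bool (prod_encode (a, b) = xs ! 0) * b)"
    by (intro trec_intros; simp)+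
  then have "trec 1 (\<lambda>xs. fst (prod_decode (xs ! 0)))" "trec 1 (\<lambda>xs. snd (prod_decode (xs ! 0)))"
    using sum[where h = "\<lambda>a b. a"] sum[where h = "\<lambda>a b. b"] by simp_all
  then show "trec n (\<lambda>xs. fst (prod_decode (f xs)))" "trec n (\<lambda>xs. snd (prod_decode (f xs)))"
    using trec_comp1[of "\<lambda>z. fst (prod_decode z)"] trec_comp1[of "\<lambda>z. snd (prod_decode z)"] assms
    by blast+
qed

lemma trec_list_encode:
  "(\<And>f. f \<in> set fs \<Longrightarrow> trec n f) \<Longrightarrow> trec n (\<lambda>xs. list_encode (map (\<lambda>f. f xs) fs))"
  by (induction fs) (auto intro!: trec_intros)

definition code_nth :: "nat \<Rightarrow> nat \<Rightarrow> nat" where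
  "code_nth i z = fst (prod_decode (((\<lambda>z. snd (prod_decode (z - 1))) ^^ i) z - 1))"

lemma code_nth_list_encode: "i < length l \<Longrightarrow> code_nth i (list_encode l) = l ! i"
proof -
  assume i: "i < length l"
  then have "((\<lambda>z. snd (prod_decode (z - 1))) ^^ i) (list_encode l) = list_encode (drop i l)"
  proof (induction i)
    case (Suc i)
    then show ?case by (simp add: Cons_nth_drop_Suc[symmetric])
  qed simp
  then show ?thesis using i by (simp add: code_nth_def Cons_nth_drop_Suc[symmetric])
qed

lemma trec_code_nth [trec_intros]: "trec n f \<Longrightarrow> trec n (\<lambda>xs. code_nth i (f xs))"
proof -
  assume f: "trec n f"
  have "trec n (\<lambda>xs. ((\<lambda>z. snd (prod_decode (z - 1))) ^^ i) (f xs))"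
    by (induction i) (auto intro!: trec_intros f)
  then show ?thesis unfolding code_nth_def by (intro trec_intros)
qed

section \<open>Evaluation in stages\<close>

inductive_cases evals_ZeroE: "evals Zero xs y"
inductive_cases evals_SuccE: "evals Succ xs y"
inductive_cases evals_ProjE: "evals (Proj i) xs y"
inductive_cases evals_CompE: "evals (Comp h gs) xs y"
inductive_cases evals_PrimRec0E: "evals (PrimRec g h) (0 # xs) y"
inductive_cases evals_PrimRecSucE: "evals (PrimRec g h) (Suc n # xs) y"
inductive_cases evals_PrimRecNilE: "evals (PrimRec g h) [] y"
inductive_cases evals_MuE: "evals (Mu g) xs y"

lemma evals_determ: "evals g xs y \<Longrightarrow> evals g xs z \<Longrightarrow> y = z"
proof (induction g xs y arbitrary: z rule: evals.induct)
  case (evals_Comp xs gs ys h w)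
  from evals_Comp.prems obtain zs where
    zs: "list_all2 (\<lambda>g y. evals g xs y) gs zs" "evals h zs z"
    by (rule evals_CompE)
  have "ys = zs"
  proof (rule nth_equalityI)
    show "length ys = length zs"
      using evals_Comp.IH(1) zs(1) by (simp add: list_all2_conv_all_nth)
    show "ys ! i = zs ! i" if "i < length ys" for i
      using evals_Comp.IH(1) zs(1) that by (simp add: list_all2_conv_all_nth)
  qed
  with zs evals_Comp.IH(2) show ?case by blast
next
  case (evals_PrimRec_Suc g h n xs r y)
  from evals_PrimRec_Suc.prems obtain r' where
    "evals (PrimRec g h) (n # xs) r'" "evals h (n # r' # xs) z"
    by (rule evals_PrimRecSucE)
  with evals_PrimRec_Suc.IH show ?case by blast
next
  case (evals_Mu g n xs)
  from evals_Mu.prems have z: "evals g (z # xs) 0" "\<forall>m<z. \<exists>w. evals g (m # xs) (Suc w)"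
    by (auto elim: evals_MuE)
  show ?case
  proof (rule linorder_cases[of n z])
    assume "n < z"
    with z evals_Mu.IH(1) show ?thesis by fastforce
  next
    assume "z < n"
    with z evals_Mu.IH(2) show ?thesis by fastforce
  qed
qed (blast elim: evals_ZeroE evals_SuccE evals_ProjE evals_PrimRec0E)+

text \<open>
  \<open>stages g k T\<close>: within \<open>t\<close> stages, the value at \<open>t # xs\<close> is 0 while \<open>g\<close> has not been seen
  to be defined at \<open>xs\<close>, and the successor of the value of \<open>g\<close> from then on.
\<close>

definition stages :: "recf \<Rightarrow> nat \<Rightarrow> (nat list \<Rightarrow> nat) \<Rightarrow> bool" where
  "stages g k T \<longleftrightarrow> trec (Suc k) T \<and>
     (\<forall>xs. length xs = k \<longrightarrow>
        (\<forall>t t' y. T (t # xs) = Suc y \<longrightarrow> t \<le> t' \<longrightarrow> T (t' # xs) = Suc y) \<and>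
        (\<forall>y. evals g xs y \<longleftrightarrow> (\<exists>t. T (t # xs) = Suc y)))"

lemma stagesI:
  assumes "trec (Suc k) T"
    and "\<And>xs t t' y. length xs = k \<Longrightarrow> T (t # xs) = Suc y \<Longrightarrow> t \<le> t' \<Longrightarrow> T (t' # xs) = Suc y"
    and "\<And>xs t y. length xs = k \<Longrightarrow> T (t # xs) = Suc y \<Longrightarrow> evals g xs y"
    and "\<And>xs y. length xs = k \<Longrightarrow> evals g xs y \<Longrightarrow> \<exists>t. T (t # xs) = Suc y"
  shows "stages g k T"
  unfolding stages_def using assms by blast

lemma stages_trec: "stages g k T \<Longrightarrow> trec (Suc k) T"
  and stages_mono: "stages g k T \<Longrightarrow> length xs = k \<Longrightarrow> T (t # xs) = Suc y \<Longrightarrow> t \<le> t' \<Longrightarrow> T (t' # xs) = Suc y"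
  and stages_sound: "stages g k T \<Longrightarrow> length xs = k \<Longrightarrow> T (t # xs) = Suc y \<Longrightarrow> evals g xs y"
  and stages_complete: "stages g k T \<Longrightarrow> length xs = k \<Longrightarrow> evals g xs y \<Longrightarrow> \<exists>t. T (t # xs) = Suc y"
  unfolding stages_def by blast+

lemma trec_drop_params:
  assumes "trec (length fs + n) F" "\<And>f. f \<in> set fs \<Longrightarrow> trec m f" "m = k + n"
  shows "trec m (\<lambda>ys. F (map (\<lambda>f. f ys) fs @ drop k ys))"
  using trec_append_params[of fs n F k] assms by simp

lemma stages_Zero: "stages Zero k (\<lambda>_. 1)"
  by (rule stagesI) (auto intro: evals.intros trec_const elim: evals_ZeroE)

lemma stages_Succ: "\<exists>T. stages Succ k T"
proof (cases "k = 1")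
  case True
  have "stages Succ k (\<lambda>ys. Suc (Suc (ys ! 1)))"
  proof (rule stagesI)
    show "trec (Suc k) (\<lambda>ys. Suc (Suc (ys ! 1)))" using True by (intro trec_intros) simp
    show "length xs = k \<Longrightarrow> Suc (Suc ((t # xs) ! 1)) = Suc y \<Longrightarrow> evals Succ xs y" for xs t y
      using True evals_Succ by (cases xs) auto
  qed (auto elim: evals_SuccE)
  then show ?thesis by (rule exI[where P = "stages Succ k"])
next
  case False
  have "stages Succ k (\<lambda>ys. 0)"
    by (rule stagesI) (use False in \<open>auto elim: evals_SuccE intro: trec_const\<close>)
  then show ?thesis by (rule exI[where P = "stages Succ k"])
qed

lemma stages_Proj: "\<exists>T. stages (Proj i) k T"
proof (cases "i < k")
  case True
  have "stages (Proj i) k (\<lambda>ys. Suc (ys ! Suc i))"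
  proof (rule stagesI)
    show "trec (Suc k) (\<lambda>ys. Suc (ys ! Suc i))" using True by (intro trec_intros) simp
  qed (use True evals_Proj in \<open>auto elim: evals_ProjE\<close>)
  then show ?thesis by (rule exI[where P = "stages (Proj i) k"])
next
  case False
  have "stages (Proj i) k (\<lambda>ys. 0)"
    by (rule stagesI) (use False in \<open>auto elim: evals_ProjE intro: trec_const\<close>)
  then show ?thesis by (rule exI[where P = "stages (Proj i) k"])
qed

lemma trecp_Ball: "finite A \<Longrightarrow> (\<And>a. a \<in> A \<Longrightarrow> trecp n (P a)) \<Longrightarrow> trecp n (\<lambda>xs. \<forall>a\<in>A. P a xs)"
proof (induction A rule: finite_induct)
  case empty
  then show ?case using trec_const[of n 1] by (simp add: trecp_def)
next
  case (insert a A)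
  then show ?case using trecp_conj[of n "P a" "\<lambda>xs. \<forall>a\<in>A. P a xs"] by simp
qed

lemma stages_Comp:
  assumes gs: "\<And>g. g \<in> set gs \<Longrightarrow> \<exists>T. stages g k T" and h: "\<exists>T. stages h (length gs) T"
  shows "\<exists>T. stages (Comp h gs) k T"
proof -
  obtain Th where Th: "stages h (length gs) Th" using h by blast
  obtain G where G: "\<And>g. g \<in> set gs \<Longrightarrow> stages g k (G g)" using gs by metis
  have trG: "trec (Suc k) (G g)" if "g \<in> set gs" for g by (rule stages_trec[OF G[OF that]])
  let ?v = "\<lambda>ys. ys ! 0 # map (\<lambda>g. G g ys - 1) gs"
  let ?T = "\<lambda>ys. if \<forall>g\<in>set gs. G g ys \<noteq> 0 then Th (?v ys) else 0"
  have "stages (Comp h gs) k ?T"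
  proof (rule stagesI)
    have "trec (Suc k) (\<lambda>ys. Th (map (\<lambda>f. f ys) ((\<lambda>ys. ys ! 0) # map (\<lambda>g ys. G g ys - 1) gs)))"
    proof (rule trec_comp)
      show "trec (Suc k) f" if "f \<in> set ((\<lambda>ys. ys ! 0) # map (\<lambda>g ys. G g ys - 1) gs)" for f
        using that by (auto intro!: trec_nth trec_diff trec_const trG)
    qed (use stages_trec[OF Th] in simp)
    then show "trec (Suc k) ?T"
      by (intro trec_if trecp_Ball trecp_not trecp_eq trec_const trG) (simp_all add: comp_def)
  next
    fix xs t t' y
    assume xs: "length xs = k" "?T (t # xs) = Suc y" "t \<le> t'"
    then have pos: "\<forall>g\<in>set gs. G g (t # xs) \<noteq> 0" by (simp split: if_splits)
    have eq: "G g (t' # xs) = G g (t # xs)" if g: "g \<in> set gs" for g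
    proof -
      obtain z where z: "G g (t # xs) = Suc z" using not0_implies_Suc[OF bspec[OF pos g]] by blast
      then show ?thesis using stages_mono[OF G[OF g] xs(1) z xs(3)] by simp
    qed
    have "Th (t # map (\<lambda>g. G g (t # xs) - 1) gs) = Suc y" using xs(2) pos by (simp split: if_splits)
    then have "Th (t' # map (\<lambda>g. G g (t # xs) - 1) gs) = Suc y"
      using stages_mono[OF Th _ _ xs(3)] by simp
    moreover have "map (\<lambda>g. G g (t' # xs) - 1) gs = map (\<lambda>g. G g (t # xs) - 1) gs"
      using eq by simp
    ultimately show "?T (t' # xs) = Suc y" using pos eq by (simp cong: map_cong)
  next
    fix xs t y
    assume xs: "length xs = k" "?T (t # xs) = Suc y"
    then have pos: "\<forall>g\<in>set gs. G g (t # xs) \<noteq> 0" by (simp split: if_splits)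
    show "evals (Comp h gs) xs y"
    proof (rule evals_Comp)
      show "list_all2 (\<lambda>g y. evals g xs y) gs (map (\<lambda>g. G g (t # xs) - 1) gs)"
        unfolding list_all2_conv_all_nth using pos
        by (auto intro!: stages_sound[OF G xs(1), of _ t])
      show "evals h (map (\<lambda>g. G g (t # xs) - 1) gs) y"
        by (rule stages_sound[OF Th, of _ t]) (use xs pos in auto)
    qed
  next
    fix xs y
    assume xs: "length xs = k" and "evals (Comp h gs) xs y"
    then obtain ys where ys: "list_all2 (\<lambda>g y. evals g xs y) gs ys" "evals h ys y"
      by (auto elim: evals_CompE)
    then have len: "length ys = length gs" by (simp add: list_all2_lengthD)
    obtain t0 where t0: "Th (t0 # ys) = Suc y" using stages_complete[OF Th len ys(2)] by blast
    have "\<forall>i<length gs. \<exists>t. G (gs ! i) (t # xs) = Suc (ys ! i)"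
      using ys(1) xs stages_complete[OF G] by (auto simp: list_all2_conv_all_nth)
    then obtain \<tau> where \<tau>: "\<And>i. i < length gs \<Longrightarrow> G (gs ! i) (\<tau> i # xs) = Suc (ys ! i)" by metis
    let ?t = "t0 + (\<Sum>i<length gs. \<tau> i)"
    have val: "G (gs ! i) (?t # xs) = Suc (ys ! i)" if "i < length gs" for i
      by (rule stages_mono[OF G[OF nth_mem[OF that]] xs \<tau>[OF that]])
        (use that in \<open>auto intro: trans_le_add2 member_le_sum\<close>)
    then have "\<forall>g\<in>set gs. G g (?t # xs) \<noteq> 0" by (auto simp: in_set_conv_nth)
    moreover have "map (\<lambda>g. G g (?t # xs) - 1) gs = ys"
      using val len by (intro nth_equalityI) auto
    moreover have "Th (?t # ys) = Suc y" using stages_mono[OF Th len t0] by simp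
    ultimately show "\<exists>t. ?T (t # xs) = Suc y" by (intro exI[of _ ?t]) simp
  qed
  then show ?thesis by (rule exI[where P = "stages (Comp h gs) k"])
qed

lemma stages_PrimRec:
  assumes "\<And>k. \<exists>T. stages g k T" "\<And>k. \<exists>T. stages h k T"
  shows "\<exists>T. stages (PrimRec g h) k T"
proof (cases k)
  case 0
  have "stages (PrimRec g h) k (\<lambda>ys. 0)"
    by (rule stagesI) (use 0 in \<open>auto elim: evals_PrimRecNilE intro: trec_const\<close>)
  then show ?thesis by (rule exI[where P = "stages (PrimRec g h) k"])
next
  case (Suc n)
  obtain G where G: "stages g n G" using assms by blast
  obtain H where H: "stages h (Suc (Suc n)) H" using assms by blast
  define R where "R t xs = rec_nat (G (t # xs)) (\<lambda>m r. if r = 0 then 0 else H (t # m # (r - 1) # xs))" for t xs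
  have R: "R t xs 0 = G (t # xs)" "R t xs (Suc m) = (if R t xs m = 0 then 0 else H (t # m # (R t xs m - 1) # xs))" for t xs m
    by (simp_all add: R_def)
  let ?T = "\<lambda>ys. R (ys ! 0) (drop 2 ys) (ys ! 1)"
  have "stages (PrimRec g h) k ?T"
  proof (rule stagesI)
    have "trec (Suc k) (\<lambda>ys. G (map (\<lambda>f. f ys) [\<lambda>ys. ys ! 0] @ drop 2 ys))"
      by (rule trec_drop_params[of _ n]) (use stages_trec[OF G] Suc in \<open>auto intro: trec_nth\<close>)
    then have g: "trec (Suc k) (\<lambda>ys. G (ys ! 0 # drop 2 ys))" by simp
    have "trec (Suc (Suc (Suc k))) (\<lambda>zs. H (map (\<lambda>f. f zs)
        [\<lambda>zs. zs ! 2, \<lambda>zs. zs ! 0, \<lambda>zs. zs ! 1 - 1] @ drop 4 zs))"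
      by (rule trec_drop_params[of _ n])
        (use stages_trec[OF H] Suc in \<open>auto intro!: trec_nth trec_diff trec_const simp del: One_nat_def\<close>)
    then have h: "trec (Suc (Suc (Suc k)))
        (\<lambda>zs. if zs ! 1 = 0 then 0 else H (drop 2 zs ! 0 # zs ! 0 # (zs ! 1 - 1) # drop 2 (drop 2 zs)))"
      by (intro trec_if trecp_eq trec_nth trec_const) (auto elim: trec_cong)
    have "trec (Suc k) (\<lambda>ys. rec_nat (G (ys ! 0 # drop 2 ys))
       (\<lambda>m r. if r = 0 then 0 else H (ys ! 0 # m # (r - 1) # drop 2 ys)) (ys ! 1))"
      by (rule trec_rec[OF _ g h]) (use Suc in \<open>simp add: trec_nth\<close>)
    then show "trec (Suc k) ?T" unfolding R_def .
  next
    fix xs t t' y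
    assume xs: "length xs = k" "?T (t # xs) = Suc y" "t \<le> t'"
    then obtain m zs where zs: "xs = m # zs" "length zs = n" using Suc by (cases xs) auto
    have "R t zs m = Suc y \<Longrightarrow> R t' zs m = Suc y" for m y
    proof (induction m arbitrary: y)
      case 0
      then show ?case using stages_mono[OF G zs(2) _ xs(3)] by (simp add: R)
    next
      case (Suc m)
      then obtain r where r: "R t zs m = Suc r" by (cases "R t zs m") (auto simp: R)
      with Suc.IH have "R t' zs m = Suc r" by blast
      with r Suc.prems show ?case using stages_mono[OF H _ _ xs(3)] zs by (simp add: R)
    qed
    then show "?T (t' # xs) = Suc y" using xs zs by simp
  next
    fix xs t y
    assume xs: "length xs = k" "?T (t # xs) = Suc y"
    then obtain m zs where zs: "xs = m # zs" "length zs = n" using Suc by (cases xs) auto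
    have "R t zs m = Suc y \<Longrightarrow> evals (PrimRec g h) (m # zs) y" for m y
    proof (induction m arbitrary: y)
      case 0
      then show ?case using stages_sound[OF G zs(2)] by (auto simp: R intro: evals_PrimRec_0)
    next
      case (Suc m)
      then obtain r where r: "R t zs m = Suc r" by (cases "R t zs m") (auto simp: R)
      with Suc.prems have "H (t # m # r # zs) = Suc y" by (simp add: R)
      then have "evals h (m # r # zs) y" using stages_sound[OF H] zs by simp
      with Suc.IH[OF r] show ?case by (rule evals_PrimRec_Suc)
    qed
    then show "evals (PrimRec g h) xs y" using xs zs by simp
  next
    fix xs y
    assume xs: "length xs = k" "evals (PrimRec g h) xs y"
    then obtain m zs where zs: "xs = m # zs" "length zs = n" using Suc by (cases xs) auto
    have mono: "R t' zs m = Suc y" if "R t zs m = Suc y" "t \<le> t'" for t t' m y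
      using that(1)
    proof (induction m arbitrary: y)
      case 0
      then show ?case using stages_mono[OF G zs(2) _ that(2)] by (simp add: R)
    next
      case (Suc m)
      then obtain r where r: "R t zs m = Suc r" by (cases "R t zs m") (auto simp: R)
      with Suc.IH have "R t' zs m = Suc r" by blast
      with r Suc.prems show ?case using stages_mono[OF H _ _ that(2)] zs by (simp add: R)
    qed
    have "evals (PrimRec g h) (m # zs) y \<Longrightarrow> \<exists>t. R t zs m = Suc y" for m y
    proof (induction m arbitrary: y)
      case 0
      then show ?case using stages_complete[OF G zs(2)] by (auto simp: R elim: evals_PrimRec0E)
    next
      case (Suc m)
      from Suc.prems obtain r where r: "evals (PrimRec g h) (m # zs) r" "evals h (m # r # zs) y"
        by (rule evals_PrimRecSucE)
      obtain t1 where t1: "R t1 zs m = Suc r" using Suc.IH r by blast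
      obtain t2 where t2: "H (t2 # m # r # zs) = Suc y"
        using stages_complete[OF H _ r(2)] zs by auto
      have "R (t1 + t2) zs m = Suc r" using mono[OF t1] by simp
      moreover have "H ((t1 + t2) # m # r # zs) = Suc y"
        using stages_mono[OF H _ t2] zs by simp
      ultimately have "R (t1 + t2) zs (Suc m) = Suc y" by (simp add: R)
      then show ?case ..
    qed
    then show "\<exists>t. ?T (t # xs) = Suc y" using xs zs by simp
  qed
  then show ?thesis by (rule exI[where P = "stages (PrimRec g h) k"])
qed

lemma foldr_search:
  "foldr (\<lambda>i acc. if v i = 0 then 0 else if v i = Suc 0 then Suc i else acc) [a..<b] 0 = Suc n \<longleftrightarrow>
     a \<le> n \<and> n < b \<and> v n = Suc 0 \<and> (\<forall>i\<ge>a. i < n \<longrightarrow> 1 < v i)"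
  for v :: "nat \<Rightarrow> nat"
proof (induction "b - a" arbitrary: a)
  case 0
  then show ?case by auto
next
  case (Suc d)
  then have upt: "[a..<b] = a # [Suc a..<b]" by (simp add: upt_conv_Cons)
  have IH: "foldr (\<lambda>i acc. if v i = 0 then 0 else if v i = Suc 0 then Suc i else acc) [Suc a..<b] 0 = Suc n \<longleftrightarrow>
     Suc a \<le> n \<and> n < b \<and> v n = Suc 0 \<and> (\<forall>i\<ge>Suc a. i < n \<longrightarrow> 1 < v i)"
    using Suc by simp
  have split: "(\<forall>i\<ge>a. i < n \<longrightarrow> 1 < v i) \<longleftrightarrow> (a < n \<longrightarrow> 1 < v a) \<and> (\<forall>i\<ge>Suc a. i < n \<longrightarrow> 1 < v i)"
    by (metis Suc_leD Suc_leI le_neq_implies_less order_refl)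
  show ?case
  proof (cases "v a \<le> 1")
    case True
    then have "v a = 0 \<or> v a = 1" by auto
    then show ?thesis unfolding upt split using Suc(2) by (cases "a = n") auto
  next
    case False
    then show ?thesis unfolding upt split using IH by (cases "a = n") auto
  qed
qed

lemma stages_Mu:
  assumes "\<And>k. \<exists>T. stages g k T"
  shows "\<exists>T. stages (Mu g) k T"
proof -
  obtain G where G: "stages g (Suc k) G" using assms by blast
  define S where "S t xs = foldr (\<lambda>i acc. if G (t # i # xs) = 0 then 0
     else if G (t # i # xs) = Suc 0 then Suc i else acc) [0..<t] 0" for t xs
  let ?T = "\<lambda>ys. S (ys ! 0) (drop 1 ys)"
  have T: "?T (t # xs) = Suc n \<longleftrightarrow> n < t \<and> G (t # n # xs) = Suc 0 \<and> (\<forall>i<n. 1 < G (t # i # xs))" for t xs n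
    using foldr_search[of "\<lambda>i. G (t # i # xs)" 0 t n] by (simp add: S_def)
  have "stages (Mu g) k ?T"
  proof (rule stagesI)
    have "trec (Suc (Suc (Suc k))) (\<lambda>zs. G (map (\<lambda>f. f zs) [\<lambda>zs. zs ! 2, \<lambda>zs. zs ! 0] @ drop 3 zs))"
      by (rule trec_drop_params[of _ k])
        (use stages_trec[OF G] in \<open>auto intro!: trec_nth\<close>)
    then have "trec (Suc (Suc (Suc k))) (\<lambda>zs. G (drop 2 zs ! 0 # zs ! 0 # drop 1 (drop 2 zs)))"
      by (rule trec_cong) (simp add: numeral_3_eq_3)
    then show "trec (Suc k) ?T" unfolding S_def
      by (intro trec_intros) simp_all
  next
    fix xs t t' y
    assume xs: "length xs = k" "?T (t # xs) = Suc y" "t \<le> t'"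
    have "1 < G (t' # i # xs)" if "1 < G (t # i # xs)" for i
    proof -
      from that have z: "G (t # i # xs) = Suc (Suc (G (t # i # xs) - 2))" by linarith
      show ?thesis using stages_mono[OF G _ z xs(3)] xs by simp
    qed
    then show "?T (t' # xs) = Suc y"
      using xs(1,2,3) stages_mono[OF G _ _ xs(3), of "y # xs" 0] unfolding T by auto
  next
    fix xs t y
    assume xs: "length xs = k" "?T (t # xs) = Suc y"
    show "evals (Mu g) xs y"
    proof (rule evals_Mu)
      show "evals g (y # xs) 0" using xs stages_sound[OF G] unfolding T by auto
      show "\<forall>m<y. \<exists>z. evals g (m # xs) (Suc z)"
      proof (intro allI impI)
        fix m assume "m < y"
        then have "1 < G (t # m # xs)" using xs(2) unfolding T by auto
        then have "G (t # m # xs) = Suc (Suc (G (t # m # xs) - 2))" by linarith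
        then have "evals g (m # xs) (Suc (G (t # m # xs) - 2))"
          by (rule stages_sound[OF G, rotated]) (simp add: xs(1))
        then show "\<exists>z. evals g (m # xs) (Suc z)" ..
      qed
    qed
  next
    fix xs y
    assume xs: "length xs = k" and "evals (Mu g) xs y"
    then have ev: "evals g (y # xs) 0" "\<forall>m<y. \<exists>z. evals g (m # xs) (Suc z)"
      by (auto elim: evals_MuE)
    obtain t0 where t0: "G (t0 # y # xs) = Suc 0" using stages_complete[OF G _ ev(1)] xs by auto
    have "\<forall>m<y. \<exists>t z. G (t # m # xs) = Suc (Suc z)"
    proof (intro allI impI)
      fix m assume "m < y"
      then obtain z where z: "evals g (m # xs) (Suc z)" using ev(2) by blast
      have "\<exists>t. G (t # m # xs) = Suc (Suc z)"
        by (rule stages_complete[OF G _ z]) (simp add: xs)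
      then show "\<exists>t z. G (t # m # xs) = Suc (Suc z)" by blast
    qed
    then obtain \<tau> \<zeta> where \<tau>: "\<And>m. m < y \<Longrightarrow> G (\<tau> m # m # xs) = Suc (Suc (\<zeta> m))" by metis
    let ?t = "Suc y + t0 + (\<Sum>i<y. \<tau> i)"
    have "1 < G (?t # m # xs)" if "m < y" for m
    proof -
      have "\<tau> m \<le> (\<Sum>i<y. \<tau> i)" using that by (auto intro: member_le_sum)
      then have "\<tau> m \<le> ?t" by simp
      then show ?thesis using stages_mono[OF G _ \<tau>[OF that]] xs by simp
    qed
    moreover have "G (?t # y # xs) = Suc 0" using stages_mono[OF G _ t0] xs by simp
    ultimately have "?T (?t # xs) = Suc y" unfolding T by simp
    then show "\<exists>t. ?T (t # xs) = Suc y" ..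
  qed
  then show ?thesis by (rule exI[where P = "stages (Mu g) k"])
qed

lemma ex_stages: "\<exists>T. stages g k T"
proof (induction g arbitrary: k)
  case Zero
  show ?case using stages_Zero by blast
next
  case (Comp h gs)
  then show ?case by (intro stages_Comp) auto
next
  case Succ
  show ?case by (rule stages_Succ)
next
  case (Proj i)
  show ?case by (rule stages_Proj)
next
  case (PrimRec g h)
  then show ?case by (rule stages_PrimRec)
next
  case (Mu g)
  then show ?case by (rule stages_Mu)
qed

lemma partial_recursive_stages:
  assumes "partial_recursive F"
  obtains T :: "nat \<Rightarrow> nat \<Rightarrow> nat"
  where "trec 2 (\<lambda>xs. T (xs ! 0) (xs ! 1))"
    and "\<And>x t t' y. T t x = Suc y \<Longrightarrow> t \<le> t' \<Longrightarrow> T t' x = Suc y"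
    and "\<And>x y. F x = Some y \<longleftrightarrow> (\<exists>t. T t x = Suc y)"
proof -
  obtain g where g: "\<And>x y. F x = Some y \<longleftrightarrow> evals g [x] y"
    using assms unfolding partial_recursive_def by blast
  obtain T where T: "stages g 1 T" using ex_stages by blast
  show ?thesis
  proof (rule that[of "\<lambda>t x. T [t, x]"])
    show "trec 2 (\<lambda>xs. T [xs ! 0, xs ! 1])"
    proof (rule trec_cong)
      show "trec 2 T" using stages_trec[OF T] by (simp add: numeral_2_eq_2)
      show "length xs = 2 \<Longrightarrow> T xs = T [xs ! 0, xs ! 1]" for xs
        by (auto simp: numeral_2_eq_2 length_Suc_conv)
    qed
    show "T [t, x] = Suc y \<Longrightarrow> t \<le> t' \<Longrightarrow> T [t', x] = Suc y" for x t t' y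
      by (rule stages_mono[OF T]) auto
    show "F x = Some y \<longleftrightarrow> (\<exists>t. T [t, x] = Suc y)" for x y
      unfolding g using stages_sound[OF T, of "[x]"] stages_complete[OF T, of "[x]"] by auto
  qed
qed

lemma ex_recf_search:
  assumes P: "trec (Suc n) P" and h: "trec (Suc n) h"
  obtains g where "\<And>xs y. length xs = n \<Longrightarrow>
    evals g xs y \<longleftrightarrow> (\<exists>t. P (t # xs) = 0 \<and> (\<forall>s<t. P (s # xs) \<noteq> 0) \<and> y = h (t # xs))"
proof -
  obtain p where p: "\<And>xs. length xs = Suc n \<Longrightarrow> evals p xs (P xs)"
    using P unfolding trec_def by blast
  obtain h' where h': "\<And>xs. length xs = Suc n \<Longrightarrow> evals h' xs (h xs)"
    using h unfolding trec_def by blast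
  let ?g = "Comp h' (Mu p # map Proj [0..<n])"
  have mu: "evals (Mu p) xs t \<longleftrightarrow> P (t # xs) = 0 \<and> (\<forall>s<t. P (s # xs) \<noteq> 0)" if xs: "length xs = n" for xs t
  proof
    assume "evals (Mu p) xs t"
    then have ev: "evals p (t # xs) 0" "\<forall>m<t. \<exists>z. evals p (m # xs) (Suc z)"
      by (auto elim: evals_MuE)
    have pe: "evals p (m # xs) (P (m # xs))" for m using p xs by simp
    show "P (t # xs) = 0 \<and> (\<forall>s<t. P (s # xs) \<noteq> 0)"
      using ev evals_determ[OF pe] by (metis nat.distinct(1))
  next
    assume t: "P (t # xs) = 0 \<and> (\<forall>s<t. P (s # xs) \<noteq> 0)"
    show "evals (Mu p) xs t"
    proof (rule evals_Mu)
      show "evals p (t # xs) 0" using p[of "t # xs"] t xs by simp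
      show "\<forall>m<t. \<exists>z. evals p (m # xs) (Suc z)"
      proof (intro allI impI)
        fix m assume "m < t"
        then have "Suc (P (m # xs) - 1) = P (m # xs)" using t by simp
        then have "evals p (m # xs) (Suc (P (m # xs) - 1))" using p[of "m # xs"] xs by simp
        then show "\<exists>z. evals p (m # xs) (Suc z)" by (rule exI)
      qed
    qed
  qed
  have "evals ?g xs y \<longleftrightarrow> (\<exists>t. evals (Mu p) xs t \<and> y = h (t # xs))" if xs: "length xs = n" for xs y
  proof
    assume "evals ?g xs y"
    then obtain ts where ts: "list_all2 (\<lambda>g y. evals g xs y) (Mu p # map Proj [0..<n]) ts" "evals h' ts y"
      by (rule evals_CompE)
    then obtain t us where us: "ts = t # us" "evals (Mu p) xs t"
      "list_all2 (\<lambda>g y. evals g xs y) (map Proj [0..<n]) us"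
      by (auto simp: list_all2_Cons1)
    have "us = xs"
    proof (rule nth_equalityI)
      show "length us = length xs" using us(3) xs by (auto dest: list_all2_lengthD)
      show "us ! i = xs ! i" if "i < length us" for i
        using us(3) that by (auto simp: list_all2_conv_all_nth elim: evals_ProjE)
    qed
    then have "y = h (t # xs)" using evals_determ[OF ts(2)] h'[of ts] us xs by simp
    with us show "\<exists>t. evals (Mu p) xs t \<and> y = h (t # xs)" by blast
  next
    assume "\<exists>t. evals (Mu p) xs t \<and> y = h (t # xs)"
    then obtain t where t: "evals (Mu p) xs t" "y = h (t # xs)" by blast
    show "evals ?g xs y"
    proof (rule evals_Comp)
      show "list_all2 (\<lambda>g y. evals g xs y) (Mu p # map Proj [0..<n]) (t # xs)"
        using t xs by (simp, auto simp: list_all2_conv_all_nth intro: evals_Proj)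
      show "evals h' (t # xs) y" using h' t xs by simp
    qed
  qed
  then show ?thesis by (intro that[of ?g]) (auto simp: mu)
qed

lemma partial_recursive_search:
  fixes P h :: "nat \<Rightarrow> nat \<Rightarrow> nat"
  assumes "trec 2 (\<lambda>xs. P (xs ! 0) (xs ! 1))" "trec 2 (\<lambda>xs. h (xs ! 0) (xs ! 1))"
  shows "partial_recursive (\<lambda>x. if \<exists>t. P t x = 0 then Some (h (LEAST t. P t x = 0) x) else None)"
proof -
  have tr: "trec (Suc 1) (\<lambda>xs. P (xs ! 0) (xs ! 1))" "trec (Suc 1) (\<lambda>xs. h (xs ! 0) (xs ! 1))"
    using assms by (simp_all add: numeral_2_eq_2)
  obtain g where g: "\<And>xs y. length xs = 1 \<Longrightarrow> evals g xs y \<longleftrightarrow>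
    (\<exists>t. P ((t # xs) ! 0) ((t # xs) ! 1) = 0 \<and> (\<forall>s<t. P ((s # xs) ! 0) ((s # xs) ! 1) \<noteq> 0)
      \<and> y = h ((t # xs) ! 0) ((t # xs) ! 1))"
    by (rule ex_recf_search[OF tr]) (rule that)
  have least: "(P t x = 0 \<and> (\<forall>s<t. P s x \<noteq> 0)) \<longleftrightarrow> (\<exists>t. P t x = 0) \<and> t = (LEAST t. P t x = 0)" for t x
  proof
    assume t: "P t x = 0 \<and> (\<forall>s<t. P s x \<noteq> 0)"
    have le: "t \<le> s" if "P s x = 0" for s using t that by (cases "s < t") auto
    have "(LEAST t. P t x = 0) = t"
      using t le by (blast intro: Least_equality)
    with t show "(\<exists>t. P t x = 0) \<and> t = (LEAST t. P t x = 0)" by auto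
  next
    assume t: "(\<exists>t. P t x = 0) \<and> t = (LEAST t. P t x = 0)"
    then have "P t x = 0" using LeastI_ex[of "\<lambda>t. P t x = 0"] by simp
    moreover have "P s x \<noteq> 0" if "s < t" for s
      using t that not_less_Least[of s "\<lambda>t. P t x = 0"] by simp
    ultimately show "P t x = 0 \<and> (\<forall>s<t. P s x \<noteq> 0)" by blast
  qed
  have "evals g [x] y \<longleftrightarrow> (\<exists>t. (P t x = 0 \<and> (\<forall>s<t. P s x \<noteq> 0)) \<and> y = h t x)" for x y
    using g[of "[x]" y] by simp
  then show ?thesis unfolding partial_recursive_def least
    by (intro exI[of _ g]) auto
qed

section \<open>Simulating an oracle machine with a one-element oracle\<close>

definition val :: "nat \<Rightarrow> nat list \<Rightarrow> nat" where
  "val S rs = foldr (\<lambda>d acc. d + S * acc) rs 0"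

lemma val_simps [simp]: "val S [] = 0" "val S (d # rs) = d + S * val S rs"
  by (simp_all add: val_def)

lemma val_mod: "set rs \<subseteq> {..<S} \<Longrightarrow> val S rs mod S = cell rs"
  by (cases rs) (auto simp: cell_def)

lemma val_div: "set rs \<subseteq> {..<S} \<Longrightarrow> val S rs div S = val S (tl rs)"
  by (cases rs) auto

definition word_of :: "nat \<Rightarrow> nat \<Rightarrow> nat" where
  "word_of S r = foldr (\<lambda>i acc. if r div S ^ i mod S = 1 \<or> r div S ^ i mod S = 2
     then r div S ^ i mod S + 2 * acc else 0) [0..<r] 0"

lemma trec_word_of [trec_intros]: "trec n f \<Longrightarrow> trec n (\<lambda>xs. word_of S (f xs))"
proof -
  assume f: "trec n f"
  have "trec 1 (\<lambda>xs. word_of S (xs ! 0))"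
    unfolding word_of_def by (intro trec_intros) simp_all
  from trec_comp1[of "word_of S", OF this f] show ?thesis .
qed

lemma word_of_val:
  assumes "set rs \<subseteq> {..<S}"
  shows "word_of S (val S rs) = nat_of_str (tape_word (ls, rs))"
proof -
  let ?tw = "takeWhile (\<lambda>x. x = 1 \<or> x = 2)"
  have fold: "foldr (\<lambda>i acc. if val S rs div S ^ i mod S = 1 \<or> val S rs div S ^ i mod S = 2
     then val S rs div S ^ i mod S + 2 * acc else 0) [0..<K] 0 = nat_of_str (map (\<lambda>x. x = 2) (?tw rs))"
    if "length (?tw rs) \<le> K" for K
    using assms that
  proof (induction rs arbitrary: K)
    case Nil
    have "foldr (\<lambda>i acc. 0) l 0 = (0 :: nat)" for l :: "nat list" by (induction l) auto
    then show ?case by simp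
  next
    case (Cons d rs)
    let ?v = "val S (d # rs)"
    have d: "?v mod S = d" "?v div S = val S rs" using Cons.prems by auto
    show ?case
    proof (cases K)
      case 0
      then show ?thesis using Cons.prems by auto
    next
      case (Suc K')
      have upt: "[0..<K] = 0 # map Suc [0..<K']"
        by (simp add: Suc upt_conv_Cons map_Suc_upt del: upt_Suc)
      have shift: "?v div S ^ Suc i = val S rs div S ^ i" for i
        unfolding power_Suc div_mult2_eq d ..
      show ?thesis
        unfolding upt foldr.simps foldr_map comp_def shift power_0 div_by_1 d
        using Cons.IH[of K'] Cons.prems Suc by auto
    qed
  qed
  have "length (?tw rs) \<le> val S rs"
    using assms
  proof (induction rs)
    case (Cons d rs)
    then have "S \<ge> 1" and le: "length (?tw rs) \<le> val S rs" by auto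
    from mult_le_mono[OF this] have "length (?tw rs) \<le> S * val S rs" by simp
    then show ?case by auto
  qed simp
  then show ?thesis
    unfolding word_of_def tape_word_def snd_conv by (rule fold)
qed

definition tape_code :: "nat \<Rightarrow> tape \<Rightarrow> nat" where
  "tape_code S t = prod_encode (val S (fst t), val S (snd t))"

definition config_code :: "nat \<Rightarrow> config \<Rightarrow> nat" where
  "config_code S c = list_encode (fst c # map (tape_code S) (snd c))"

definition tape_over :: "nat \<Rightarrow> tape \<Rightarrow> bool" where
  "tape_over S t \<longleftrightarrow> set (fst t) \<subseteq> {..<S} \<and> set (snd t) \<subseteq> {..<S}"

definition config_of :: "otm \<Rightarrow> config \<Rightarrow> bool" where
  "config_of M c \<longleftrightarrow> fst c < states M \<and> length (snd c) = tapes M \<and>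
     (\<forall>t\<in>set (snd c). tape_over (symbols M) t)"

fun move_code :: "move \<Rightarrow> nat" where
  "move_code MoveL = 0"
| "move_code Stay = 1"
| "move_code MoveR = 2"

definition act_code :: "nat \<Rightarrow> nat \<Rightarrow> nat \<Rightarrow> nat \<Rightarrow> nat" where
  "act_code S w m z =
    (if m = 0 then prod_encode (fst (prod_decode z) div S,
        fst (prod_decode z) mod S + S * (w + S * (snd (prod_decode z) div S)))
     else if m = 1 then prod_encode (fst (prod_decode z), w + S * (snd (prod_decode z) div S))
     else prod_encode (w + S * fst (prod_decode z), snd (prod_decode z) div S))"

lemma trec_act_code:
  "trec n w \<Longrightarrow> trec n m \<Longrightarrow> trec n z \<Longrightarrow> trec n (\<lambda>xs. act_code S (w xs) (m xs) (z xs))"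
  unfolding act_code_def by (intro trec_intros)

lemma act_code_correct:
  assumes "tape_over S t" "w < S"
  shows "tape_code S (move_tape m (write_tape w t)) = act_code S w (move_code m) (tape_code S t)"
    and "tape_over S (move_tape m (write_tape w t))"
proof -
  obtain ls rs where t: "t = (ls, rs)" by force
  have sub: "set ls \<subseteq> {..<S}" "set rs \<subseteq> {..<S}" using assms by (auto simp: tape_over_def t)
  have tl: "set (tl ls) \<subseteq> {..<S}" "set (tl rs) \<subseteq> {..<S}"
    using sub by (cases ls; cases rs; simp)+
  have cell: "cell ls < S" using sub assms(2) by (cases ls) (auto simp: cell_def)
  show "tape_code S (move_tape m (write_tape w t)) = act_code S w (move_code m) (tape_code S t)"
    using sub by (cases m)
      (simp_all add: t write_tape_def tape_code_def act_code_def val_mod val_div cell_def[of "_ # _"])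
  show "tape_over S (move_tape m (write_tape w t))"
    using sub assms(2) tl cell by (cases m) (auto simp: t write_tape_def tape_over_def cell_def[of "_ # _"])
qed

lemma oracle_tm_delta:
  assumes "oracle_tm M" "q < states M" "length xs = tapes M" "set xs \<subseteq> {..<symbols M}"
    and "delta M q xs = (q', acts)"
  shows "q' < states M" "length acts = tapes M" "fst ` set acts \<subseteq> {..<symbols M}"
proof -
  have "case delta M q xs of (q', acts) \<Rightarrow>
      q' < states M \<and> length acts = tapes M \<and> fst ` set acts \<subseteq> {..<symbols M}"
  proof -
    have "\<forall>q<states M. \<forall>xs. length xs = tapes M \<and> set xs \<subseteq> {..<symbols M} \<longrightarrow>
       (case delta M q xs of (q', acts) \<Rightarrow>
          q' < states M \<and> length acts = tapes M \<and> fst ` set acts \<subseteq> {..<symbols M})"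
      using assms(1) unfolding oracle_tm_def by (elim conjE)
    from this[THEN spec, THEN mp, OF assms(2), THEN spec, THEN mp, OF conjI, OF assms(3,4)]
    show ?thesis .
  qed
  then show "q' < states M" "length acts = tapes M" "fst ` set acts \<subseteq> {..<symbols M}"
    using assms(5) by simp_all
qed

lemma step_valid:
  assumes M: "oracle_tm M" and c: "config_of M c"
  shows "config_of M (step M X c)"
proof (cases "fst c = halt M \<or> fst c = query M")
  case True
  have "yes M < states M" "no M < states M" using M by (simp_all add: oracle_tm_def)
  with True show ?thesis
    using c by (auto simp: step_def config_of_def case_prod_beta)
next
  case False
  obtain q ts where qts: "c = (q, ts)" by force
  let ?xs = "map read_tape ts"
  obtain q' acts where d: "delta M q ?xs = (q', acts)" by force
  have S: "3 \<le> symbols M" using M by (simp add: oracle_tm_def)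
  have "read_tape t < symbols M" if "t \<in> set ts" for t
  proof -
    have "set (snd t) \<subseteq> {..<symbols M}" using c that by (auto simp: config_of_def tape_over_def qts)
    then show ?thesis using S by (cases "snd t") (auto simp: read_tape_def cell_def)
  qed
  then have xs: "q < states M" "length ?xs = tapes M" "set ?xs \<subseteq> {..<symbols M}"
    using c by (auto simp: config_of_def qts)
  note wf = oracle_tm_delta[OF M xs d]
  have "tape_over (symbols M) (move_tape (snd a) (write_tape (fst a) t))"
    if "(a, t) \<in> set (zip acts ts)" for a t
  proof (rule act_code_correct(2))
    show "tape_over (symbols M) t"
      using c set_zip_rightD[OF that] by (simp add: config_of_def qts)
    show "fst a < symbols M"
      using wf(3) set_zip_leftD[OF that] by auto
  qed
  then show ?thesis
    using False c wf by (auto simp: step_def qts d config_of_def)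
qed

context
  fixes M :: otm
  assumes M: "oracle_tm M"
begin

definition head_index :: "nat \<Rightarrow> nat" where
  "head_index z = list_encode (code_nth 0 z #
     map (\<lambda>i. snd (prod_decode (code_nth (Suc i) z)) mod symbols M) [0..<tapes M])"

definition local_configs :: "(nat \<times> nat list) set" where
  "local_configs = {..<states M} \<times> {xs. set xs \<subseteq> {..<symbols M} \<and> length xs = tapes M}"

lemma ex_table:
  "\<exists>F. (\<forall>n f. trec n f \<longrightarrow> trec n (\<lambda>xs. F (f xs))) \<and>
    (\<forall>q xs. (q, xs) \<in> local_configs \<longrightarrow> F (list_encode (q # xs)) = G q xs)"
proof -
  have "finite local_configs"
    unfolding local_configs_def by (intro finite_cartesian_product finite_lists_length_eq) auto
  then obtain N where N: "\<And>c. c \<in> local_configs \<Longrightarrow> list_encode (fst c # snd c) < N"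
    using finite_nat_set_iff_bounded[of "(\<lambda>c. list_encode (fst c # snd c)) ` local_configs"] by auto
  let ?F = "\<lambda>z. if z < N then (\<lambda>z. G (hd (list_decode z)) (tl (list_decode z))) z else 0"
  show ?thesis
  proof (intro exI[of _ ?F] conjI allI impI)
    show "trec n f \<Longrightarrow> trec n (\<lambda>xs. ?F (f xs))" for n f by (rule trec_table)
    show "(q, xs) \<in> local_configs \<Longrightarrow> ?F (list_encode (q # xs)) = G q xs" for q xs
      using N[of "(q, xs)"] by (simp del: list_encode.simps)
  qed
qed

lemma ex_step_code:
  obtains st where
    "\<And>n f g. trec n f \<Longrightarrow> trec n g \<Longrightarrow> trec n (\<lambda>xs. st (f xs) (g xs))"
    "\<And>x c. config_of M c \<Longrightarrow>
       st x (config_code (symbols M) c) = config_code (symbols M) (step M {str_of_nat x} c)"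
proof -
  let ?S = "symbols M" and ?k = "tapes M"
  obtain Q where Q: "\<And>n f. trec n f \<Longrightarrow> trec n (\<lambda>xs. Q (f xs))"
    "\<And>q xs. (q, xs) \<in> local_configs \<Longrightarrow> Q (list_encode (q # xs)) = fst (delta M q xs)"
    using ex_table[of "\<lambda>q xs. fst (delta M q xs)"] by blast
  have "\<forall>i. \<exists>F. (\<forall>n f. trec n f \<longrightarrow> trec n (\<lambda>xs. F (f xs))) \<and>
    (\<forall>q xs. (q, xs) \<in> local_configs \<longrightarrow> F (list_encode (q # xs)) = fst (snd (delta M q xs) ! i))"
    by (rule allI, rule ex_table)
  from choice[OF this] obtain A where A': "\<forall>i. (\<forall>n f. trec n f \<longrightarrow> trec n (\<lambda>xs. A i (f xs))) \<and>
    (\<forall>q xs. (q, xs) \<in> local_configs \<longrightarrow> A i (list_encode (q # xs)) = fst (snd (delta M q xs) ! i))" by (rule exE)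
  have A: "trec n f \<Longrightarrow> trec n (\<lambda>xs. A i (f xs))"
    "(q, xs) \<in> local_configs \<Longrightarrow> A i (list_encode (q # xs)) = fst (snd (delta M q xs) ! i)" for i n f q xs
    using spec[OF A', of i] by simp_all
  have "\<forall>i. \<exists>F. (\<forall>n f. trec n f \<longrightarrow> trec n (\<lambda>xs. F (f xs))) \<and>
    (\<forall>q xs. (q, xs) \<in> local_configs \<longrightarrow> F (list_encode (q # xs)) = move_code (snd (snd (delta M q xs) ! i)))"
    by (rule allI, rule ex_table)
  from choice[OF this] obtain B where B': "\<forall>i. (\<forall>n f. trec n f \<longrightarrow> trec n (\<lambda>xs. B i (f xs))) \<and>
    (\<forall>q xs. (q, xs) \<in> local_configs \<longrightarrow> B i (list_encode (q # xs)) = move_code (snd (snd (delta M q xs) ! i)))" by (rule exE)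
  have B: "trec n f \<Longrightarrow> trec n (\<lambda>xs. B i (f xs))"
    "(q, xs) \<in> local_configs \<Longrightarrow> B i (list_encode (q # xs)) = move_code (snd (snd (delta M q xs) ! i))" for i n f q xs
    using spec[OF B', of i] by simp_all
  define st where "st x z =
    (if code_nth 0 z = halt M then z
     else if code_nth 0 z = query M then
       list_encode ((if word_of ?S (snd (prod_decode (code_nth 2 z))) = x then yes M else no M) #
         map (\<lambda>i. code_nth (Suc i) z) [0..<?k])
     else list_encode (Q (head_index z) #
       map (\<lambda>i. act_code ?S (A i (head_index z)) (B i (head_index z)) (code_nth (Suc i) z)) [0..<?k]))" for x z
  have enc: "trec n (\<lambda>xs. list_encode (h xs # map (\<lambda>i. k i xs) [0..<?k]))"
    if "trec n h" "\<And>i. trec n (k i)" for n h k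
  proof -
    have "trec n (\<lambda>xs. list_encode (map (\<lambda>f. f xs) (h # map k [0..<?k])))"
      by (rule trec_list_encode) (use that in auto)
    then show ?thesis by (simp add: comp_def del: list_encode.simps)
  qed
  have idx: "trec n (\<lambda>xs. head_index (g xs))" if "trec n g" for n g
    unfolding head_index_def by (intro enc trec_intros that)
  show ?thesis
  proof (rule that[of st])
    show "trec n (\<lambda>xs. st (f xs) (g xs))" if "trec n f" "trec n g" for n f g
      unfolding st_def
      by (intro trec_if trecp_eq enc trec_act_code A(1) B(1) Q(1) idx trec_code_nth trec_word_of
          trec_prod_decode trec_const that)
  next
    fix x c assume c: "config_of M c"
    obtain q ts where qts: "c = (q, ts)" by force
    have len: "length ts = ?k" and q: "q < states M" using c by (auto simp: config_of_def qts)
    have k2: "2 \<le> ?k" and S: "3 \<le> ?S" using M by (auto simp: oracle_tm_def)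
    let ?z = "config_code ?S c"
    have z0: "code_nth 0 ?z = q"
      by (simp add: config_code_def code_nth_list_encode qts del: list_encode.simps)
    have zi: "code_nth (Suc i) ?z = tape_code ?S (ts ! i)" if "i < ?k" for i
      using that len by (simp add: config_code_def code_nth_list_encode qts del: list_encode.simps)
    have over: "tape_over ?S (ts ! i)" if "i < ?k" for i
      using c that len by (auto simp: config_of_def qts)
    have rd: "snd (prod_decode (tape_code ?S (ts ! i))) mod ?S = read_tape (ts ! i)" if "i < ?k" for i
      using over[OF that] by (simp add: tape_code_def read_tape_def val_mod tape_over_def)
    have rd_less: "read_tape (ts ! i) < ?S" if "i < ?k" for i
      unfolding rd[OF that, symmetric] using S by simp
    let ?xs = "map read_tape ts"
    have idx: "head_index ?z = list_encode (q # ?xs)"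
      unfolding head_index_def z0
      by (intro arg_cong[of _ _ list_encode] arg_cong[of _ _ "(#) q"] nth_equalityI)
        (auto simp: len zi rd)
    have loc: "(q, ?xs) \<in> local_configs"
    proof -
      have "\<forall>t\<in>set ts. read_tape t < ?S" by (simp add: all_set_conv_all_nth len rd_less)
      then show ?thesis using q len by (auto simp: local_configs_def)
    qed
    obtain q' acts where d: "delta M q ?xs = (q', acts)" by force
    have acts: "length acts = ?k" "fst ` set acts \<subseteq> {..<?S}"
      using oracle_tm_delta(2,3)[OF M q _ _ d] loc by (auto simp: local_configs_def)
    show "st x ?z = config_code ?S (step M {str_of_nat x} c)"
    proof (cases "q = halt M")
      case True
      then show ?thesis unfolding st_def z0 by (simp add: step_def qts)
    next
      case nh: False
      show ?thesis
      proof (cases "q = query M")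
        case True
        have "word_of ?S (snd (prod_decode (code_nth 2 ?z))) = nat_of_str (tape_word (ts ! 1))"
          using zi[of 1] over[of 1] k2 word_of_val[of "snd (ts ! 1)" ?S "fst (ts ! 1)"]
          by (simp add: tape_code_def tape_over_def numeral_2_eq_2)
        then have test: "word_of ?S (snd (prod_decode (code_nth 2 ?z))) = x \<longleftrightarrow> tape_word (ts ! 1) \<in> {str_of_nat x}"
          by auto
        have "map (\<lambda>i. code_nth (Suc i) ?z) [0..<?k] = map (tape_code ?S) ts"
          by (intro nth_equalityI) (auto simp: len zi)
        then show ?thesis
          unfolding st_def z0 test using nh True
          by (simp add: step_def qts config_code_def)
      next
        case nq: False
        have "map (\<lambda>i. act_code ?S (A i (head_index ?z)) (B i (head_index ?z)) (code_nth (Suc i) ?z)) [0..<?k]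
          = map (tape_code ?S) (map2 (\<lambda>(x, m) t. move_tape m (write_tape x t)) acts ts)"
        proof (rule nth_equalityI)
          fix i assume "i < length (map (\<lambda>i. act_code ?S (A i (head_index ?z)) (B i (head_index ?z)) (code_nth (Suc i) ?z)) [0..<?k])"
          then have i: "i < ?k" by simp
          then have "acts ! i \<in> set acts" using acts by simp
          then have "fst (acts ! i) < ?S" using acts(2) by blast
          from act_code_correct(1)[OF over[OF i] this, of "snd (acts ! i)"]
          show "map (\<lambda>i. act_code ?S (A i (head_index ?z)) (B i (head_index ?z)) (code_nth (Suc i) ?z)) [0..<?k] ! i
            = map (tape_code ?S) (map2 (\<lambda>(x, m) t. move_tape m (write_tape x t)) acts ts) ! i"
            using i acts len by (simp add: zi idx A(2)[OF loc] B(2)[OF loc] d case_prod_beta del: list_encode.simps)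
        qed (simp add: acts len)
        moreover have "Q (head_index ?z) = q'" using Q(2)[OF loc] by (simp add: idx d del: list_encode.simps)
        ultimately show ?thesis
          unfolding st_def z0 using nh nq
          by (simp add: step_def qts config_code_def d del: list_encode.simps)
      qed
    qed
  qed
qed

lemma init_config_of: "config_of M (init_config M (str_of_nat n))"
  using M by (auto simp: init_config_def config_of_def oracle_tm_def tape_over_def bit_sym_def)

lemma ex_otm_stages:
  "\<exists>R. trec 3 (\<lambda>xs. R (xs ! 0) (xs ! 1) (xs ! 2)) \<and>
    (\<forall>t t' x n y. R t x n = Suc y \<longrightarrow> t \<le> t' \<longrightarrow> R t' x n = Suc y) \<and>
    (\<forall>x n v. otm_output M {str_of_nat x} (str_of_nat n) v \<longleftrightarrow> (\<exists>t. R t x n = Suc (nat_of_str v)))"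
proof -
  let ?S = "symbols M"
  obtain st where st: "\<And>n f g. trec n f \<Longrightarrow> trec n g \<Longrightarrow> trec n (\<lambda>xs. st (f xs) (g xs))"
    "\<And>x c. config_of M c \<Longrightarrow> st x (config_code ?S c) = config_code ?S (step M {str_of_nat x} c)"
    by (rule ex_step_code) (rule that)
  define ini where "ini n = config_code ?S (init_config M (str_of_nat n))" for n
  have ini: "ini n = Suc (prod_encode (start M, Suc (prod_encode (prod_encode (0,
      foldr (\<lambda>b acc. bit_sym b + ?S * acc) (str_of_nat n) 0),
      list_encode (replicate (tapes M - 1) (prod_encode (0, 0)))))))" for n
  proof -
    have "val S (map bit_sym s) = foldr (\<lambda>b acc. bit_sym b + S * acc) s 0" for S s
      by (induction s) auto
    then show ?thesis
      by (simp add: ini_def init_config_def config_code_def tape_code_def map_replicate)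
  qed
  have "trec 1 (\<lambda>xs. ini (xs ! 0))"
    unfolding ini bit_sym_def by (intro trec_intros) simp_all
  then have tr_ini: "trec n (\<lambda>xs. ini (f xs))" if "trec n f" for n f
    using trec_comp1[of ini] that by blast
  let ?run = "\<lambda>t x n. (step M {str_of_nat x} ^^ t) (init_config M (str_of_nat n))"
  define R where "R t x n = (let z = (st x ^^ t) (ini n) in
     if code_nth 0 z = halt M then Suc (word_of ?S (snd (prod_decode (code_nth 1 z)))) else 0)" for t x n
  have valid: "config_of M (?run t x n)" for t x n
    by (induction t) (simp_all add: init_config_of step_valid[OF M])
  have run: "(st x ^^ t) (ini n) = config_code ?S (?run t x n)" for t x n
    by (induction t) (simp_all add: ini_def st(2) valid)
  have R: "R t x n = (if fst (?run t x n) = halt M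
     then Suc (nat_of_str (tape_word (snd (?run t x n) ! 0))) else 0)" for t x n
  proof -
    obtain q ts where c: "?run t x n = (q, ts)" by force
    then have len: "length ts = tapes M" using valid[of t x n] by (simp add: config_of_def)
    then have pos: "0 < length ts" using M by (simp add: oracle_tm_def)
    have "\<forall>t\<in>set ts. tape_over ?S t" using valid[of t x n] c by (simp add: config_of_def)
    with pos have over: "tape_over ?S (ts ! 0)" by (metis nth_mem)
    have z: "code_nth 0 (config_code ?S (q, ts)) = q"
      "code_nth 1 (config_code ?S (q, ts)) = tape_code ?S (ts ! 0)"
      using pos by (simp_all add: config_code_def code_nth_list_encode del: list_encode.simps)
    show ?thesis
      unfolding R_def Let_def run c fst_conv snd_conv z
      using over word_of_val[of "snd (ts ! 0)" ?S "fst (ts ! 0)"]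
      by (simp add: tape_code_def tape_over_def)
  qed
  have stay: "?run t' x n = ?run t x n" if "fst (?run t x n) = halt M" "t \<le> t'" for t t' x n
    using that(2)
  proof (induction t' rule: dec_induct)
    case (step m)
    have "step M X c = c" if "fst c = halt M" for X c
      using that by (cases c) (simp add: step_def)
    with step show ?case using that(1) by simp
  qed simp
  have tr: "trec 3 (\<lambda>xs. (st (xs ! 1) ^^ (xs ! 0)) (ini (xs ! 2)))"
    by (intro trec_funpow[of 3 _ _ "\<lambda>r xs. st (xs ! 1) r"] st(1) tr_ini trec_intros) simp_all
  have "trec 3 (\<lambda>xs. R (xs ! 0) (xs ! 1) (xs ! 2))"
    unfolding R_def Let_def by (intro trec_intros tr)
  moreover have "R t' x n = Suc y" if "R t x n = Suc y" "t \<le> t'" for t t' x n y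
  proof -
    have "fst (?run t x n) = halt M" using that(1) unfolding R by (simp split: if_splits)
    from stay[OF this that(2)] show ?thesis using that(1) unfolding R by metis
  qed
  moreover have "otm_output M {str_of_nat x} (str_of_nat n) v \<longleftrightarrow> (\<exists>t. R t x n = Suc (nat_of_str v))" for x n v
    unfolding otm_output_def R by (auto simp: prod_eq_iff)
  ultimately show ?thesis by blast
qed

end

section \<open>Compiling recursive functions to loop programs\<close>

datatype prog = Inc nat | Dec nat | Seq prog prog | While nat prog

inductive runs :: "prog \<Rightarrow> (nat \<Rightarrow> nat) \<Rightarrow> (nat \<Rightarrow> nat) \<Rightarrow> bool" where
  runs_Inc: "runs (Inc r) \<sigma> (\<sigma>(r := Suc (\<sigma> r)))"
| runs_Dec: "runs (Dec r) \<sigma> (\<sigma>(r := \<sigma> r - 1))"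
| runs_Seq: "runs P \<sigma> \<sigma>' \<Longrightarrow> runs Q \<sigma>' \<sigma>'' \<Longrightarrow> runs (Seq P Q) \<sigma> \<sigma>''"
| runs_While_0: "\<sigma> r = 0 \<Longrightarrow> runs (While r P) \<sigma> \<sigma>"
| runs_While_Suc: "0 < \<sigma> r \<Longrightarrow> runs P \<sigma> \<sigma>' \<Longrightarrow> runs (While r P) \<sigma>' \<sigma>'' \<Longrightarrow> runs (While r P) \<sigma> \<sigma>''"

definition clear :: "nat \<Rightarrow> prog" where
  "clear r = While r (Dec r)"

definition copy :: "nat \<Rightarrow> nat \<Rightarrow> nat \<Rightarrow> prog" where
  "copy r s t = Seq (clear s) (Seq (clear t)
     (Seq (While r (Seq (Dec r) (Seq (Inc s) (Inc t)))) (While t (Seq (Dec t) (Inc r)))))"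

lemma runs_clear: "runs (clear r) \<sigma> (\<sigma>(r := 0))"
proof (induction "\<sigma> r" arbitrary: \<sigma>)
  case 0
  then have "\<sigma>(r := 0) = \<sigma>" by auto
  with 0 show ?case using runs_While_0[of \<sigma> r "Dec r"] by (simp add: clear_def)
next
  case (Suc n)
  have "runs (clear r) (\<sigma>(r := \<sigma> r - 1)) ((\<sigma>(r := \<sigma> r - 1))(r := 0))"
    using Suc by (metis diff_Suc_1 fun_upd_same)
  with Suc(2) show ?case unfolding clear_def using runs_While_Suc[OF _ runs_Dec] by fastforce
qed

lemma runs_copy:
  assumes "r \<noteq> s" "r \<noteq> t" "s \<noteq> t"
  shows "runs (copy r s t) \<sigma> (\<sigma>(s := \<sigma> r, t := 0))"
proof -
  have dup: "runs (While r (Seq (Dec r) (Seq (Inc s) (Inc t)))) \<sigma> (\<sigma>(r := 0, s := \<sigma> s + \<sigma> r, t := \<sigma> t + \<sigma> r))" for \<sigma>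
  proof (induction "\<sigma> r" arbitrary: \<sigma>)
    case 0
    then have eq: "\<sigma>(r := 0, s := \<sigma> s + \<sigma> r, t := \<sigma> t + \<sigma> r) = \<sigma>" by auto
    show ?case unfolding eq by (rule runs_While_0) (simp add: 0)
  next
    case (Suc n)
    let ?\<sigma> = "\<sigma>(r := \<sigma> r - 1, s := Suc (\<sigma> s), t := Suc (\<sigma> t))"
    have step: "runs (Seq (Dec r) (Seq (Inc s) (Inc t))) \<sigma> ?\<sigma>"
    proof -
      let ?\<tau> = "\<sigma>(r := \<sigma> r - 1)"
      let ?\<tau>' = "?\<tau>(s := Suc (?\<tau> s))"
      have "runs (Seq (Dec r) (Seq (Inc s) (Inc t))) \<sigma> (?\<tau>'(t := Suc (?\<tau>' t)))"
        by (intro runs_Seq[OF runs_Dec] runs_Seq[OF runs_Inc] runs_Inc)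
      then show ?thesis using assms by simp
    qed
    have loop: "runs (While r (Seq (Dec r) (Seq (Inc s) (Inc t)))) ?\<sigma>
        (?\<sigma>(r := 0, s := ?\<sigma> s + ?\<sigma> r, t := ?\<sigma> t + ?\<sigma> r))"
      by (rule Suc(1)) (use Suc(2) assms in simp)
    have eq: "?\<sigma>(r := 0, s := ?\<sigma> s + ?\<sigma> r, t := ?\<sigma> t + ?\<sigma> r)
        = \<sigma>(r := 0, s := \<sigma> s + \<sigma> r, t := \<sigma> t + \<sigma> r)"
      using assms Suc(2)[symmetric] by (auto simp: fun_eq_iff)
    have "0 < \<sigma> r" using Suc(2) by simp
    from runs_While_Suc[OF this step loop] show ?case unfolding eq .
  qed
  have restore: "runs (While t (Seq (Dec t) (Inc r))) \<sigma> (\<sigma>(t := 0, r := \<sigma> r + \<sigma> t))" for \<sigma>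
  proof (induction "\<sigma> t" arbitrary: \<sigma>)
    case 0
    then have eq: "\<sigma>(t := 0, r := \<sigma> r + \<sigma> t) = \<sigma>" by auto
    show ?case unfolding eq by (rule runs_While_0) (simp add: 0)
  next
    case (Suc n)
    let ?\<sigma> = "\<sigma>(t := \<sigma> t - 1, r := Suc (\<sigma> r))"
    have step: "runs (Seq (Dec t) (Inc r)) \<sigma> ?\<sigma>"
    proof -
      let ?\<tau> = "\<sigma>(t := \<sigma> t - 1)"
      have "runs (Seq (Dec t) (Inc r)) \<sigma> (?\<tau>(r := Suc (?\<tau> r)))"
        by (intro runs_Seq[OF runs_Dec] runs_Inc)
      then show ?thesis using assms by simp
    qed
    have loop: "runs (While t (Seq (Dec t) (Inc r))) ?\<sigma> (?\<sigma>(t := 0, r := ?\<sigma> r + ?\<sigma> t))"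
      by (rule Suc(1)) (use Suc(2) assms in simp)
    have eq: "?\<sigma>(t := 0, r := ?\<sigma> r + ?\<sigma> t) = \<sigma>(t := 0, r := \<sigma> r + \<sigma> t)"
      using assms Suc(2)[symmetric] by (auto simp: fun_eq_iff)
    have "0 < \<sigma> t" using Suc(2) by simp
    from runs_While_Suc[OF this step loop] show ?case unfolding eq .
  qed
  let ?\<sigma>1 = "\<sigma>(s := 0, t := 0)"
  let ?\<sigma>2 = "?\<sigma>1(r := 0, s := ?\<sigma>1 s + ?\<sigma>1 r, t := ?\<sigma>1 t + ?\<sigma>1 r)"
  have "runs (copy r s t) \<sigma> (?\<sigma>2(t := 0, r := ?\<sigma>2 r + ?\<sigma>2 t))"
    unfolding copy_def by (intro runs_Seq[OF runs_clear] runs_Seq[OF dup] restore)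
  moreover have "?\<sigma>2(t := 0, r := ?\<sigma>2 r + ?\<sigma>2 t) = \<sigma>(s := \<sigma> r, t := 0)"
    using assms by (auto simp: fun_eq_iff)
  ultimately show ?thesis by simp
qed

text \<open>Registers from \<open>k\<close> on are scratch and need not be 0 initially.\<close>

definition realizes :: "prog \<Rightarrow> recf \<Rightarrow> nat list \<Rightarrow> nat \<Rightarrow> nat \<Rightarrow> bool" where
  "realizes P g ins out k \<longleftrightarrow> (\<forall>\<sigma> y. evals g (map \<sigma> ins) y \<longrightarrow>
     (\<exists>\<sigma>'. runs P \<sigma> \<sigma>' \<and> \<sigma>' out = y \<and> (\<forall>r<k. r \<noteq> out \<longrightarrow> \<sigma>' r = \<sigma> r)))"

lemma realizesD:
  assumes "realizes P g ins out k" "evals g (map \<sigma> ins) y"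
  obtains \<sigma>' where "runs P \<sigma> \<sigma>'" "\<sigma>' out = y" "\<And>r. r < k \<Longrightarrow> r \<noteq> out \<Longrightarrow> \<sigma>' r = \<sigma> r"
  using assms unfolding realizes_def by blast

definition realizable :: "recf \<Rightarrow> bool" where
  "realizable g \<longleftrightarrow> (\<forall>ins out k. set ins \<subseteq> {..<k} \<longrightarrow> out < k \<longrightarrow> out \<notin> set ins \<longrightarrow>
     (\<exists>P. realizes P g ins out k))"

lemma realizableD: "realizable g \<Longrightarrow> set ins \<subseteq> {..<k} \<Longrightarrow> out < k \<Longrightarrow> out \<notin> set ins \<Longrightarrow>
     \<exists>P. realizes P g ins out k"
  unfolding realizable_def by blast

lemma realizable_Zero: "realizable Zero"
  unfolding realizable_def
proof (intro allI impI)
  fix ins out k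
  have "realizes (clear out) Zero ins out k"
    unfolding realizes_def using runs_clear by (fastforce elim: evals_ZeroE)
  then show "\<exists>P. realizes P Zero ins out k" by (rule exI)
qed

lemma realizable_Succ: "realizable Succ"
  unfolding realizable_def
proof (intro allI impI)
  fix ins :: "nat list" and out k :: nat
  assume ins: "set ins \<subseteq> {..<k}" and out: "out < k" "out \<notin> set ins"
  have "\<exists>\<sigma>'. runs (Seq (copy (hd ins) out k) (Inc out)) \<sigma> \<sigma>' \<and> \<sigma>' out = y \<and> (\<forall>r<k. r \<noteq> out \<longrightarrow> \<sigma>' r = \<sigma> r)"
    if ev: "evals Succ (map \<sigma> ins) y" for \<sigma> y
  proof -
    obtain x where x: "map \<sigma> ins = [x]" "y = Suc x" using ev by (auto elim: evals_SuccE)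
    then obtain r where r: "ins = [r]" by auto
    let ?\<sigma> = "\<sigma>(out := \<sigma> r, k := 0)"
    have "runs (copy r out k) \<sigma> ?\<sigma>" by (rule runs_copy) (use r ins out in auto)
    from runs_Seq[OF this runs_Inc]
    have "runs (Seq (copy (hd ins) out k) (Inc out)) \<sigma> (?\<sigma>(out := Suc (?\<sigma> out)))"
      unfolding r list.sel .
    then show ?thesis using r x out by (intro exI[of _ "?\<sigma>(out := Suc (?\<sigma> out))"]) auto
  qed
  then have "realizes (Seq (copy (hd ins) out k) (Inc out)) Succ ins out k"
    unfolding realizes_def by blast
  then show "\<exists>P. realizes P Succ ins out k" by (rule exI)
qed

lemma realizable_Proj: "realizable (Proj i)"
  unfolding realizable_def
proof (intro allI impI)
  fix ins :: "nat list" and out k :: nat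
  assume ins: "set ins \<subseteq> {..<k}" and out: "out < k" "out \<notin> set ins"
  have "\<exists>\<sigma>'. runs (copy (ins ! i) out k) \<sigma> \<sigma>' \<and> \<sigma>' out = y \<and> (\<forall>r<k. r \<noteq> out \<longrightarrow> \<sigma>' r = \<sigma> r)"
    if ev: "evals (Proj i) (map \<sigma> ins) y" for \<sigma> y
  proof -
    have i: "i < length ins" "y = \<sigma> (ins ! i)" using ev by (auto elim: evals_ProjE)
    then have "ins ! i \<in> set ins" by simp
    then have "runs (copy (ins ! i) out k) \<sigma> (\<sigma>(out := \<sigma> (ins ! i), k := 0))"
      by (intro runs_copy) (use ins out in auto)
    then show ?thesis using i out by (intro exI[of _ "\<sigma>(out := \<sigma> (ins ! i), k := 0)"]) auto
  qed
  then have "realizes (copy (ins ! i) out k) (Proj i) ins out k"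
    unfolding realizes_def by blast
  then show "\<exists>P. realizes P (Proj i) ins out k" by (rule exI)
qed

lemma realizable_Comp:
  assumes gs: "\<And>g. g \<in> set gs \<Longrightarrow> realizable g" and h: "realizable h"
  shows "realizable (Comp h gs)"
  unfolding realizable_def
proof (intro allI impI)
  fix ins :: "nat list" and out k :: nat
  assume ins: "set ins \<subseteq> {..<k}" and out: "out < k" "out \<notin> set ins"
  let ?K = "k + length gs"
  have args: "\<exists>P. \<forall>\<sigma> ys. list_all2 (\<lambda>g y. evals g (map \<sigma> ins) y) gs ys \<longrightarrow>
    (\<exists>\<sigma>'. runs P \<sigma> \<sigma>' \<and> (\<forall>i<j. \<sigma>' (k + i) = ys ! i) \<and> (\<forall>r<k. \<sigma>' r = \<sigma> r))"
    if "j \<le> length gs" for j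
    using that
  proof (induction j)
    case 0
    have "runs (clear k) \<sigma> (\<sigma>(k := 0))" for \<sigma> by (rule runs_clear)
    then show ?case by (intro exI[of _ "clear k"]) fastforce
  next
    case (Suc j)
    then obtain P where P: "\<And>\<sigma> ys. list_all2 (\<lambda>g y. evals g (map \<sigma> ins) y) gs ys \<Longrightarrow>
      \<exists>\<sigma>'. runs P \<sigma> \<sigma>' \<and> (\<forall>i<j. \<sigma>' (k + i) = ys ! i) \<and> (\<forall>r<k. \<sigma>' r = \<sigma> r)" by auto
    have "\<exists>Q. realizes Q (gs ! j) ins (k + j) ?K"
      by (rule realizableD[OF gs]) (use Suc ins in auto)
    then obtain Q where Q: "realizes Q (gs ! j) ins (k + j) ?K" by blast
    have "\<exists>\<sigma>'. runs (Seq P Q) \<sigma> \<sigma>' \<and> (\<forall>i<Suc j. \<sigma>' (k + i) = ys ! i) \<and> (\<forall>r<k. \<sigma>' r = \<sigma> r)"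
      if ys: "list_all2 (\<lambda>g y. evals g (map \<sigma> ins) y) gs ys" for \<sigma> ys
    proof -
      obtain \<sigma>1 where \<sigma>1: "runs P \<sigma> \<sigma>1" "\<forall>i<j. \<sigma>1 (k + i) = ys ! i" "\<forall>r<k. \<sigma>1 r = \<sigma> r"
        using P[OF ys] by blast
      have mp: "map \<sigma>1 ins = map \<sigma> ins" using ins \<sigma>1(3) by auto
      have "evals (gs ! j) (map \<sigma>1 ins) (ys ! j)"
        unfolding mp using list_all2_nthD[OF ys, of j] Suc.prems by simp
      from realizesD[OF Q this] obtain \<sigma>2 where \<sigma>2: "runs Q \<sigma>1 \<sigma>2" "\<sigma>2 (k + j) = ys ! j"
        "\<And>r. r < ?K \<Longrightarrow> r \<noteq> k + j \<Longrightarrow> \<sigma>2 r = \<sigma>1 r" by blast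
      have "runs (Seq P Q) \<sigma> \<sigma>2" by (rule runs_Seq[OF \<sigma>1(1) \<sigma>2(1)])
      moreover have "\<sigma>2 (k + i) = ys ! i" if "i < Suc j" for i
        using that \<sigma>1(2) \<sigma>2(2,3) Suc.prems by (cases "i = j") auto
      moreover have "\<sigma>2 r = \<sigma> r" if "r < k" for r
        using that \<sigma>1(3) \<sigma>2(3) by auto
      ultimately show ?thesis by blast
    qed
    then show ?case by blast
  qed
  from args[OF order_refl] obtain P where P: "\<And>\<sigma> ys. list_all2 (\<lambda>g y. evals g (map \<sigma> ins) y) gs ys \<Longrightarrow>
      \<exists>\<sigma>'. runs P \<sigma> \<sigma>' \<and> (\<forall>i<length gs. \<sigma>' (k + i) = ys ! i) \<and> (\<forall>r<k. \<sigma>' r = \<sigma> r)" by auto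
  have "\<exists>Q. realizes Q h [k..<?K] out ?K"
    by (rule realizableD[OF h]) (use out in auto)
  then obtain Q where Q: "realizes Q h [k..<?K] out ?K" by blast
  have "\<exists>\<sigma>'. runs (Seq P Q) \<sigma> \<sigma>' \<and> \<sigma>' out = z \<and> (\<forall>r<k. r \<noteq> out \<longrightarrow> \<sigma>' r = \<sigma> r)"
    if ev: "evals (Comp h gs) (map \<sigma> ins) z" for \<sigma> z
  proof -
    obtain ys where ys: "list_all2 (\<lambda>g y. evals g (map \<sigma> ins) y) gs ys" "evals h ys z"
      using ev by (auto elim: evals_CompE)
    obtain \<sigma>1 where \<sigma>1: "runs P \<sigma> \<sigma>1" "\<forall>i<length gs. \<sigma>1 (k + i) = ys ! i" "\<forall>r<k. \<sigma>1 r = \<sigma> r"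
      using P[OF ys(1)] by blast
    have "map \<sigma>1 [k..<?K] = ys"
      using \<sigma>1(2) list_all2_lengthD[OF ys(1)] by (intro nth_equalityI) auto
    then have "evals h (map \<sigma>1 [k..<?K]) z" using ys(2) by simp
    from realizesD[OF Q this] obtain \<sigma>2 where \<sigma>2: "runs Q \<sigma>1 \<sigma>2" "\<sigma>2 out = z"
      "\<And>r. r < ?K \<Longrightarrow> r \<noteq> out \<Longrightarrow> \<sigma>2 r = \<sigma>1 r" by blast
    have "runs (Seq P Q) \<sigma> \<sigma>2" by (rule runs_Seq[OF \<sigma>1(1) \<sigma>2(1)])
    then show ?thesis using \<sigma>1(3) \<sigma>2(2,3) by auto
  qed
  then have "realizes (Seq P Q) (Comp h gs) ins out k" unfolding realizes_def by blast
  then show "\<exists>P. realizes P (Comp h gs) ins out k" by (rule exI)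
qed

lemma evals_PrimRec_le:
  "evals (PrimRec g h) (m # xs) y \<Longrightarrow> j \<le> m \<Longrightarrow> \<exists>r. evals (PrimRec g h) (j # xs) r"
proof (induction m arbitrary: y)
  case (Suc m)
  from Suc.prems(1) obtain r where "evals (PrimRec g h) (m # xs) r"
    by (rule evals_PrimRecSucE)
  with Suc show ?case by (cases "j = Suc m") auto
qed auto

lemma realizable_PrimRec:
  assumes g: "realizable g" and h: "realizable h"
  shows "realizable (PrimRec g h)"
  unfolding realizable_def
proof (intro allI impI)
  fix ins :: "nat list" and out k :: nat
  assume ins: "set ins \<subseteq> {..<k}" and out: "out < k" "out \<notin> set ins"
  show "\<exists>P. realizes P (PrimRec g h) ins out k"
  proof (cases ins)
    case Nil
    then have "realizes P (PrimRec g h) ins out k" for P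
      unfolding realizes_def by (auto elim: evals_PrimRecNilE)
    then show ?thesis by blast
  next
    case (Cons a rest)
    define i c acc acc' t K where "i = k" "c = k + 1" "acc = k + 2" "acc' = k + 3" "t = k + 4" "K = k + 5"
    note regs = this
    have rest: "set rest \<subseteq> {..<k}" and a: "a < k" using ins Cons by auto
    have "\<exists>P. realizes P g rest acc K"
      by (rule realizableD[OF g]) (use rest in \<open>auto simp: regs\<close>)
    then obtain P where P: "realizes P g rest acc K" by blast
    have "\<exists>Q. realizes Q h (i # acc # rest) acc' K"
      by (rule realizableD[OF h]) (use rest in \<open>auto simp: regs\<close>)
    then obtain Q where Q: "realizes Q h (i # acc # rest) acc' K" by blast
    define body where "body = Seq (Dec c) (Seq Q (Seq (copy acc' acc t) (Inc i)))"
    have loop: "\<exists>\<sigma>'. runs (While c body) \<sigma> \<sigma>' \<and> \<sigma>' acc = y \<and> (\<forall>r<k. \<sigma>' r = \<sigma> r)"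
      if "\<sigma> c = d" "evals (PrimRec g h) (\<sigma> i # map \<sigma> rest) (\<sigma> acc)"
        "evals (PrimRec g h) ((\<sigma> i + d) # map \<sigma> rest) y" for \<sigma> d y
      using that
    proof (induction d arbitrary: \<sigma>)
      case 0
      then have "\<sigma> acc = y" using evals_determ by simp
      then show ?case using 0 runs_While_0[of \<sigma> c] by blast
    next
      case (Suc d)
      obtain z where z: "evals (PrimRec g h) (Suc (\<sigma> i) # map \<sigma> rest) z"
        using evals_PrimRec_le[OF Suc.prems(3), of "Suc (\<sigma> i)"] by auto
      from this obtain r where "evals (PrimRec g h) (\<sigma> i # map \<sigma> rest) r" "evals h (\<sigma> i # r # map \<sigma> rest) z"
        by (rule evals_PrimRecSucE)
      with Suc.prems(2) have ev: "evals h (\<sigma> i # \<sigma> acc # map \<sigma> rest) z" using evals_determ by blast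
      let ?\<sigma>1 = "\<sigma>(c := \<sigma> c - 1)"
      have mp1: "map ?\<sigma>1 (i # acc # rest) = \<sigma> i # \<sigma> acc # map \<sigma> rest"
        using rest by (auto simp: regs)
      have "evals h (map ?\<sigma>1 (i # acc # rest)) z" unfolding mp1 by (rule ev)
      from realizesD[OF Q this] obtain \<sigma>2 where \<sigma>2: "runs Q ?\<sigma>1 \<sigma>2" "\<sigma>2 acc' = z"
        "\<And>r. r < K \<Longrightarrow> r \<noteq> acc' \<Longrightarrow> \<sigma>2 r = ?\<sigma>1 r" by blast
      let ?\<sigma>3 = "\<sigma>2(acc := \<sigma>2 acc', t := 0)"
      let ?\<sigma>4 = "?\<sigma>3(i := Suc (?\<sigma>3 i))"
      have copy: "runs (copy acc' acc t) \<sigma>2 ?\<sigma>3" by (rule runs_copy) (auto simp: regs)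
      have body: "runs body \<sigma> ?\<sigma>4"
        unfolding body_def by (intro runs_Seq[OF runs_Dec] runs_Seq[OF \<sigma>2(1)] runs_Seq[OF copy] runs_Inc)
      have low: "?\<sigma>4 r = \<sigma> r" if "r < k" for r
        using that \<sigma>2(3)[of r] by (auto simp: regs)
      have mp: "map ?\<sigma>4 rest = map \<sigma> rest"
        by (rule map_cong[OF refl], rule low) (use rest in auto)
      have vals: "?\<sigma>4 c = d" "?\<sigma>4 i = Suc (\<sigma> i)" "?\<sigma>4 acc = z"
        using \<sigma>2(3)[of c] \<sigma>2(3)[of i] \<sigma>2(2) Suc.prems(1) by (auto simp: regs)
      have "\<exists>\<sigma>'. runs (While c body) ?\<sigma>4 \<sigma>' \<and> \<sigma>' acc = y \<and> (\<forall>r<k. \<sigma>' r = ?\<sigma>4 r)"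
      proof (rule Suc.IH)
        show "?\<sigma>4 c = d" by (rule vals)
        show "evals (PrimRec g h) (?\<sigma>4 i # map ?\<sigma>4 rest) (?\<sigma>4 acc)" unfolding mp vals by (rule z)
        show "evals (PrimRec g h) ((?\<sigma>4 i + d) # map ?\<sigma>4 rest) y"
          unfolding mp vals using Suc.prems(3) by simp
      qed
      then obtain \<sigma>' where \<sigma>': "runs (While c body) ?\<sigma>4 \<sigma>'" "\<sigma>' acc = y" "\<And>r. r < k \<Longrightarrow> \<sigma>' r = ?\<sigma>4 r" by blast
      have "runs (While c body) \<sigma> \<sigma>'"
        by (rule runs_While_Suc[OF _ body \<sigma>'(1)]) (use Suc.prems(1) in simp)
      moreover have "\<sigma>' r = \<sigma> r" if "r < k" for r using \<sigma>'(3)[OF that] low[OF that] by (rule trans)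
      ultimately show ?case using \<sigma>'(2) by blast
    qed
    define R where "R = Seq (copy a c t) (Seq (clear i) (Seq P (Seq (While c body) (copy acc out t))))"
    have "\<exists>\<sigma>'. runs R \<sigma> \<sigma>' \<and> \<sigma>' out = y \<and> (\<forall>r<k. r \<noteq> out \<longrightarrow> \<sigma>' r = \<sigma> r)"
      if ev: "evals (PrimRec g h) (map \<sigma> ins) y" for \<sigma> y
    proof -
      have ev': "evals (PrimRec g h) (\<sigma> a # map \<sigma> rest) y" using ev Cons by simp
      obtain z where z: "evals (PrimRec g h) (0 # map \<sigma> rest) z"
        using evals_PrimRec_le[OF ev', of 0] by auto
      then have gz: "evals g (map \<sigma> rest) z" by (auto elim: evals_PrimRec0E)
      let ?\<sigma>1 = "\<sigma>(c := \<sigma> a, t := 0)"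
      let ?\<sigma>2 = "?\<sigma>1(i := 0)"
      have 1: "runs (copy a c t) \<sigma> ?\<sigma>1" by (rule runs_copy) (use a in \<open>auto simp: regs\<close>)
      have mp2: "map ?\<sigma>2 rest = map \<sigma> rest" using rest by (intro map_cong) (auto simp: regs)
      have "evals g (map ?\<sigma>2 rest) z" unfolding mp2 by (rule gz)
      from realizesD[OF P this] obtain \<sigma>3 where \<sigma>3: "runs P ?\<sigma>2 \<sigma>3" "\<sigma>3 acc = z"
        "\<And>r. r < K \<Longrightarrow> r \<noteq> acc \<Longrightarrow> \<sigma>3 r = ?\<sigma>2 r" by blast
      have vals: "\<sigma>3 c = \<sigma> a" "\<sigma>3 i = 0" using \<sigma>3(3)[of c] \<sigma>3(3)[of i] by (auto simp: regs)
      have low: "\<sigma>3 r = \<sigma> r" if "r < k" for r using \<sigma>3(3)[of r] that by (auto simp: regs)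
      have mp: "map \<sigma>3 rest = map \<sigma> rest" using rest low by (intro map_cong) auto
      obtain \<sigma>4 where \<sigma>4: "runs (While c body) \<sigma>3 \<sigma>4" "\<sigma>4 acc = y" "\<And>r. r < k \<Longrightarrow> \<sigma>4 r = \<sigma>3 r"
        using loop[of \<sigma>3 "\<sigma> a" y, OF vals(1)] z ev' \<sigma>3(2) by (auto simp: mp vals)
      have 5: "runs (copy acc out t) \<sigma>4 (\<sigma>4(out := \<sigma>4 acc, t := 0))"
        by (rule runs_copy) (use out in \<open>auto simp: regs\<close>)
      have "runs R \<sigma> (\<sigma>4(out := \<sigma>4 acc, t := 0))"
        unfolding R_def by (intro runs_Seq[OF 1] runs_Seq[OF runs_clear] runs_Seq[OF \<sigma>3(1)] runs_Seq[OF \<sigma>4(1)] 5)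
      moreover have "(\<sigma>4(out := \<sigma>4 acc, t := 0)) r = \<sigma> r" if "r < k" "r \<noteq> out" for r
        using that \<sigma>4(3) low by (auto simp: regs)
      moreover have "(\<sigma>4(out := \<sigma>4 acc, t := 0)) out = y" using \<sigma>4(2) out by (auto simp: regs)
      ultimately show ?thesis by blast
    qed
    then have "realizes R (PrimRec g h) ins out k" unfolding realizes_def by blast
    then show ?thesis by (rule exI)
  qed
qed

lemma realizable_Mu:
  assumes g: "realizable g"
  shows "realizable (Mu g)"
  unfolding realizable_def
proof (intro allI impI)
  fix ins :: "nat list" and out k :: nat
  assume ins: "set ins \<subseteq> {..<k}" and out: "out < k" "out \<notin> set ins"
  have "\<exists>P. realizes P g (out # ins) k (Suc k)"
    by (rule realizableD[OF g]) (use ins out in auto)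
  then obtain P where P: "realizes P g (out # ins) k (Suc k)" by blast
  define body where "body = Seq (Inc out) P"
  have loop: "\<exists>\<sigma>'. runs (While k body) \<sigma> \<sigma>' \<and> \<sigma>' out = n \<and> (\<forall>r<k. r \<noteq> out \<longrightarrow> \<sigma>' r = \<sigma> r)"
    if "n - \<sigma> out = d" "\<sigma> out \<le> n" "evals g (\<sigma> out # map \<sigma> ins) (\<sigma> k)"
      "evals g (n # map \<sigma> ins) 0" "\<forall>m<n. \<exists>z. evals g (m # map \<sigma> ins) (Suc z)" for \<sigma> d n
    using that
  proof (induction d arbitrary: \<sigma>)
    case 0
    then have "\<sigma> out = n" by simp
    with 0 have "\<sigma> k = 0" using evals_determ by blast
    with \<open>\<sigma> out = n\<close> show ?case using runs_While_0[of \<sigma> k] by blast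
  next
    case (Suc d)
    then have less: "\<sigma> out < n" by simp
    then obtain z where "evals g (\<sigma> out # map \<sigma> ins) (Suc z)" using Suc.prems(5) by blast
    then have pos: "0 < \<sigma> k" using evals_determ[OF Suc.prems(3)] by simp
    let ?\<sigma>1 = "\<sigma>(out := Suc (\<sigma> out))"
    have mp1: "map ?\<sigma>1 ins = map \<sigma> ins" using out by (intro map_cong) auto
    have "\<exists>y. evals g (Suc (\<sigma> out) # map \<sigma> ins) y"
    proof (cases "Suc (\<sigma> out) = n")
      case True
      then show ?thesis using Suc.prems(4) by blast
    next
      case False
      then have "Suc (\<sigma> out) < n" using less by simp
      then show ?thesis using Suc.prems(5) by blast
    qed
    then obtain y where y: "evals g (map ?\<sigma>1 (out # ins)) y" using mp1 by auto
    from realizesD[OF P y] obtain \<sigma>2 where \<sigma>2: "runs P ?\<sigma>1 \<sigma>2" "\<sigma>2 k = y"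
      "\<And>r. r < Suc k \<Longrightarrow> r \<noteq> k \<Longrightarrow> \<sigma>2 r = ?\<sigma>1 r" by blast
    have o2: "\<sigma>2 out = Suc (\<sigma> out)" using \<sigma>2(3)[of out] out by simp
    have low: "\<sigma>2 r = \<sigma> r" if "r < k" "r \<noteq> out" for r using \<sigma>2(3)[of r] that by simp
    have mp2: "map \<sigma>2 ins = map \<sigma> ins" using ins out low by (intro map_cong) auto
    have "\<exists>\<sigma>'. runs (While k body) \<sigma>2 \<sigma>' \<and> \<sigma>' out = n \<and> (\<forall>r<k. r \<noteq> out \<longrightarrow> \<sigma>' r = \<sigma>2 r)"
    proof (rule Suc.IH)
      show "evals g (\<sigma>2 out # map \<sigma>2 ins) (\<sigma>2 k)" using y mp1 by (simp add: o2 mp2 \<sigma>2(2))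
    qed (unfold mp2 o2, use Suc.prems less in auto)
    then obtain \<sigma>' where \<sigma>': "runs (While k body) \<sigma>2 \<sigma>'" "\<sigma>' out = n" "\<forall>r<k. r \<noteq> out \<longrightarrow> \<sigma>' r = \<sigma>2 r" by blast
    have "runs (While k body) \<sigma> \<sigma>'"
      by (rule runs_While_Suc[of \<sigma> k, OF pos _ \<sigma>'(1)]) (use runs_Seq[OF runs_Inc \<sigma>2(1)] in \<open>simp add: body_def\<close>)
    then show ?case using \<sigma>'(2,3) low by auto
  qed
  define R where "R = Seq (clear out) (Seq P (While k body))"
  have "\<exists>\<sigma>'. runs R \<sigma> \<sigma>' \<and> \<sigma>' out = n \<and> (\<forall>r<k. r \<noteq> out \<longrightarrow> \<sigma>' r = \<sigma> r)"
    if ev: "evals (Mu g) (map \<sigma> ins) n" for \<sigma> n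
  proof -
    have ev': "evals g (n # map \<sigma> ins) 0" "\<forall>m<n. \<exists>z. evals g (m # map \<sigma> ins) (Suc z)"
      using ev by (auto elim: evals_MuE)
    let ?\<sigma>1 = "\<sigma>(out := 0)"
    have mp1: "map ?\<sigma>1 ins = map \<sigma> ins" using out by (intro map_cong) auto
    have "\<exists>y. evals g (0 # map \<sigma> ins) y" using ev' by (cases n) auto
    then obtain y where y: "evals g (map ?\<sigma>1 (out # ins)) y" using mp1 by auto
    from realizesD[OF P y] obtain \<sigma>2 where \<sigma>2: "runs P ?\<sigma>1 \<sigma>2" "\<sigma>2 k = y"
      "\<And>r. r < Suc k \<Longrightarrow> r \<noteq> k \<Longrightarrow> \<sigma>2 r = ?\<sigma>1 r" by blast
    have o2: "\<sigma>2 out = 0" using \<sigma>2(3)[of out] out by simp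
    have low: "\<sigma>2 r = \<sigma> r" if "r < k" "r \<noteq> out" for r using \<sigma>2(3)[of r] that by simp
    have mp2: "map \<sigma>2 ins = map \<sigma> ins" using ins out low by (intro map_cong) auto
    have "\<exists>\<sigma>'. runs (While k body) \<sigma>2 \<sigma>' \<and> \<sigma>' out = n \<and> (\<forall>r<k. r \<noteq> out \<longrightarrow> \<sigma>' r = \<sigma>2 r)"
    proof (rule loop[OF refl])
      show "evals g (\<sigma>2 out # map \<sigma>2 ins) (\<sigma>2 k)" using y mp1 by (simp add: o2 mp2 \<sigma>2(2))
    qed (unfold mp2 o2, use ev' in auto)
    then obtain \<sigma>' where \<sigma>': "runs (While k body) \<sigma>2 \<sigma>'" "\<sigma>' out = n" "\<forall>r<k. r \<noteq> out \<longrightarrow> \<sigma>' r = \<sigma>2 r" by blast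
    have "runs R \<sigma> \<sigma>'" unfolding R_def by (intro runs_Seq[OF runs_clear] runs_Seq[OF \<sigma>2(1)] \<sigma>'(1))
    then show ?thesis using \<sigma>'(2,3) low by auto
  qed
  then have "realizes R (Mu g) ins out k" unfolding realizes_def by blast
  then show "\<exists>P. realizes P (Mu g) ins out k" by (rule exI)
qed

lemma realizable: "realizable g"
proof (induction g)
  case (Comp h gs)
  then show ?case by (intro realizable_Comp) auto
qed (intro realizable_Zero realizable_Succ realizable_Proj realizable_PrimRec realizable_Mu; assumption)+

section \<open>Running loop programs on Turing machines\<close>

fun incs :: "bool list \<Rightarrow> bool list" where
  "incs [] = [False]"
| "incs (b # s) = (if b then False # incs s else True # s)"

fun decs :: "bool list \<Rightarrow> bool list" where
  "decs [] = []"
| "decs (b # s) = (if b then False # s else if s = [] then [] else True # decs s)"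

lemma nat_of_str_incs: "nat_of_str (incs s) = Suc (nat_of_str s)"
  by (induction s) auto

lemma nat_of_str_eq_0 [simp]: "nat_of_str s = 0 \<longleftrightarrow> s = []"
  by (cases s) auto

lemma nat_of_str_decs: "nat_of_str (decs s) = nat_of_str s - 1"
proof (induction s)
  case (Cons b s)
  then show ?case using nat_of_str_eq_0[of s] by (cases "nat_of_str s") auto
qed simp

lemma str_of_nat_Suc: "str_of_nat (Suc n) = incs (str_of_nat n)"
  using nat_of_str_incs[of "str_of_nat n"] by (metis nat_of_str_inverse str_of_nat_inverse)

lemma str_of_nat_diff_1: "str_of_nat (n - 1) = decs (str_of_nat n)"
  using nat_of_str_decs[of "str_of_nat n"] by (metis nat_of_str_inverse str_of_nat_inverse)

lemma str_of_nat_0 [simp]: "str_of_nat 0 = []"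
  by (metis nat_of_str.simps(1) nat_of_str_inverse)

text \<open>
  Every instruction acts on one tape; it maps the scanned symbol to the symbol to be written, the
  move and the next address.
\<close>

type_synonym instr = "nat \<times> (nat \<Rightarrow> nat \<times> move \<times> nat)"

definition code_inc :: "nat \<Rightarrow> nat \<Rightarrow> instr list" where
  "code_inc r q = [
     (r, \<lambda>s. (s, MoveR, q + 1)),
     (r, \<lambda>s. if s = 2 then (1, MoveR, q + 1) else if s = 1 then (2, MoveL, q + 2) else (1, MoveL, q + 2)),
     (r, \<lambda>s. if s = 0 then (0, Stay, q + 3) else (s, MoveL, q + 2))]"

definition code_dec :: "nat \<Rightarrow> nat \<Rightarrow> instr list" where
  "code_dec r q = [
     (r, \<lambda>s. (s, MoveR, q + 1)),
     (r, \<lambda>s. if s = 1 then (2, MoveR, q + 1) else if s = 2 then (1, MoveL, q + 3) else (0, MoveL, q + 2)),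
     (r, \<lambda>s. (0, MoveL, q + 3)),
     (r, \<lambda>s. if s = 0 then (0, Stay, q + 4) else (s, MoveL, q + 3))]"

fun psize :: "prog \<Rightarrow> nat" where
  "psize (Inc r) = 3"
| "psize (Dec r) = 4"
| "psize (Seq P Q) = psize P + psize Q"
| "psize (While r P) = psize P + 3"

fun code :: "prog \<Rightarrow> nat \<Rightarrow> instr list" where
  "code (Inc r) q = code_inc r q"
| "code (Dec r) q = code_dec r q"
| "code (Seq P Q) q = code P q @ code Q (q + psize P)"
| "code (While r P) q =
     [(r, \<lambda>s. (s, MoveR, q + 1)),
      (r, \<lambda>s. if s = 0 then (0, MoveL, q + 3 + psize P) else (s, MoveL, q + 2))] @
     code P (q + 2) @
     [(r, \<lambda>s. (s, Stay, q))]"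

lemma length_code [simp]: "length (code P q) = psize P"
  by (induction P arbitrary: q) (auto simp: code_inc_def code_dec_def)

fun regs :: "prog \<Rightarrow> nat set" where
  "regs (Inc r) = {r}"
| "regs (Dec r) = {r}"
| "regs (Seq P Q) = regs P \<union> regs Q"
| "regs (While r P) = insert r (regs P)"

lemma finite_regs: "finite (regs P)"
  by (induction P) auto

definition wf_instr :: "nat \<Rightarrow> nat \<Rightarrow> instr \<Rightarrow> bool" where
  "wf_instr K N i \<longleftrightarrow> fst i < K \<and>
     (\<forall>s<3. fst (snd i s) < 3 \<and> snd (snd (snd i s)) < N)"

lemma wf_code:
  "regs P \<subseteq> {..<K} \<Longrightarrow> q + psize P < N \<Longrightarrow> i \<in> set (code P q) \<Longrightarrow> wf_instr K N i"
proof (induction P arbitrary: q)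
  case (Seq P Q)
  have "i \<in> set (code P q) \<or> i \<in> set (code Q (q + psize P))" using Seq.prems(3) by auto
  then show ?case
    using Seq.IH(1)[of q] Seq.IH(2)[of "q + psize P"] Seq.prems(1,2) by (elim disjE) auto
next
  case (While r P)
  from While.prems(3) consider "i \<in> set (code P (q + 2))" | "i \<notin> set (code P (q + 2))" by blast
  then show ?case
  proof cases
    case 1
    then show ?thesis using While.IH[of "q + 2"] While.prems(1,2) by simp
  next
    case 2
    then show ?thesis using While.prems by (auto simp: wf_instr_def)
  qed
qed (auto simp: wf_instr_def code_inc_def code_dec_def)

definition wf_program :: "nat \<Rightarrow> instr list \<Rightarrow> bool" where
  "wf_program K C \<longleftrightarrow> 2 \<le> K \<and> 5 \<le> length C \<and> (\<forall>i\<in>set C. wf_instr K (length C) i)"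

text \<open>
  States are addresses; the first step, in state 0, moves every head to the left, onto the blank
  before the word on the tape, and goes to address 5.
\<close>

definition machine :: "nat \<Rightarrow> instr list \<Rightarrow> otm" where
  "machine K C = \<lparr>states = length C, symbols = 3, tapes = K, start = 0, halt = 1, query = 2, yes = 3, no = 4,
     delta = (\<lambda>q xs. if q = 0 then (5, map (\<lambda>x. (x, MoveL)) xs)
       else case C ! q of (r, g) \<Rightarrow> case g (xs ! r) of (w, m, q') \<Rightarrow>
         (q', (map (\<lambda>x. (x, Stay)) xs)[r := (w, m)]))\<rparr>"

lemma oracle_tm_machine:
  assumes "wf_program K C" "5 < length C"
  shows "oracle_tm (machine K C)"
proof -
  have "case delta (machine K C) q xs of (q', acts) \<Rightarrow>
      q' < length C \<and> length acts = K \<and> fst ` set acts \<subseteq> {..<3}"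
    if q: "q < length C" and xs: "length xs = K" "set xs \<subseteq> {..<3}" for q xs
  proof (cases "q = 0")
    case True
    then show ?thesis using xs assms by (auto simp: machine_def)
  next
    case False
    obtain r g where rg: "C ! q = (r, g)" by force
    have "wf_instr K (length C) (r, g)"
      using assms(1) nth_mem[OF q] rg by (simp add: wf_program_def)
    then have r: "r < K" and g: "\<And>s. s < 3 \<Longrightarrow> fst (g s) < 3 \<and> snd (snd (g s)) < length C"
      by (auto simp: wf_instr_def)
    obtain w m q' where w: "g (xs ! r) = (w, m, q')" by (metis surj_pair)
    have "xs ! r < 3" using r xs by (metis nth_mem lessThan_iff subsetD)
    from g[OF this] have "w < 3" "q' < length C" by (auto simp: w)
    moreover have "set ((map (\<lambda>x. (x, Stay)) xs)[r := (w, m)]) \<subseteq> insert (w, m) ((\<lambda>x. (x, Stay)) ` set xs)"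
      using set_update_subset_insert[of "map (\<lambda>x. (x, Stay)) xs" r "(w, m)"] by simp
    ultimately show ?thesis using False xs by (fastforce simp: machine_def rg w)
  qed
  moreover have "C \<noteq> []" using assms(2) by auto
  ultimately show ?thesis using assms unfolding oracle_tm_def wf_program_def by (simp add: machine_def)
qed

definition reach :: "nat \<Rightarrow> instr list \<Rightarrow> bool list set \<Rightarrow> config \<Rightarrow> config \<Rightarrow> bool" where
  "reach K C X c c' \<longleftrightarrow> (\<exists>n. (step (machine K C) X ^^ n) c = c')"

lemma reach_step: "step (machine K C) X c = c' \<Longrightarrow> reach K C X c c'"
  unfolding reach_def by (rule exI[of _ 1]) simp

lemma reach_trans [trans]: "reach K C X a b \<Longrightarrow> reach K C X b c \<Longrightarrow> reach K C X a c"
  unfolding reach_def by (metis comp_apply funpow_add)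

definition frame :: "nat \<Rightarrow> nat \<Rightarrow> tape list \<Rightarrow> bool" where
  "frame K r ts \<longleftrightarrow> length ts = K \<and> r < K \<and> (\<forall>i<K. i \<noteq> r \<longrightarrow> snd (ts ! i) \<noteq> [])"

definition has_code :: "instr list \<Rightarrow> nat \<Rightarrow> instr list \<Rightarrow> bool" where
  "has_code C q l \<longleftrightarrow> (\<forall>i<length l. C ! (q + i) = l ! i)"

lemma has_code_append: "has_code C q (l @ l') \<longleftrightarrow> has_code C q l \<and> has_code C (q + length l) l'"
proof
  assume *: "has_code C q (l @ l')"
  have "C ! (q + length l + i) = l' ! i" if "i < length l'" for i
    using *[unfolded has_code_def, rule_format, of "length l + i"] that by (simp add: add.assoc)
  moreover have "C ! (q + i) = l ! i" if "i < length l" for i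
    using *[unfolded has_code_def, rule_format, of i] that by (simp add: nth_append)
  ultimately show "has_code C q l \<and> has_code C (q + length l) l'" by (simp add: has_code_def)
next
  assume *: "has_code C q l \<and> has_code C (q + length l) l'"
  have "C ! (q + i) = (l @ l') ! i" if "i < length (l @ l')" for i
  proof (cases "i < length l")
    case True
    then show ?thesis using * by (simp add: has_code_def nth_append)
  next
    case False
    then show ?thesis
      using that *[THEN conjunct2, unfolded has_code_def, rule_format, of "i - length l"]
      by (simp add: nth_append)
  qed
  then show "has_code C q (l @ l')" by (simp add: has_code_def)
qed

lemma has_code_Cons: "has_code C q (a # l) \<longleftrightarrow> C ! q = a \<and> has_code C (Suc q) l"
  using has_code_append[of C q "[a]" l] by (simp add: has_code_def)

lemma reach_instr:
  assumes fr: "frame K r ts" and q: "3 \<le> q" and C: "C ! q = (r, g)"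
    and g: "g (read_tape t) = (w, m, q')"
  shows "reach K C X (q, ts[r := t]) (q', ts[r := move_tape m (write_tape w t)])"
proof (rule reach_step)
  let ?ts = "ts[r := t]"
  have len: "length ts = K" "r < K" using fr by (auto simp: frame_def)
  have stay: "move_tape Stay (write_tape (read_tape u) u) = u" if "snd u \<noteq> []" for u
    using that by (cases u; cases "snd u") (auto simp: write_tape_def read_tape_def cell_def)
  have "map2 (\<lambda>(x, m) t. move_tape m (write_tape x t))
      ((map (\<lambda>x. (x, Stay)) (map read_tape ?ts))[r := (w, m)]) ?ts
    = ts[r := move_tape m (write_tape w t)]"
  proof (rule nth_equalityI)
    fix i assume "i < length (map2 (\<lambda>(x, m) t. move_tape m (write_tape x t))
      ((map (\<lambda>x. (x, Stay)) (map read_tape ?ts))[r := (w, m)]) ?ts)"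
    then have i: "i < K" using len by simp
    show "map2 (\<lambda>(x, m) t. move_tape m (write_tape x t))
      ((map (\<lambda>x. (x, Stay)) (map read_tape ?ts))[r := (w, m)]) ?ts ! i
      = ts[r := move_tape m (write_tape w t)] ! i"
      using i len fr stay[of "ts ! i"] by (cases "i = r") (simp_all add: frame_def)
  qed (simp add: len)
  moreover have "map read_tape ?ts ! r = read_tape t" using len by simp
  ultimately show "step (machine K C) X (q, ?ts) = (q', ts[r := move_tape m (write_tape w t)])"
    using q C g by (simp add: step_def machine_def)
qed

lemma bit_sym_simps [simp]: "bit_sym b \<noteq> 0" "bit_sym b = 2 \<longleftrightarrow> b" "bit_sym b = 1 \<longleftrightarrow> \<not> b" "bit_sym b = Suc 0 \<longleftrightarrow> \<not> b"
  "bit_sym True = 2" "bit_sym False = 1"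
  by (auto simp: bit_sym_def)

lemma cell_simps [simp]: "cell [] = 0" "cell (x # xs) = x"
  by (auto simp: cell_def)

lemma reach_return:
  assumes fr: "frame K r ts" and q: "3 \<le> q"
    and C: "C ! q = (r, \<lambda>s. if s = 0 then (0, Stay, q') else (s, MoveL, q))"
  shows "reach K C X (q, ts[r := move_tape MoveL (map bit_sym d @ 0 # z, rs)])
    (q', ts[r := (z, 0 # map bit_sym (rev d) @ rs)])"
proof (induction d arbitrary: rs)
  case Nil
  show ?case
    using reach_instr[OF fr q C, of "(z, 0 # rs)" 0 Stay q' X]
    by (simp add: read_tape_def write_tape_def)
next
  case (Cons b d)
  have "reach K C X (q, ts[r := (map bit_sym d @ 0 # z, bit_sym b # rs)])
     (q, ts[r := move_tape MoveL (map bit_sym d @ 0 # z, bit_sym b # rs)])"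
    using reach_instr[OF fr q C, of "(map bit_sym d @ 0 # z, bit_sym b # rs)" "bit_sym b" MoveL q X]
    by (simp add: read_tape_def write_tape_def)
  from reach_trans[OF this Cons.IH[of "bit_sym b # rs"]] show ?case by simp
qed

lemma reach_inc_scan:
  assumes fr: "frame K r ts" and q: "3 \<le> q" and C: "has_code C q (code_inc r q)"
  shows "\<exists>j'. reach K C X (q + 1, ts[r := (map bit_sym d @ 0 # z, map bit_sym s @ replicate j 0)])
    (q + 3, ts[r := (z, 0 # map bit_sym (rev d @ incs s) @ replicate j' 0)])"
proof (induction s arbitrary: d)
  case Nil
  have C1: "C ! (q + 1) = (r, \<lambda>s. if s = 2 then (1, MoveR, q + 1) else if s = 1 then (2, MoveL, q + 2) else (1, MoveL, q + 2))"
    and C2: "C ! (q + 2) = (r, \<lambda>s. if s = 0 then (0, Stay, q + 3) else (s, MoveL, q + 2))"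
    using C by (simp_all add: code_inc_def has_code_Cons numeral_2_eq_2)
  let ?t = "(map bit_sym d @ 0 # z, replicate j 0)"
  have rd: "read_tape ?t = 0" by (cases j) (simp_all add: read_tape_def)
  have wr: "write_tape 1 ?t = (map bit_sym d @ 0 # z, 1 # replicate (j - 1) 0)"
    by (cases j) (simp_all add: write_tape_def)
  have "reach K C X (q + 1, ts[r := ?t])
      (q + 2, ts[r := move_tape MoveL (map bit_sym d @ 0 # z, 1 # replicate (j - 1) 0)])"
    using reach_instr[OF fr _ C1, of ?t 1 MoveL "q + 2" X] q unfolding rd wr by simp
  from reach_trans[OF this reach_return[OF fr _ C2]] q show ?case
    by (intro exI[of _ "j - 1"]) simp
next
  case (Cons b s)
  have C1: "C ! (q + 1) = (r, \<lambda>s. if s = 2 then (1, MoveR, q + 1) else if s = 1 then (2, MoveL, q + 2) else (1, MoveL, q + 2))"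
    and C2: "C ! (q + 2) = (r, \<lambda>s. if s = 0 then (0, Stay, q + 3) else (s, MoveL, q + 2))"
    using C by (simp_all add: code_inc_def has_code_Cons numeral_2_eq_2)
  let ?t = "(map bit_sym d @ 0 # z, map bit_sym (b # s) @ replicate j 0)"
  show ?case
  proof (cases b)
    case True
    have "reach K C X (q + 1, ts[r := ?t]) (q + 1, ts[r := (map bit_sym (False # d) @ 0 # z, map bit_sym s @ replicate j 0)])"
      using reach_instr[OF fr _ C1, of ?t 1 MoveR "q + 1" X] q True
      by (simp add: read_tape_def write_tape_def)
    moreover obtain j' where "reach K C X (q + 1, ts[r := (map bit_sym (False # d) @ 0 # z, map bit_sym s @ replicate j 0)])
       (q + 3, ts[r := (z, 0 # map bit_sym (rev (False # d) @ incs s) @ replicate j' 0)])"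
      using Cons.IH by blast
    ultimately have "reach K C X (q + 1, ts[r := ?t])
       (q + 3, ts[r := (z, 0 # map bit_sym (rev (False # d) @ incs s) @ replicate j' 0)])"
      by (rule reach_trans)
    then show ?thesis using True by (intro exI[of _ j']) simp
  next
    case False
    have "reach K C X (q + 1, ts[r := ?t])
       (q + 2, ts[r := move_tape MoveL (map bit_sym d @ 0 # z, map bit_sym (True # s) @ replicate j 0)])"
      using reach_instr[OF fr _ C1, of ?t 2 MoveL "q + 2" X] q False
      by (simp add: read_tape_def write_tape_def)
    from reach_trans[OF this reach_return[OF fr _ C2]] q False show ?thesis
      by (intro exI[of _ j]) simp
  qed
qed

lemma reach_dec_scan:
  assumes fr: "frame K r ts" and q: "3 \<le> q" and C: "has_code C q (code_dec r q)" and s: "s \<noteq> []"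
  shows "\<exists>j'. reach K C X (q + 1, ts[r := (map bit_sym d @ 0 # z, map bit_sym s @ replicate j 0)])
    (q + 4, ts[r := (z, 0 # map bit_sym (rev d @ decs s) @ replicate j' 0)])"
  using s
proof (induction s arbitrary: d)
  case (Cons b s)
  have C1: "C ! (q + 1) = (r, \<lambda>s. if s = 1 then (2, MoveR, q + 1) else if s = 2 then (1, MoveL, q + 3) else (0, MoveL, q + 2))"
    and C2: "C ! (q + 2) = (r, \<lambda>s. (0, MoveL, q + 3))"
    and C3: "C ! (q + 3) = (r, \<lambda>s. if s = 0 then (0, Stay, q + 4) else (s, MoveL, q + 3))"
    using C by (simp_all add: code_dec_def has_code_Cons numeral_2_eq_2 numeral_3_eq_3)
  let ?t = "(map bit_sym d @ 0 # z, map bit_sym (b # s) @ replicate j 0)"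
  show ?case
  proof (cases b)
    case True
    have "reach K C X (q + 1, ts[r := ?t])
       (q + 3, ts[r := move_tape MoveL (map bit_sym d @ 0 # z, map bit_sym (False # s) @ replicate j 0)])"
      using reach_instr[OF fr _ C1, of ?t 1 MoveL "q + 3" X] q True
      by (simp add: read_tape_def write_tape_def)
    from reach_trans[OF this reach_return[OF fr _ C3]] q True show ?thesis
      by (intro exI[of _ j]) simp
  next
    case False
    let ?u = "(map bit_sym (True # d) @ 0 # z, map bit_sym s @ replicate j 0)"
    have 1: "reach K C X (q + 1, ts[r := ?t]) (q + 1, ts[r := ?u])"
      using reach_instr[OF fr _ C1, of ?t 2 MoveR "q + 1" X] q False
      by (simp add: read_tape_def write_tape_def)
    show ?thesis
    proof (cases "s = []")
      case True
      have rd: "read_tape ?u = 0" using True by (cases j) (simp_all add: read_tape_def)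
      have wr: "write_tape 0 ?u = (map bit_sym (True # d) @ 0 # z, 0 # replicate (j - 1) 0)"
        using True by (cases j) (simp_all add: write_tape_def)
      let ?v = "(map bit_sym d @ 0 # z, 2 # 0 # replicate (j - 1) 0)"
      have 2: "reach K C X (q + 1, ts[r := ?u]) (q + 2, ts[r := ?v])"
        using reach_instr[OF fr _ C1, of ?u 0 MoveL "q + 2" X] q unfolding rd wr by simp
      have 3: "reach K C X (q + 2, ts[r := ?v])
         (q + 3, ts[r := move_tape MoveL (map bit_sym d @ 0 # z, 0 # 0 # replicate (j - 1) 0)])"
        using reach_instr[OF fr _ C2, where t = ?v and X = X] q by (simp add: write_tape_def)
      have 4: "reach K C X (q + 3, ts[r := move_tape MoveL (map bit_sym d @ 0 # z, 0 # 0 # replicate (j - 1) 0)])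
         (q + 4, ts[r := (z, 0 # map bit_sym (rev d) @ 0 # 0 # replicate (j - 1) 0)])"
        using reach_return[OF fr _ C3] q by simp
      from reach_trans[OF 1 reach_trans[OF 2 reach_trans[OF 3 4]]] show ?thesis
        using True False by (intro exI[of _ "Suc (Suc (j - 1))"]) simp
    next
      case s: False
      then obtain j' where "reach K C X (q + 1, ts[r := ?u])
         (q + 4, ts[r := (z, 0 # map bit_sym (rev (True # d) @ decs s) @ replicate j' 0)])"
        using Cons.IH by blast
      from reach_trans[OF 1 this] show ?thesis using s False by (intro exI[of _ j']) simp
    qed
  qed
qed simp

text \<open>Between the instructions of a loop program every head rests on the blank before the word.\<close>

definition rep :: "nat \<Rightarrow> tape \<Rightarrow> bool" where
  "rep x t \<longleftrightarrow> (\<exists>i j. t = (replicate i 0, 0 # map bit_sym (str_of_nat x) @ replicate j 0))"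

lemma reach_inc:
  assumes fr: "frame K r ts" and q: "3 \<le> q" and C: "has_code C q (code_inc r q)" and t: "rep x t"
  shows "\<exists>t'. rep (Suc x) t' \<and> reach K C X (q, ts[r := t]) (q + 3, ts[r := t'])"
proof -
  obtain i j where ij: "t = (replicate i 0, 0 # map bit_sym (str_of_nat x) @ replicate j 0)"
    using t by (auto simp: rep_def)
  have C0: "C ! q = (r, \<lambda>s. (s, MoveR, q + 1))"
    using C by (simp add: code_inc_def has_code_Cons)
  have 1: "reach K C X (q, ts[r := t]) (q + 1, ts[r := (map bit_sym [] @ 0 # replicate i 0, map bit_sym (str_of_nat x) @ replicate j 0)])"
    using reach_instr[OF fr q C0, of t 0 MoveR "q + 1" X] by (simp add: ij read_tape_def write_tape_def)
  obtain j' where "reach K C X (q + 1, ts[r := (map bit_sym [] @ 0 # replicate i 0, map bit_sym (str_of_nat x) @ replicate j 0)])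
     (q + 3, ts[r := (replicate i 0, 0 # map bit_sym (rev [] @ incs (str_of_nat x)) @ replicate j' 0)])"
    using reach_inc_scan[OF fr q C] by blast
  from reach_trans[OF 1 this] show ?thesis
    by (intro exI conjI) (auto simp: rep_def str_of_nat_Suc)
qed

lemma reach_dec:
  assumes fr: "frame K r ts" and q: "3 \<le> q" and C: "has_code C q (code_dec r q)" and t: "rep x t"
  shows "\<exists>t'. rep (x - 1) t' \<and> reach K C X (q, ts[r := t]) (q + 4, ts[r := t'])"
proof -
  obtain i j where ij: "t = (replicate i 0, 0 # map bit_sym (str_of_nat x) @ replicate j 0)"
    using t by (auto simp: rep_def)
  have C0: "C ! q = (r, \<lambda>s. (s, MoveR, q + 1))"
    and C1: "C ! (q + 1) = (r, \<lambda>s. if s = 1 then (2, MoveR, q + 1) else if s = 2 then (1, MoveL, q + 3) else (0, MoveL, q + 2))"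
    and C2: "C ! (q + 2) = (r, \<lambda>s. (0, MoveL, q + 3))"
    and C3: "C ! (q + 3) = (r, \<lambda>s. if s = 0 then (0, Stay, q + 4) else (s, MoveL, q + 3))"
    using C by (simp_all add: code_dec_def has_code_Cons numeral_2_eq_2 numeral_3_eq_3)
  let ?u = "(map bit_sym [] @ 0 # replicate i 0, map bit_sym (str_of_nat x) @ replicate j 0)"
  have 1: "reach K C X (q, ts[r := t]) (q + 1, ts[r := ?u])"
    using reach_instr[OF fr q C0, of t 0 MoveR "q + 1" X] by (simp add: ij read_tape_def write_tape_def)
  show ?thesis
  proof (cases "str_of_nat x = []")
    case True
    have x: "x = 0" using True by (metis nat_of_str.simps(1) str_of_nat_inverse)
    have rd: "read_tape ?u = 0" using True by (cases j) (simp_all add: read_tape_def)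
    have wr: "write_tape 0 ?u = (0 # replicate i 0, 0 # replicate (j - 1) 0)"
      using True by (cases j) (simp_all add: write_tape_def)
    let ?v = "(replicate i 0, 0 # 0 # replicate (j - 1) 0)"
    have 2: "reach K C X (q + 1, ts[r := ?u]) (q + 2, ts[r := ?v])"
      using reach_instr[OF fr _ C1, of ?u 0 MoveL "q + 2" X] q unfolding rd wr by simp
    let ?w = "(replicate (i - 1) 0, 0 # 0 # 0 # replicate (j - 1) 0)"
    have 3: "reach K C X (q + 2, ts[r := ?v]) (q + 3, ts[r := ?w])"
      using reach_instr[OF fr _ C2, where t = ?v and X = X] q
      by (cases i) (simp_all add: write_tape_def)
    have 4: "reach K C X (q + 3, ts[r := ?w]) (q + 4, ts[r := ?w])"
      using reach_instr[OF fr _ C3, of ?w 0 Stay "q + 4" X] q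
      by (simp add: write_tape_def read_tape_def)
    have "rep 0 ?w" unfolding rep_def
      by (intro exI[of _ "i - 1"] exI[of _ "Suc (Suc (j - 1))"]) simp
    with reach_trans[OF 1 reach_trans[OF 2 reach_trans[OF 3 4]]] show ?thesis
      by (intro exI[of _ ?w]) (simp add: x)
  next
    case False
    then obtain j' where "reach K C X (q + 1, ts[r := ?u])
       (q + 4, ts[r := (replicate i 0, 0 # map bit_sym (rev [] @ decs (str_of_nat x)) @ replicate j' 0)])"
      using reach_dec_scan[OF fr q C] by blast
    from reach_trans[OF 1 this] show ?thesis
      by (intro exI conjI) (auto simp: rep_def str_of_nat_diff_1[unfolded One_nat_def])
  qed
qed

definition holds :: "nat \<Rightarrow> (nat \<Rightarrow> nat) \<Rightarrow> tape list \<Rightarrow> bool" where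
  "holds K \<sigma> ts \<longleftrightarrow> length ts = K \<and> (\<forall>i<K. rep (\<sigma> i) (ts ! i))"

lemma rep_nonempty: "rep x t \<Longrightarrow> snd t \<noteq> []"
  by (auto simp: rep_def)

lemma holds_frame: "holds K \<sigma> ts \<Longrightarrow> r < K \<Longrightarrow> frame K r ts"
  by (auto simp: holds_def frame_def rep_nonempty)

lemma holds_update: "holds K \<sigma> ts \<Longrightarrow> r < K \<Longrightarrow> rep x t \<Longrightarrow> holds K (\<sigma>(r := x)) (ts[r := t])"
  by (auto simp: holds_def nth_list_update)

lemma reach_test:
  assumes fr: "frame K r ts" and q: "3 \<le> q" and t: "rep x t"
    and C: "C ! q = (r, \<lambda>s. (s, MoveR, q + 1))"
      "C ! (q + 1) = (r, \<lambda>s. if s = 0 then (0, MoveL, q0) else (s, MoveL, q1))"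
  shows "\<exists>t'. rep x t' \<and> reach K C X (q, ts[r := t]) (if x = 0 then q0 else q1, ts[r := t'])"
proof -
  obtain i j where ij: "t = (replicate i 0, 0 # map bit_sym (str_of_nat x) @ replicate j 0)"
    using t by (auto simp: rep_def)
  let ?u = "(0 # replicate i 0, map bit_sym (str_of_nat x) @ replicate j 0)"
  have 1: "reach K C X (q, ts[r := t]) (q + 1, ts[r := ?u])"
    using reach_instr[OF fr q C(1), of t 0 MoveR "q + 1" X] by (simp add: ij read_tape_def write_tape_def)
  show ?thesis
  proof (cases "str_of_nat x")
    case Nil
    then have x: "x = 0" by (metis nat_of_str.simps(1) str_of_nat_inverse)
    have rd: "read_tape ?u = 0" using Nil by (cases j) (simp_all add: read_tape_def)
    have wr: "write_tape 0 ?u = (0 # replicate i 0, 0 # replicate (j - 1) 0)"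
      using Nil by (cases j) (simp_all add: write_tape_def)
    let ?v = "(replicate i 0, 0 # 0 # replicate (j - 1) 0)"
    have 2: "reach K C X (q + 1, ts[r := ?u]) (q0, ts[r := ?v])"
      using reach_instr[OF fr _ C(2), of ?u 0 MoveL q0 X] q unfolding rd wr by simp
    have "rep 0 ?v" unfolding rep_def
      by (intro exI[of _ i] exI[of _ "Suc (j - 1)"]) simp
    with reach_trans[OF 1 2] show ?thesis by (intro exI[of _ ?v]) (simp add: x)
  next
    case (Cons b s)
    then have x: "x \<noteq> 0" by (metis list.distinct(1) str_of_nat_0)
    have "reach K C X (q + 1, ts[r := ?u]) (q1, ts[r := t])"
      using reach_instr[OF fr _ C(2), of ?u "bit_sym b" MoveL q1 X] q Cons
      by (simp add: read_tape_def write_tape_def ij)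
    from reach_trans[OF 1 this] show ?thesis using t x by (intro exI[of _ t]) simp
  qed
qed

lemma reach_runs:
  assumes "runs P \<sigma> \<sigma>'" "regs P \<subseteq> {..<K}" "has_code C q (code P q)" "3 \<le> q" "holds K \<sigma> ts"
  shows "\<exists>ts'. holds K \<sigma>' ts' \<and> reach K C X (q, ts) (q + psize P, ts')"
  using assms
proof (induction arbitrary: q ts rule: runs.induct)
  case (runs_Inc r \<sigma>)
  then have r: "r < K" by simp
  have "rep (\<sigma> r) (ts ! r)" using runs_Inc r by (simp add: holds_def)
  from reach_inc[OF holds_frame[OF runs_Inc(4) r] runs_Inc(3) runs_Inc(2)[unfolded code.simps] this, of X]
  obtain t' where t': "rep (Suc (\<sigma> r)) t'" "reach K C X (q, ts[r := ts ! r]) (q + 3, ts[r := t'])" by blast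
  have "reach K C X (q, ts) (q + psize (Inc r), ts[r := t'])" using t'(2) by simp
  with holds_update[OF runs_Inc(4) r t'(1)] show ?case by blast
next
  case (runs_Dec r \<sigma>)
  then have r: "r < K" by simp
  have "rep (\<sigma> r) (ts ! r)" using runs_Dec r by (simp add: holds_def)
  from reach_dec[OF holds_frame[OF runs_Dec(4) r] runs_Dec(3) runs_Dec(2)[unfolded code.simps] this, of X]
  obtain t' where t': "rep (\<sigma> r - 1) t'" "reach K C X (q, ts[r := ts ! r]) (q + 4, ts[r := t'])" by blast
  have "reach K C X (q, ts) (q + psize (Dec r), ts[r := t'])" using t'(2) by simp
  with holds_update[OF runs_Dec(4) r t'(1)] show ?case by blast
next
  case (runs_Seq P \<sigma> \<sigma>' Q \<sigma>'')
  have code: "has_code C q (code P q)" "has_code C (q + psize P) (code Q (q + psize P))"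
    using runs_Seq.prems(2) by (simp_all add: has_code_append)
  obtain ts1 where 1: "holds K \<sigma>' ts1" "reach K C X (q, ts) (q + psize P, ts1)"
    using runs_Seq.IH(1)[OF _ code(1) runs_Seq.prems(3,4)] runs_Seq.prems(1) by auto
  obtain ts2 where 2: "holds K \<sigma>'' ts2" "reach K C X (q + psize P, ts1) (q + psize P + psize Q, ts2)"
    using runs_Seq.IH(2)[OF _ code(2) _ 1(1)] runs_Seq.prems(1,3) by auto
  from 2(1) reach_trans[OF 1(2) 2(2)] show ?case by (auto simp: add.assoc)
next
  case (runs_While_0 \<sigma> r P)
  then have r: "r < K" by simp
  have C: "C ! q = (r, \<lambda>s. (s, MoveR, q + 1))"
      "C ! (q + 1) = (r, \<lambda>s. if s = 0 then (0, MoveL, q + 3 + psize P) else (s, MoveL, q + 2))"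
    using runs_While_0.prems(2) by (simp_all add: has_code_Cons)
  have "rep (\<sigma> r) (ts ! r)" using runs_While_0(5) r unfolding holds_def by blast
  from reach_test[OF holds_frame[OF runs_While_0(5) r] runs_While_0(4) this C, of X]
  obtain t' where t': "rep (\<sigma> r) t'" "reach K C X (q, ts[r := ts ! r]) (q + 3 + psize P, ts[r := t'])"
    using runs_While_0(1) by auto
  then have "holds K \<sigma> (ts[r := t'])" using holds_update[OF runs_While_0(5) r t'(1)] by simp
  then show ?case using t'(2) by (intro exI[of _ "ts[r := t']"]) (simp add: ac_simps)
next
  case (runs_While_Suc \<sigma> r P \<sigma>' \<sigma>'')
  then have r: "r < K" by simp
  have C: "C ! q = (r, \<lambda>s. (s, MoveR, q + 1))"
      "C ! (q + 1) = (r, \<lambda>s. if s = 0 then (0, MoveL, q + 3 + psize P) else (s, MoveL, q + 2))"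
    and body: "has_code C (q + 2) (code P (q + 2))"
    and jump: "C ! (q + 2 + psize P) = (r, \<lambda>s. (s, Stay, q))"
    using runs_While_Suc.prems(2) by (simp_all add: has_code_Cons has_code_append)
  have "rep (\<sigma> r) (ts ! r)" using runs_While_Suc.prems(4) r unfolding holds_def by blast
  from reach_test[OF holds_frame[OF runs_While_Suc.prems(4) r] runs_While_Suc.prems(3) this C, of X]
  obtain t' where t': "rep (\<sigma> r) t'" "reach K C X (q, ts[r := ts ! r]) (q + 2, ts[r := t'])"
    using runs_While_Suc(1) by auto
  then have h1: "holds K \<sigma> (ts[r := t'])" using holds_update[OF runs_While_Suc.prems(4) r t'(1)] by simp
  obtain ts2 where 2: "holds K \<sigma>' ts2" "reach K C X (q + 2, ts[r := t']) (q + 2 + psize P, ts2)"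
    using runs_While_Suc.IH(1)[OF _ body _ h1] runs_While_Suc.prems(1,3) by auto
  have fr2: "frame K r ts2" by (rule holds_frame[OF 2(1) r])
  have "snd (ts2 ! r) \<noteq> []" using 2(1) r by (auto simp: holds_def rep_nonempty)
  then have "write_tape (read_tape (ts2 ! r)) (ts2 ! r) = ts2 ! r"
    by (cases "ts2 ! r"; cases "snd (ts2 ! r)") (auto simp: write_tape_def read_tape_def)
  then have "move_tape Stay (write_tape (read_tape (ts2 ! r)) (ts2 ! r)) = ts2 ! r"
    by (cases "ts2 ! r") auto
  with reach_instr[OF fr2 _ jump, of "ts2 ! r" "read_tape (ts2 ! r)" Stay q X] runs_While_Suc.prems(3)
  have 3: "reach K C X (q + 2 + psize P, ts2) (q, ts2)" by simp
  obtain ts3 where 4: "holds K \<sigma>'' ts3" "reach K C X (q, ts2) (q + psize (While r P), ts3)"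
    using runs_While_Suc.IH(2)[OF runs_While_Suc.prems(1-3) 2(1)] by blast
  have "reach K C X (q, ts) (q + psize (While r P), ts3)"
    using reach_trans[OF _ reach_trans[OF 2(2) reach_trans[OF 3 4(2)]]] t'(2) by simp
  with 4(1) show ?case by blast
qed

lemma tape_word_rep: "tape_word (ls, map bit_sym w @ replicate j 0) = w"
proof -
  have "takeWhile (\<lambda>x. x = 1 \<or> x = 2) (map bit_sym w @ replicate j 0) = map bit_sym w"
  proof -
    have "takeWhile (\<lambda>x. x = 1 \<or> x = 2) (replicate j (0 :: nat)) = []" by (cases j) auto
    then show ?thesis by (subst takeWhile_append2) (auto simp: bit_sym_def)
  qed
  then show ?thesis by (simp add: tape_word_def comp_def)
qed

lemma reach_enter_word:
  assumes fr: "frame K r ts" and q: "3 \<le> q" and C: "C ! q = (r, \<lambda>s. (s, MoveR, q'))" and t: "rep x t"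
  shows "\<exists>i j. reach K C X (q, ts[r := t])
    (q', ts[r := (0 # replicate i 0, map bit_sym (str_of_nat x) @ replicate j 0)])"
proof -
  obtain i j where ij: "t = (replicate i 0, 0 # map bit_sym (str_of_nat x) @ replicate j 0)"
    using t by (auto simp: rep_def)
  have "reach K C X (q, ts[r := t]) (q', ts[r := (0 # replicate i 0, map bit_sym (str_of_nat x) @ replicate j 0)])"
    using reach_instr[OF fr q C, of t 0 MoveR q' X] by (simp add: ij read_tape_def write_tape_def)
  then show ?thesis by blast
qed

lemma reach_leave_word:
  assumes fr: "frame K r ts" and q: "3 \<le> q" and C: "C ! q = (r, \<lambda>s. (s, MoveL, q'))"
  shows "\<exists>t. rep x t \<and> reach K C X
    (q, ts[r := (0 # replicate i 0, map bit_sym (str_of_nat x) @ replicate j 0)]) (q', ts[r := t])"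
proof -
  let ?u = "(0 # replicate i 0, map bit_sym (str_of_nat x) @ replicate j 0)"
  let ?t = "move_tape MoveL (write_tape (read_tape ?u) ?u)"
  have "rep x ?t"
  proof (cases "snd ?u = []")
    case True
    then have "str_of_nat x = []" "j = 0" by auto
    then show ?thesis unfolding rep_def
      by (intro exI[of _ i] exI[of _ 1]) (simp add: write_tape_def read_tape_def)
  next
    case False
    then have "write_tape (read_tape ?u) ?u = ?u"
      by (cases "snd ?u") (auto simp: write_tape_def read_tape_def)
    then show ?thesis unfolding rep_def
      by (intro exI[of _ i] exI[of _ j]) simp
  qed
  moreover have "reach K C X (q, ts[r := ?u]) (q', ts[r := ?t])"
    by (rule reach_instr[OF fr q C refl])
  ultimately show ?thesis by blast
qed

theorem ex_oracle_machine:
  "\<exists>M. oracle_tm M \<and> (\<forall>n x y. evals g [n, x] y \<longrightarrow>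
     otm_output M {str_of_nat x} (str_of_nat n) (str_of_nat y))"
proof -
  have "\<exists>P. realizes P g [0, 1] 2 3"
    by (rule realizableD[OF realizable]) auto
  then obtain P0 where P0: "realizes P0 g [0, 1] 2 3" by blast
  define P where "P = Seq P0 (copy 2 0 3)"
  have P: "\<exists>\<sigma>'. runs P \<sigma> \<sigma>' \<and> \<sigma>' 0 = y" if "evals g [\<sigma> 0, \<sigma> 1] y" for \<sigma> y
  proof -
    from that have "evals g (map \<sigma> [0, 1]) y" by simp
    from realizesD[OF P0 this] obtain \<sigma>1 where 1: "runs P0 \<sigma> \<sigma>1" "\<sigma>1 2 = y" by blast
    have "runs (copy 2 0 3) \<sigma>1 (\<sigma>1(0 := \<sigma>1 2, 3 := 0))" by (rule runs_copy) auto
    from runs_Seq[OF 1(1) this] show ?thesis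
      unfolding P_def by (intro exI[of _ "\<sigma>1(0 := \<sigma>1 2, 3 := 0)"]) (simp add: 1(2))
  qed
  obtain K where K: "regs P \<subseteq> {..<K}" "2 \<le> K"
  proof -
    obtain k where "\<forall>r\<in>regs P. r < k" using finite_regs finite_nat_set_iff_bounded by blast
    then show ?thesis by (intro that[of "max k 2"]) auto
  qed
  define e where "e = 10 + psize P"
  define halting :: instr where "halting = (0, \<lambda>s. (0, Stay, 0))"
  define C where "C = [halting, halting, halting,
      (1, \<lambda>s. (s, MoveL, 10)),
      (1, \<lambda>s. (s, MoveL, 6)),
      (1, \<lambda>s. (s, MoveR, 2))] @ code (Inc 1) 6 @
      [(1, \<lambda>s. (s, Stay, 5))] @ code P 10 @ [(0, \<lambda>s. (s, MoveR, 1))]"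
  have len: "length C = e + 1" by (simp add: C_def e_def code_inc_def)
  have C: "C ! 3 = (1, \<lambda>s. (s, MoveL, 10))" "C ! 4 = (1, \<lambda>s. (s, MoveL, 6))"
    "C ! 5 = (1, \<lambda>s. (s, MoveR, 2))" "has_code C 6 (code (Inc 1) 6)"
    "C ! 9 = (1, \<lambda>s. (s, Stay, 5))" "has_code C 10 (code P 10)" "C ! e = (0, \<lambda>s. (s, MoveR, 1))"
  proof -
    have "has_code C 0 C" by (simp add: has_code_def)
    from this[unfolded C_def has_code_Cons has_code_append]
    show "C ! 3 = (1, \<lambda>s. (s, MoveL, 10))" "C ! 4 = (1, \<lambda>s. (s, MoveL, 6))"
      "C ! 5 = (1, \<lambda>s. (s, MoveR, 2))" "has_code C 6 (code (Inc 1) 6)"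
      "C ! 9 = (1, \<lambda>s. (s, Stay, 5))" "has_code C 10 (code P 10)" "C ! e = (0, \<lambda>s. (s, MoveR, 1))"
      unfolding C_def[symmetric] e_def
      by (simp_all add: eval_nat_numeral code_inc_def)
  qed
  have wf: "wf_program K C"
  proof -
    have "wf_instr K (length C) i" if "i \<in> set (code (Inc 1) 6)" for i
      by (rule wf_code[OF _ _ that]) (use K in \<open>auto simp: len e_def\<close>)
    moreover have "wf_instr K (length C) i" if "i \<in> set (code P 10)" for i
      by (rule wf_code[OF K(1) _ that]) (simp add: len e_def)
    moreover have "set C = {halting, (1, \<lambda>s. (s, MoveL, 10)), (1, \<lambda>s. (s, MoveL, 6)), (1, \<lambda>s. (s, MoveR, 2)),
        (1, \<lambda>s. (s, Stay, 5)), (0, \<lambda>s. (s, MoveR, 1))} \<union> set (code (Inc 1) 6) \<union> set (code P 10)"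
      unfolding C_def by auto
    moreover have "wf_instr K (length C) i" if "i \<in> {halting, (1, \<lambda>s. (s, MoveL, 10)),
        (1, \<lambda>s. (s, MoveL, 6)), (1, \<lambda>s. (s, MoveR, 2)), (1, \<lambda>s. (s, Stay, 5)), (0, \<lambda>s. (s, MoveR, 1))}" for i
      using that K(2) by (auto simp: wf_instr_def halting_def len e_def)
    ultimately have "\<forall>i\<in>set C. wf_instr K (length C) i" by blast
    then show ?thesis using K(2) by (simp add: wf_program_def len e_def)
  qed
  let ?M = "machine K C"
  have "otm_output ?M {str_of_nat x} (str_of_nat n) (str_of_nat y)" if ev: "evals g [n, x] y" for n x y
  proof -
    let ?X = "{str_of_nat x}"
    have start: "\<exists>ts. holds K (\<lambda>r. if r = 0 then n else 0) ts \<and>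
        reach K C ?X (init_config ?M (str_of_nat n)) (5, ts)"
    proof -
      let ?ts = "([], map bit_sym (str_of_nat n)) # replicate (K - 1) ([], [])"
      let ?m = "\<lambda>t. move_tape MoveL (write_tape (read_tape t) t)"
      have "map2 (\<lambda>(x, m) t. move_tape m (write_tape x t)) (map (\<lambda>x. (x, MoveL)) (map read_tape ?ts)) ?ts
          = map ?m ?ts"
        by (rule nth_equalityI) auto
      then have "step ?M ?X (0, ?ts) = (5, map ?m ?ts)"
        by (simp add: step_def machine_def)
      then have "reach K C ?X (init_config ?M (str_of_nat n)) (5, map ?m ?ts)"
        by (intro reach_step) (simp add: init_config_def machine_def)
      moreover have "holds K (\<lambda>r. if r = 0 then n else 0) (map ?m ?ts)"
      proof -
        have "rep 0 (?m ([], []))" unfolding rep_def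
          by (intro exI[of _ 0] exI[of _ 1]) (simp add: read_tape_def write_tape_def)
        moreover have "rep n (?m ([], map bit_sym (str_of_nat n)))"
        proof (cases "str_of_nat n")
          case Nil
          then show ?thesis unfolding rep_def
            by (intro exI[of _ 0] exI[of _ 1]) (simp add: read_tape_def write_tape_def)
        next
          case (Cons b s)
          then show ?thesis unfolding rep_def
            by (intro exI[of _ 0]) (simp add: read_tape_def write_tape_def)
        qed
        ultimately show ?thesis using K(2) by (auto simp: holds_def nth_Cons')
      qed
      ultimately show ?thesis by blast
    qed
    have query: "\<exists>ts'. holds K \<sigma> ts' \<and> reach K C ?X (5, ts) (if \<sigma> 1 = x then 10 else 6, ts')"
      if h: "holds K \<sigma> ts" for \<sigma> ts
    proof -
      have fr: "frame K 1 ts" by (rule holds_frame[OF h]) (use K in simp)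
      have r: "rep (\<sigma> 1) (ts ! 1)" using h K(2) by (simp add: holds_def)
      have "3 \<le> (5 :: nat)" by simp
      from reach_enter_word[OF fr this C(3) r, of ?X]
      obtain i j where 1: "reach K C ?X (5, ts)
         (2, ts[1 := (0 # replicate i 0, map bit_sym (str_of_nat (\<sigma> 1)) @ replicate j 0)])"
        by auto
      let ?ts = "ts[1 := (0 # replicate i 0, map bit_sym (str_of_nat (\<sigma> 1)) @ replicate j 0)]"
      let ?q = "if \<sigma> 1 = x then 3 else 4 :: nat"
      have "length ts = K" using h by (simp add: holds_def)
      then have "tape_word (?ts ! 1) = str_of_nat (\<sigma> 1)"
        using K(2) tape_word_rep by simp
      then have "step ?M ?X (2, ?ts) = (?q, ?ts)"
        by (auto simp: step_def machine_def)
      then have 2: "reach K C ?X (2, ?ts) (?q, ?ts)" by (rule reach_step)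
      have Cq: "C ! ?q = (1, \<lambda>s. (s, MoveL, if \<sigma> 1 = x then 10 else 6))" using C(1,2) by simp
      have "3 \<le> ?q" by simp
      from reach_leave_word[OF fr this Cq, of "\<sigma> 1" ?X i j]
      obtain t where t: "rep (\<sigma> 1) t" "reach K C ?X (?q, ?ts) (if \<sigma> 1 = x then 10 else 6, ts[1 := t])" by blast
      have "holds K \<sigma> (ts[1 := t])"
        using holds_update[OF h _ t(1), of 1] K(2) by simp
      with reach_trans[OF 1 reach_trans[OF 2 t(2)]] show ?thesis by blast
    qed
    have search: "\<exists>\<sigma>' ts'. holds K \<sigma>' ts' \<and> \<sigma>' 0 = n \<and> \<sigma>' 1 = x \<and> reach K C ?X (5, ts) (10, ts')"
      if "d = x - \<sigma> 1" "\<sigma> 1 \<le> x" "\<sigma> 0 = n" "holds K \<sigma> ts" for d \<sigma> ts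
      using that
    proof (induction d arbitrary: \<sigma> ts)
      case 0
      then have "\<sigma> 1 = x" by simp
      with query[OF 0(4)] 0(3) show ?case by auto
    next
      case (Suc d)
      then have ne: "\<sigma> 1 \<noteq> x" by auto
      obtain ts1 where 1: "holds K \<sigma> ts1" "reach K C ?X (5, ts) (6, ts1)"
        using query[OF Suc.prems(4)] ne by auto
      have "\<exists>ts'. holds K (\<sigma>(1 := Suc (\<sigma> 1))) ts' \<and> reach K C ?X (6, ts1) (6 + psize (Inc 1), ts')"
        by (rule reach_runs[OF runs_Inc _ C(4) _ 1(1)]) (use K in auto)
      then obtain ts2 where 2: "holds K (\<sigma>(1 := Suc (\<sigma> 1))) ts2" "reach K C ?X (6, ts1) (9, ts2)" by auto
      have fr2: "frame K 1 ts2" by (rule holds_frame[OF 2(1)]) (use K in simp)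
      have "rep ((\<sigma>(1 := Suc (\<sigma> 1))) 1) (ts2 ! 1)" 
        using 2(1)[unfolded holds_def, THEN conjunct2, rule_format, of 1] K(2) by (metis less_le_trans one_less_numeral_iff semiring_norm(76))
      then have "snd (ts2 ! 1) \<noteq> []" by (rule rep_nonempty)
      then have "move_tape Stay (write_tape (read_tape (ts2 ! 1)) (ts2 ! 1)) = ts2 ! 1"
        by (cases "ts2 ! 1"; cases "snd (ts2 ! 1)") (auto simp: write_tape_def read_tape_def)
      with reach_instr[OF fr2 _ C(5), of "ts2 ! 1" "read_tape (ts2 ! 1)" Stay 5 ?X]
      have 3: "reach K C ?X (9, ts2) (5, ts2)" by simp
      have "\<exists>\<sigma>' ts'. holds K \<sigma>' ts' \<and> \<sigma>' 0 = n \<and> \<sigma>' 1 = x \<and> reach K C ?X (5, ts2) (10, ts')"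
        by (rule Suc.IH[OF _ _ _ 2(1)]) (use Suc.prems ne in auto)
      then obtain \<sigma>' ts' where 4: "holds K \<sigma>' ts'" "\<sigma>' 0 = n" "\<sigma>' 1 = x" "reach K C ?X (5, ts2) (10, ts')"
        by blast
      from reach_trans[OF 1(2) reach_trans[OF 2(2) reach_trans[OF 3 4(4)]]] 4(1-3) show ?case by blast
    qed
    from start obtain ts0 where 0: "holds K (\<lambda>r. if r = 0 then n else 0) ts0"
      "reach K C ?X (init_config ?M (str_of_nat n)) (5, ts0)" by blast
    from search[OF refl _ _ 0(1)] obtain \<sigma>1 ts1 where 1: "holds K \<sigma>1 ts1" "\<sigma>1 0 = n" "\<sigma>1 1 = x"
      "reach K C ?X (5, ts0) (10, ts1)" by auto
    obtain \<sigma>2 where 2: "runs P \<sigma>1 \<sigma>2" "\<sigma>2 0 = y" using P[of \<sigma>1 y] ev 1(2,3) by auto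
    have "\<exists>ts'. holds K \<sigma>2 ts' \<and> reach K C ?X (10, ts1) (10 + psize P, ts')"
      by (rule reach_runs[OF 2(1) K(1) C(6) _ 1(1)]) simp
    then obtain ts2 where 3: "holds K \<sigma>2 ts2" "reach K C ?X (10, ts1) (e, ts2)" by (auto simp: e_def)
    have fr: "frame K 0 ts2" by (rule holds_frame[OF 3(1)]) (use K in simp)
    have "0 < K" using K(2) by simp
    then have r: "rep y (ts2 ! 0)" using 3(1) 2(2) unfolding holds_def by blast
    have "3 \<le> e" by (simp add: e_def)
    from reach_enter_word[OF fr this C(7) r, of ?X]
    obtain i j where 4: "reach K C ?X (e, ts2)
       (1, ts2[0 := (0 # replicate i 0, map bit_sym (str_of_nat y) @ replicate j 0)])" by auto
    let ?ts = "ts2[0 := (0 # replicate i 0, map bit_sym (str_of_nat y) @ replicate j 0)]"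
    have "length ts2 = K" using 3(1) by (simp add: holds_def)
    then have "tape_word (?ts ! 0) = str_of_nat y" using K(2) tape_word_rep by simp
    moreover have "reach K C ?X (init_config ?M (str_of_nat n)) (halt ?M, ?ts)"
      using reach_trans[OF 0(2) reach_trans[OF 1(4) reach_trans[OF 3(2) 4]]] by (simp add: machine_def)
    ultimately show ?thesis unfolding otm_output_def reach_def by blast
  qed
  moreover have "oracle_tm ?M" by (rule oracle_tm_machine[OF wf]) (simp add: len e_def)
  ultimately show ?thesis by blast
qed

section \<open>Approximating the halting probability\<close>

lemma kraft_inequality:
  assumes "finite S" "prefix_free S"
  shows "(\<Sum>s\<in>S. (1 / 2) ^ length s) \<le> (1 :: real)"
proof -
  obtain n where "\<forall>s\<in>S. length s \<le> n"
    using finite_nat_set_iff_bounded_le[of "length ` S"] assms(1) by auto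
  then show ?thesis using assms
  proof (induction n arbitrary: S)
    case 0
    then have "S \<subseteq> {[]}" by auto
    then have "S = {} \<or> S = {[]}" by blast
    then show ?case by auto
  next
    case (Suc n)
    show ?case
    proof (cases "[] \<in> S")
      case True
      then have "S = {[]}" using Suc.prems(3) unfolding prefix_free_def by (metis insertI1 insert_absorb is_singletonI' is_singleton_the_elem prefix_bot.bot_least singletonD)
      then show ?thesis by simp
    next
      case False
      define A where "A b = {s. b # s \<in> S}" for b
      have fin: "finite (A b)" for b
        using finite_vimageI[OF Suc.prems(2), of "(#) b"] by (simp add: A_def vimage_def)
      have le: "(\<Sum>s\<in>A b. (1 / 2) ^ length s) \<le> (1 :: real)" for b
      proof (rule Suc.IH[OF _ fin])
        show "\<forall>s\<in>A b. length s \<le> n" using Suc.prems(1) by (auto simp: A_def)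
        show "prefix_free (A b)"
          using Suc.prems(3) unfolding prefix_free_def A_def
          by (metis Cons_prefix_Cons list.inject mem_Collect_eq)
      qed
      have S: "S = (#) True ` A True \<union> (#) False ` A False"
      proof
        show "S \<subseteq> (#) True ` A True \<union> (#) False ` A False"
        proof
          fix s assume s: "s \<in> S"
          then obtain b u where "s = b # u" using False by (cases s) auto
          then show "s \<in> (#) True ` A True \<union> (#) False ` A False"
            using s by (cases b) (auto simp: A_def)
        qed
      qed (auto simp: A_def)
      have half: "(\<Sum>s\<in>(#) b ` A b. (1 / 2) ^ length s) = (1 / 2 :: real) * (\<Sum>s\<in>A b. (1 / 2) ^ length s)" for b
        by (subst sum.reindex) (auto simp: sum_distrib_left inj_on_def)
      have "(\<Sum>s\<in>S. (1 / 2) ^ length s) = (1 / 2 :: real) * (\<Sum>s\<in>A True. (1 / 2) ^ length s)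
          + (1 / 2) * (\<Sum>s\<in>A False. (1 / 2) ^ length s)"
        unfolding half[symmetric] by (subst S, rule sum.union_disjoint) (use fin in auto)
      then show ?thesis using le[of True] le[of False] by simp
    qed
  qed
qed

lemma prefix_free_subset: "prefix_free S \<Longrightarrow> T \<subseteq> S \<Longrightarrow> prefix_free T"
  unfolding prefix_free_def by blast

lemma Omega_summable:
  assumes "prefix_free (dom V)"
  shows "(\<lambda>p. (1 / 2 :: real) ^ length p) summable_on dom V"
proof (rule nonneg_bdd_above_summable_on)
  show "bdd_above (sum (\<lambda>p. (1 / 2 :: real) ^ length p) ` {F. F \<subseteq> dom V \<and> finite F})"
    using kraft_inequality prefix_free_subset[OF assms] by (intro bdd_aboveI[of _ 1]) auto
qed simp

lemma Omega_ge:
  assumes "prefix_free (dom V)" "finite F" "F \<subseteq> dom V"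
  shows "(\<Sum>p\<in>F. (1 / 2) ^ length p) \<le> Omega V"
  unfolding Omega_def by (rule finite_sum_le_infsum[OF Omega_summable]) (use assms in auto)

lemma Omega_nonneg: "0 \<le> Omega V"
  unfolding Omega_def by (rule infsum_nonneg) simp

lemma Omega_approx:
  assumes "prefix_free (dom V)" "0 < \<epsilon>"
  obtains F where "finite F" "F \<subseteq> dom V" "Omega V - \<epsilon> < (\<Sum>p\<in>F. (1 / 2) ^ length p)"
proof -
  have "((\<lambda>p. (1 / 2 :: real) ^ length p) has_sum Omega V) (dom V)"
    unfolding Omega_def by (rule has_sum_infsum[OF Omega_summable[OF assms(1)]])
  then have "\<forall>\<^sub>F F in finite_subsets_at_top (dom V). dist (\<Sum>p\<in>F. (1 / 2) ^ length p) (Omega V) < \<epsilon>"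
    unfolding has_sum_def using assms(2) by (rule tendstoD)
  then obtain F where "finite F" "F \<subseteq> dom V" "dist (\<Sum>p\<in>F. (1 / 2) ^ length p) (Omega V) < \<epsilon>"
    unfolding eventually_finite_subsets_at_top by blast
  then show ?thesis by (intro that[of F]) (auto simp: dist_real_def)
qed

definition bits_value :: "nat \<Rightarrow> nat \<Rightarrow> nat" where
  "bits_value n x = (\<Sum>i<n. of_bool (nat_of_str (drop i (str_of_nat x)) \<noteq> 0 \<and> even (nat_of_str (drop i (str_of_nat x))))
     * 2 ^ (n - Suc i))"

lemma length_bin_prefix [simp]: "length (bin_prefix \<alpha> n) = n"
  by (simp add: bin_prefix_def)

lemma bits_value_bin_prefix: "int (bits_value n (nat_of_str (bin_prefix \<alpha> n))) = \<lfloor>2 ^ n * frac \<alpha>\<rfloor>"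
proof -
  have bit: "nat_of_str (drop i (bin_prefix \<alpha> n)) \<noteq> 0 \<and> even (nat_of_str (drop i (bin_prefix \<alpha> n)))
      \<longleftrightarrow> bin_digit \<alpha> (Suc i)" if "i < n" for i
  proof -
    have "drop i (bin_prefix \<alpha> n) = bin_digit \<alpha> (Suc i) # drop (Suc i) (bin_prefix \<alpha> n)"
      using that by (simp add: Cons_nth_drop_Suc[symmetric] bin_prefix_def del: upt_Suc)
    then show ?thesis by simp
  qed
  have "bits_value n (nat_of_str (bin_prefix \<alpha> n)) = (\<Sum>i<n. of_bool (bin_digit \<alpha> (Suc i)) * 2 ^ (n - Suc i))"
    unfolding bits_value_def nat_of_str_inverse by (rule sum.cong) (simp_all only: bit lessThan_iff)
  then have "int (bits_value n (nat_of_str (bin_prefix \<alpha> n))) = (\<Sum>i<n. of_bool (bin_digit \<alpha> (Suc i)) * 2 ^ (n - Suc i))"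
    by (simp only: of_nat_sum of_nat_mult of_nat_of_bool of_nat_power of_nat_numeral)
  also have "\<dots> = \<lfloor>2 ^ n * frac \<alpha>\<rfloor>"
  proof (induction n)
    case 0
    show ?case using frac_lt_1[of \<alpha>] frac_ge_0[of \<alpha>] by (simp add: floor_eq_iff)
  next
    case (Suc n)
    have "(\<Sum>i<Suc n. of_bool (bin_digit \<alpha> (Suc i)) * 2 ^ (Suc n - Suc i))
      = (\<Sum>i<n. of_bool (bin_digit \<alpha> (Suc i)) * (2 * 2 ^ (n - Suc i))) + (of_bool (bin_digit \<alpha> (Suc n)) :: int)"
    proof -
      have "(2 :: int) ^ (Suc n - Suc i) = 2 * 2 ^ (n - Suc i)" if "i < n" for i
        using that by (simp add: Suc_diff_Suc flip: power_Suc)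
      then show ?thesis by simp
    qed
    also have "\<dots> = 2 * \<lfloor>2 ^ n * frac \<alpha>\<rfloor> + of_bool (bin_digit \<alpha> (Suc n))"
      unfolding Suc.IH[symmetric] by (simp only: sum_distrib_left mult.left_commute[of 2])
    also have "\<dots> = \<lfloor>2 ^ Suc n * frac \<alpha>\<rfloor>"
      using floor_double[of "2 ^ n * frac \<alpha>"] by (simp add: bin_digit_def mult.assoc)
    finally show ?case .
  qed
  finally show ?thesis .
qed

section \<open>Bounded and unbounded gaps\<close>

lemma restrict_length_eq:
  "restrict_length S (int n + int m - int c)
     = {s. nat_of_str s < 2 ^ (n + m + 1 - c) - 1 \<and> str_of_nat (nat_of_str s) \<in> S}"
proof -
  have "int (length s) \<le> int n + int m - int c \<longleftrightarrow> length s < n + m + 1 - c" for s :: "bool list"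
    by linarith
  then show ?thesis
    unfolding restrict_length_def length_less_iff_nat_of_str by (auto simp: less_diff_conv)
qed

lemma computer_stages:
  assumes "computer V"
  obtains T :: "nat \<Rightarrow> nat \<Rightarrow> nat"
  where "trec 2 (\<lambda>xs. T (xs ! 0) (xs ! 1))"
    and "\<And>x t t' y. T t x = Suc y \<Longrightarrow> t \<le> t' \<Longrightarrow> T t' x = Suc y"
    and "\<And>s u. V s = Some u \<longleftrightarrow> (\<exists>t. T t (nat_of_str s) = Suc (nat_of_str u))"
proof -
  have "partial_recursive (\<lambda>x. map_option nat_of_str (V (str_of_nat x)))"
    using assms by (simp add: computer_def partial_recursive_str_def)
  then obtain T where T: "trec 2 (\<lambda>xs. T (xs ! 0) (xs ! 1))"
    "\<And>x t t' y. T t x = Suc y \<Longrightarrow> t \<le> t' \<Longrightarrow> T t' x = Suc y"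
    "\<And>x y. map_option nat_of_str (V (str_of_nat x)) = Some y \<longleftrightarrow> (\<exists>t. T t x = Suc y)"
    by (rule partial_recursive_stages) (rule that)
  have "V s = Some u \<longleftrightarrow> (\<exists>t. T t (nat_of_str s) = Suc (nat_of_str u))" for s u
    using T(3)[of "nat_of_str s" "nat_of_str u"] by auto
  with T(1,2) show ?thesis by (rule that)
qed

lemma stages_dom_iff:
  assumes "\<And>s u. V s = Some u \<longleftrightarrow> (\<exists>t. T t (nat_of_str s) = Suc (nat_of_str u))"
  shows "s \<in> dom V \<longleftrightarrow> (\<exists>t. T t (nat_of_str s) \<noteq> 0)"
proof
  assume "\<exists>t. T t (nat_of_str s) \<noteq> 0"
  then obtain t y where "T t (nat_of_str s) = Suc y" using not0_implies_Suc by blast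
  then have "T t (nat_of_str s) = Suc (nat_of_str (str_of_nat y))" by simp
  then show "s \<in> dom V" using assms by blast
next
  assume "s \<in> dom V"
  then obtain t u where "T t (nat_of_str s) = Suc (nat_of_str u)" using assms by blast
  then show "\<exists>t. T t (nat_of_str s) \<noteq> 0" by (metis nat.distinct(1))
qed

lemma stages_finite:
  fixes T :: "nat \<Rightarrow> nat \<Rightarrow> nat"
  assumes mono: "\<And>x t t' y. T t x = Suc y \<Longrightarrow> t \<le> t' \<Longrightarrow> T t' x = Suc y"
    and "finite F" "\<And>x. x \<in> F \<Longrightarrow> \<exists>t. T t x \<noteq> 0"
  shows "\<exists>t. \<forall>t'\<ge>t. \<forall>x\<in>F. T t' x \<noteq> 0"
  using assms(2,3)
proof (induction F rule: finite_induct)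
  case (insert x F)
  then obtain t where t: "\<forall>t'\<ge>t. \<forall>x\<in>F. T t' x \<noteq> 0" by blast
  obtain u y where "T u x = Suc y" using insert.prems not0_implies_Suc by blast
  then have "\<forall>t'\<ge>u. T t' x \<noteq> 0" using mono by (metis nat.distinct(1))
  with t show ?case by (intro exI[of _ "t + u"]) auto
qed simp

lemma trec_apply_Suc:
  assumes "partial_recursive ((Some \<circ> f) |` {1..})"
  shows "trec 1 (\<lambda>xs. f (Suc (xs ! 0)))"
proof -
  obtain g where g: "\<And>x y. ((Some \<circ> f) |` {1..}) x = Some y \<longleftrightarrow> evals g [x] y"
    using assms unfolding partial_recursive_def by blast
  have "evals (Comp g [Succ]) xs (f (Suc (xs ! 0)))" if "length xs = 1" for xs
  proof -
    obtain x where xs: "xs = [x]" using \<open>length xs = 1\<close> by (cases xs) auto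
    have "evals g [Suc x] (f (Suc x))" by (simp flip: g)
    then show ?thesis unfolding xs by (intro evals_Comp[of _ _ "[Suc x]"]) (auto intro: evals_Succ)
  qed
  then show ?thesis unfolding trec_def by blast
qed

lemma computerI:
  assumes "partial_recursive G" "prefix_free {s. G (nat_of_str s) \<noteq> None}"
  shows "computer (\<lambda>s. map_option str_of_nat (G (nat_of_str s)))"
proof -
  have "map_option nat_of_str (map_option str_of_nat (G (nat_of_str (str_of_nat x)))) = G x" for x
    by (simp add: option.map_comp comp_def option.map_ident)
  moreover have "dom (\<lambda>s. map_option str_of_nat (G (nat_of_str s))) = {s. G (nat_of_str s) \<noteq> None}"
    by (auto simp: dom_def)
  ultimately show ?thesis
    using assms by (simp add: computer_def partial_recursive_str_def)
qed

lemma ex_machine_if_bounded: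
  assumes V: "optimal V" and W: "optimal W" and f: "partial_recursive ((Some \<circ> f) |` {1..})"
    and B: "\<And>n. 1 \<le> n \<Longrightarrow> f n \<le> B"
  shows "\<exists>M c. oracle_tm M \<and> (\<forall>n\<ge>1. otm_output M {bin_prefix (Omega V) n} (str_of_nat n)
    (code_set (restrict_length (dom W) (int n + int (f n) - int c))))"
proof -
  have cV: "computer V" and cW: "computer W" using V W by (auto simp: optimal_def)
  then have pfV: "prefix_free (dom V)" and pfW: "prefix_free (dom W)" by (auto simp: computer_def)
  obtain TV where TV: "trec 2 (\<lambda>xs. TV (xs ! 0) (xs ! 1))"
    "\<And>x t t' y. TV t x = Suc y \<Longrightarrow> t \<le> t' \<Longrightarrow> TV t' x = Suc y"
    "\<And>s u. V s = Some u \<longleftrightarrow> (\<exists>t. TV t (nat_of_str s) = Suc (nat_of_str u))"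
    by (rule computer_stages[OF cV]) (rule that)
  obtain TW where TW: "trec 2 (\<lambda>xs. TW (xs ! 0) (xs ! 1))"
    "\<And>x t t' y. TW t x = Suc y \<Longrightarrow> t \<le> t' \<Longrightarrow> TW t' x = Suc y"
    "\<And>s u. W s = Some u \<longleftrightarrow> (\<exists>t. TW t (nat_of_str s) = Suc (nat_of_str u))"
    by (rule computer_stages[OF cW]) (rule that)
  note domV = stages_dom_iff[of V TV, OF TV(3)] and domW = stages_dom_iff[of W TW, OF TW(3)]
  have trV: "trec n (\<lambda>xs. TV (a xs) (b xs))" if "trec n a" "trec n b" for n a b
    by (rule trec_comp2[where F = TV, OF TV(1) that])
  have trW: "trec n (\<lambda>xs. TW (a xs) (b xs))" if "trec n a" "trec n b" for n a b
    by (rule trec_comp2[where F = TW, OF TW(1) that])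
  have trf: "trec n (\<lambda>xs. f (Suc (a xs)))" if "trec n a" for n a
    by (rule trec_comp1[where F = "\<lambda>x. f (Suc x)", OF trec_apply_Suc[OF f] that])
  define G where "G x = (if \<exists>t. 1 - TW t x = 0 then Some (LEAST t. 1 - TW t x = 0) else None)" for x
  have "partial_recursive G"
    unfolding G_def
    by (rule partial_recursive_search[where P = "\<lambda>t x. 1 - TW t x" and h = "\<lambda>t x. t"])
      (intro trec_diff trW trec_intros; simp)+
  moreover have domG: "{s. G (nat_of_str s) \<noteq> None} = dom W"
    unfolding G_def set_eq_iff domW by (auto simp: Suc_le_eq)
  ultimately have "computer (\<lambda>s. map_option str_of_nat (G (nat_of_str s)))"
    using computerI[of G] pfW by metis
  with V obtain d where d: "\<And>p. p \<in> dom W \<Longrightarrow>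
      \<exists>q. V q = map_option str_of_nat (G (nat_of_str p)) \<and> length q \<le> length p + d"
    unfolding optimal_def domG[symmetric] by (fastforce simp: dom_def)
  define c where "c = B + d + 1"
  define I where "I = nat \<lfloor>Omega V\<rfloor>"
  \<comment> \<open>\<open>S t / 2 ^ t\<close> is the weight of the programs found by stage \<open>t\<close>.\<close>
  define S where "S t = (\<Sum>x<t. if TV t x = 0 then 0 else 2 ^ (t - length (str_of_nat x)) :: nat)" for t :: nat
  define P where "P t n x = (of_bool (\<not> (bits_value n x + I * 2 ^ n) * 2 ^ t < 2 ^ n * S t + 2 ^ t) :: nat)" for t n x
  define U where "U t = (\<Sum>x<t. TV t x)" for t
  define h where "h t n = foldr (\<lambda>x acc. if TW (U t) x \<noteq> 0 then nat_of_str (code_str (str_of_nat x))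
         + 2 ^ (2 * length (str_of_nat x) + 1) * acc else acc)
       [0..<2 ^ (n + f (Suc (n - 1)) + 1 - c) - 1] 0" for t n
  have trP: "trec (Suc 2) (\<lambda>ys. P (ys ! 0) (ys ! 1) (ys ! 2))"
    unfolding P_def S_def bits_value_def by (intro trV trec_intros; simp)
  have trh: "trec (Suc 2) (\<lambda>ys. h (ys ! 0) (ys ! 1))"
    unfolding h_def U_def by (intro trW trV trf trec_intros; simp)
  obtain g where g: "\<And>xs y. length xs = 2 \<Longrightarrow> evals g xs y \<longleftrightarrow>
     (\<exists>t. P ((t # xs) ! 0) ((t # xs) ! 1) ((t # xs) ! 2) = 0 \<and>
       (\<forall>s<t. P ((s # xs) ! 0) ((s # xs) ! 1) ((s # xs) ! 2) \<noteq> 0) \<and> y = h ((t # xs) ! 0) ((t # xs) ! 1))"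
    by (rule ex_recf_search[OF trP trh]) (rule that)
  have g: "evals g [n, x] y" if "P t n x = 0" "\<And>s. s < t \<Longrightarrow> P s n x \<noteq> 0" "y = h t n" for n x y t
    using g[of "[n, x]" y] that by (auto simp: numeral_2_eq_2)
  obtain M where M: "oracle_tm M" "\<And>n x y. evals g [n, x] y \<Longrightarrow>
     otm_output M {str_of_nat x} (str_of_nat n) (str_of_nat y)"
    using ex_oracle_machine[of g] by blast
  define A where "A t = str_of_nat ` {x. x < t \<and> TV t x \<noteq> 0}" for t
  have A: "finite (A t)" "A t \<subseteq> dom V" for t
    unfolding A_def by (auto simp: subset_iff domV intro: exI[of _ t])
  have S: "real (S t) = 2 ^ t * (\<Sum>p\<in>A t. (1 / 2) ^ length p)" for t
  proof -
    have "(\<Sum>p\<in>A t. (1 / 2 :: real) ^ length p) = (\<Sum>x\<in>{x. x < t \<and> TV t x \<noteq> 0}. (1 / 2) ^ length (str_of_nat x))"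
      unfolding A_def by (subst sum.reindex) (auto simp: inj_on_def)
    also have "\<dots> = (\<Sum>x<t. if TV t x = 0 then 0 else (1 / 2) ^ length (str_of_nat x))"
      by (rule sum.mono_neutral_cong_left) auto
    finally have "2 ^ t * (\<Sum>p\<in>A t. (1 / 2 :: real) ^ length p)
        = (\<Sum>x<t. 2 ^ t * (if TV t x = 0 then 0 else (1 / 2) ^ length (str_of_nat x)))"
      by (simp only: sum_distrib_left)
    also have "\<dots> = (\<Sum>x<t. real (if TV t x = 0 then 0 else 2 ^ (t - length (str_of_nat x))))"
    proof (rule sum.cong[OF refl])
      fix x assume "x \<in> {..<t}"
      then have "length (str_of_nat x) \<le> t" using length_le_nat_of_str[of "str_of_nat x"] by simp
      then have "(2 :: real) ^ t = 2 ^ (t - length (str_of_nat x)) * 2 ^ length (str_of_nat x)"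
        by (simp flip: power_add)
      then show "2 ^ t * (if TV t x = 0 then 0 else (1 / 2) ^ length (str_of_nat x))
        = real (if TV t x = 0 then 0 else 2 ^ (t - length (str_of_nat x)))"
        by (simp add: power_one_over)
    qed
    finally show ?thesis unfolding S_def by simp
  qed
  have bv: "real (bits_value n (nat_of_str (bin_prefix (Omega V) n)) + I * 2 ^ n) = \<lfloor>2 ^ n * Omega V\<rfloor>" for n
  proof -
    have "2 ^ n * Omega V = 2 ^ n * frac (Omega V) + of_int (2 ^ n * \<lfloor>Omega V\<rfloor>)"
      by (simp add: frac_def algebra_simps)
    then have "\<lfloor>2 ^ n * Omega V\<rfloor> = \<lfloor>2 ^ n * frac (Omega V)\<rfloor> + 2 ^ n * \<lfloor>Omega V\<rfloor>"
      by (metis floor_add_int)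
    moreover have "int I = \<lfloor>Omega V\<rfloor>" using Omega_nonneg[of V] by (simp add: I_def)
    ultimately have "int (bits_value n (nat_of_str (bin_prefix (Omega V) n)) + I * 2 ^ n) = \<lfloor>2 ^ n * Omega V\<rfloor>"
      using bits_value_bin_prefix[of n "Omega V"] by simp
    then show ?thesis by (metis of_int_of_nat_eq)
  qed
  have P0: "P t n (nat_of_str (bin_prefix (Omega V) n)) = 0 \<longleftrightarrow>
      \<lfloor>2 ^ n * Omega V\<rfloor> / 2 ^ n - 1 / 2 ^ n < (\<Sum>p\<in>A t. (1 / 2) ^ length p)" for t n
  proof -
    let ?v = "bits_value n (nat_of_str (bin_prefix (Omega V) n)) + I * 2 ^ n"
    let ?\<Sigma> = "\<Sum>p\<in>A t. (1 / 2 :: real) ^ length p"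
    have "P t n (nat_of_str (bin_prefix (Omega V) n)) = 0 \<longleftrightarrow> ?v * 2 ^ t < 2 ^ n * S t + 2 ^ t"
      by (simp add: P_def)
    also have "\<dots> \<longleftrightarrow> real (?v * 2 ^ t) < real (2 ^ n * S t + 2 ^ t)" by (simp only: of_nat_less_iff)
    also have "\<dots> \<longleftrightarrow> 2 ^ t * real ?v < 2 ^ t * (2 ^ n * ?\<Sigma> + 1)"
      by (simp only: of_nat_add of_nat_mult of_nat_power of_nat_numeral S) (simp add: algebra_simps)
    also have "\<dots> \<longleftrightarrow> real ?v < 2 ^ n * ?\<Sigma> + 1" by simp
    also have "\<dots> \<longleftrightarrow> \<lfloor>2 ^ n * Omega V\<rfloor> / 2 ^ n - 1 / 2 ^ n < ?\<Sigma>"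
      unfolding bv by (simp add: field_simps)
    finally show ?thesis .
  qed
  have "otm_output M {bin_prefix (Omega V) n} (str_of_nat n)
    (code_set (restrict_length (dom W) (int n + int (f n) - int c)))" if n: "1 \<le> n" for n
  proof -
    let ?x = "nat_of_str (bin_prefix (Omega V) n)"
    let ?fl = "real_of_int \<lfloor>2 ^ n * Omega V\<rfloor>"
    have fl: "?fl / 2 ^ n \<le> Omega V" "Omega V < ?fl / 2 ^ n + 1 / 2 ^ n"
    proof -
      have "?fl \<le> 2 ^ n * Omega V" "2 ^ n * Omega V < ?fl + 1" by linarith+
      then show "?fl / 2 ^ n \<le> Omega V" "Omega V < ?fl / 2 ^ n + 1 / 2 ^ n"
        by (simp_all add: field_simps)
    qed
    have "\<exists>t. P t n ?x = 0"
    proof -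
      obtain F where F: "finite F" "F \<subseteq> dom V" "Omega V - 1 / 2 ^ n < (\<Sum>p\<in>F. (1 / 2) ^ length p)"
        by (rule Omega_approx[OF pfV, of "1 / 2 ^ n"]) auto
      have "\<exists>t. \<forall>t'\<ge>t. \<forall>x\<in>nat_of_str ` F. TV t' x \<noteq> 0"
        by (rule stages_finite[OF TV(2)]) (use F domV in auto)
      then obtain t where t: "\<forall>t'\<ge>t. \<forall>x\<in>nat_of_str ` F. TV t' x \<noteq> 0" by blast
      obtain m where m: "\<forall>x\<in>nat_of_str ` F. x < m"
        using F(1) finite_nat_set_iff_bounded[of "nat_of_str ` F"] by auto
      have "F \<subseteq> A (t + m)"
      proof
        fix p assume "p \<in> F"
        then have "nat_of_str p < t + m" "TV (t + m) (nat_of_str p) \<noteq> 0" using t m by fastforce+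
        then show "p \<in> A (t + m)" unfolding A_def by (intro image_eqI[of _ _ "nat_of_str p"]) auto
      qed
      then have "(\<Sum>p\<in>F. (1 / 2 :: real) ^ length p) \<le> (\<Sum>p\<in>A (t + m). (1 / 2) ^ length p)"
        by (intro sum_mono2 A) auto
      then have "P (t + m) n ?x = 0" unfolding P0 using F(3) fl(1) by linarith
      then show ?thesis ..
    qed
    define t where "t = (LEAST t. P t n ?x = 0)"
    have t: "P t n ?x = 0" "\<And>s. s < t \<Longrightarrow> P s n ?x \<noteq> 0"
      unfolding t_def using LeastI_ex[OF \<open>\<exists>t. P t n ?x = 0\<close>] not_less_Least by blast+
    have found: "q \<in> A t" if q: "q \<in> dom V" "length q < n" for q
    proof (rule ccontr)
      assume "q \<notin> A t"
      then have "(\<Sum>p\<in>A t. (1 / 2) ^ length p) + (1 / 2 :: real) ^ length q = (\<Sum>p\<in>insert q (A t). (1 / 2) ^ length p)"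
        using A by simp
      also have "\<dots> \<le> Omega V" by (rule Omega_ge[OF pfV]) (use A q in auto)
      finally have le: "(\<Sum>p\<in>A t. (1 / 2) ^ length p) + (1 / 2 :: real) ^ length q \<le> Omega V" .
      have "(1 / 2 :: real) ^ (n - 1) \<le> (1 / 2) ^ length q"
        using q(2) by (intro power_decreasing) auto
      moreover have "(1 / 2 :: real) ^ (n - 1) = 2 / 2 ^ n"
        using n by (cases n) (auto simp: power_one_over)
      ultimately show False using le t(1)[unfolded P0] fl(2) by linarith
    qed
    have UW: "nat_of_str p < 2 ^ (n + f n + 1 - c) - 1 \<and> TW (U t) (nat_of_str p) \<noteq> 0 \<longleftrightarrow>
       nat_of_str p < 2 ^ (n + f n + 1 - c) - 1 \<and> str_of_nat (nat_of_str p) \<in> dom W" for p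
    proof -
      have "TW (U t) (nat_of_str p) \<noteq> 0" if p: "p \<in> dom W" "nat_of_str p < 2 ^ (n + f n + 1 - c) - 1"
      proof -
        have "length p < n + f n + 1 - c" using p(2) by (simp add: length_less_iff_nat_of_str)
        then have len: "length p + d < n" using B[OF n] by (simp add: c_def)
        obtain q where q: "V q = map_option str_of_nat (G (nat_of_str p))" "length q \<le> length p + d"
          using d[OF p(1)] by blast
        define t0 where "t0 = (LEAST t. 1 - TW t (nat_of_str p) = 0)"
        have ex: "\<exists>t. 1 - TW t (nat_of_str p) = 0" using p(1) unfolding domW by (auto simp: Suc_le_eq)
        then have G: "G (nat_of_str p) = Some t0" by (simp add: G_def t0_def)
        have "1 - TW t0 (nat_of_str p) = 0" unfolding t0_def by (rule LeastI_ex[OF ex])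
        then obtain y where y: "TW t0 (nat_of_str p) = Suc y" using not0_implies_Suc by fastforce
        have Vq: "V q = Some (str_of_nat t0)" using q(1) G by simp
        then have "q \<in> dom V" by blast
        then have "q \<in> A t" by (rule found) (use q(2) len in simp)
        then have qt: "nat_of_str q < t" "TV t (nat_of_str q) \<noteq> 0" by (auto simp: A_def)
        obtain t1 where t1: "TV t1 (nat_of_str q) = Suc t0" using Vq TV(3) by auto
        obtain z where z: "TV t (nat_of_str q) = Suc z" using qt(2) not0_implies_Suc by blast
        have "TV (t + t1) (nat_of_str q) = Suc z" by (rule TV(2)[OF z]) simp
        moreover have "TV (t + t1) (nat_of_str q) = Suc t0" by (rule TV(2)[OF t1]) simp
        ultimately have "TV t (nat_of_str q) = Suc t0" using z by simp
        moreover have "TV t (nat_of_str q) \<le> U t"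
          unfolding U_def using qt(1) by (intro member_le_sum) auto
        ultimately have "t0 \<le> U t" by simp
        with TW(2)[OF y] show ?thesis by simp
      qed
      moreover have "p \<in> dom W" if "TW (U t) (nat_of_str p) \<noteq> 0" using that domW by blast
      ultimately show ?thesis by auto
    qed
    have "nat_of_str (code_set (restrict_length (dom W) (int n + int (f n) - int c))) = h t n"
      unfolding restrict_length_eq UW[symmetric]
      using nat_of_str_code_set_Collect[of "2 ^ (n + f n + 1 - c) - 1" "\<lambda>x. TW (U t) x \<noteq> 0"] n
      by (simp add: h_def)
    from M(2)[OF g[OF t this]] show ?thesis by simp
  qed
  with M(1) show ?thesis by blast
qed

lemma length_takeWhile_id:
  "foldr (\<lambda>b acc. if b then Suc acc else 0) p 0 = length (takeWhile id p)"
  by (induction p) auto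

lemma bounded_if_ex_machine:
  assumes W: "optimal W" and f: "partial_recursive ((Some \<circ> f) |` {1..})"
    and M: "oracle_tm M"
    and out: "\<And>n. 1 \<le> n \<Longrightarrow> otm_output M {bin_prefix \<alpha> n} (str_of_nat n)
      (code_set (restrict_length (dom W) (int n + int (f n) - int c)))"
  shows "bdd_above (f ` {1..})"
proof (rule ccontr)
  assume "\<not> bdd_above (f ` {1..})"
  have unbounded: "\<exists>m. N < f (Suc m)" for N
  proof (rule ccontr)
    assume le: "\<nexists>m. N < f (Suc m)"
    have "f n \<le> N" if "1 \<le> n" for n using le that by (cases n) (auto simp: not_less)
    then have "bdd_above (f ` {1..})" by (intro bdd_aboveI[of _ N]) auto
    with \<open>\<not> bdd_above (f ` {1..})\<close> show False ..
  qed
  have cW: "computer W" using W by (auto simp: optimal_def)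
  obtain TW where TW: "trec 2 (\<lambda>xs. TW (xs ! 0) (xs ! 1))"
    "\<And>x t t' y. TW t x = Suc y \<Longrightarrow> t \<le> t' \<Longrightarrow> TW t' x = Suc y"
    "\<And>s u. W s = Some u \<longleftrightarrow> (\<exists>t. TW t (nat_of_str s) = Suc (nat_of_str u))"
    by (rule computer_stages[OF cW]) (rule that)
  note domW = stages_dom_iff[of W TW, OF TW(3)]
  obtain R where R: "trec 3 (\<lambda>xs. R (xs ! 0) (xs ! 1) (xs ! 2))"
    "\<And>t t' x n y. R t x n = Suc y \<Longrightarrow> t \<le> t' \<Longrightarrow> R t' x n = Suc y"
    "\<And>x n v. otm_output M {str_of_nat x} (str_of_nat n) v \<longleftrightarrow> (\<exists>t. R t x n = Suc (nat_of_str v))"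
    using ex_otm_stages[OF M] by blast
  have trW: "trec n (\<lambda>xs. TW (a xs) (b xs))" if "trec n a" "trec n b" for n a b
    by (rule trec_comp2[where F = TW, OF TW(1) that])
  have trR: "trec n (\<lambda>xs. R (a xs) (b xs) (c xs))" if "trec n a" "trec n b" "trec n c" for n a b c
    by (rule trec_comp3[where F = R, OF R(1) that])
  have trf: "trec n (\<lambda>xs. f (Suc (a xs)))" if "trec n a" for n a
    by (rule trec_comp1[where F = "\<lambda>x. f (Suc x)", OF trec_apply_Suc[OF f] that])
  define \<nu> where "\<nu> k = (LEAST m. 2 * k \<le> f (Suc m))" for k
  have \<nu>: "2 * k \<le> f (Suc (\<nu> k))" for k
  proof -
    obtain m where "2 * k < f (Suc m)" using unbounded by blast
    then show ?thesis unfolding \<nu>_def by (intro LeastI[of "\<lambda>m. 2 * k \<le> f (Suc m)" m]) simp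
  qed
  have below: "\<not> 2 * k \<le> f (Suc m)" if "m < \<nu> k" for m k
    using not_less_Least[of m "\<lambda>m. 2 * k \<le> f (Suc m)"] that unfolding \<nu>_def by blast
  have "trec 1 (\<lambda>xs. \<nu> (xs ! 0))"
  proof -
    have tr: "trec (Suc 1) (\<lambda>ys. of_bool (\<not> 2 * ys ! 1 \<le> f (Suc (ys ! 0))))" "trec (Suc 1) (\<lambda>ys. ys ! 0)"
      by (intro trf trec_intros; simp)+
    obtain g where g: "\<And>xs y. length xs = 1 \<Longrightarrow> evals g xs y \<longleftrightarrow>
       (\<exists>t. of_bool (\<not> 2 * (t # xs) ! 1 \<le> f (Suc ((t # xs) ! 0))) = (0 :: nat) \<and>
         (\<forall>s<t. of_bool (\<not> 2 * (s # xs) ! 1 \<le> f (Suc ((s # xs) ! 0))) \<noteq> (0 :: nat)) \<and> y = (t # xs) ! 0)"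
      by (rule ex_recf_search[OF tr]) (rule that)
    have "evals g xs (\<nu> (xs ! 0))" if "length xs = 1" for xs
      unfolding g[OF that] using \<nu>[of "xs ! 0"] below[of _ "xs ! 0"]
      by (intro exI[of _ "\<nu> (xs ! 0)"] conjI allI impI) simp_all
    then show ?thesis unfolding trec_def by blast
  qed
  then have tr\<nu>: "trec n (\<lambda>xs. \<nu> (a xs))" if "trec n a" for n a
    using trec_comp1[where F = \<nu>] that by blast
  define lead where "lead x = foldr (\<lambda>b acc. if b then Suc acc else 0) (str_of_nat x) 0" for x
  have trlead: "trec n (\<lambda>xs. lead (a xs))" if "trec n a" for n a
    unfolding lead_def by (intro trec_intros that) simp_all
  define rest where "rest x = nat_of_str (drop (Suc (lead x)) (str_of_nat x))" for x
  have trrest: "trec n (\<lambda>xs. rest (a xs))" if "trec n a" for n a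
    unfolding rest_def by (intro trec_intros trlead that)
  define cut where "cut k = (2 ^ (Suc (\<nu> k) + f (Suc (\<nu> k)) + 1 - c) - 1 :: nat)" for k
  have trcut: "trec n (\<lambda>xs. cut (a xs))" if "trec n a" for n a
    unfolding cut_def by (intro trec_intros trf tr\<nu> that)
  \<comment> \<open>The domain of \<open>W\<close> below the cut is exhausted as soon as its code has the length of the code
    printed by \<open>M\<close>; so the output of \<open>M\<close> need not be decoded.\<close>
  define good where "good t x \<longleftrightarrow> length (str_of_nat (rest x)) = Suc (\<nu> (lead x)) \<and>
      R t (rest x) (Suc (\<nu> (lead x))) \<noteq> 0 \<and>
      length (str_of_nat (R t (rest x) (Suc (\<nu> (lead x))) - 1))
        = (\<Sum>y<cut (lead x). if TW t y \<noteq> 0 then 2 * length (str_of_nat y) + 1 else 0)" for t x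
  \<comment> \<open>The sum of all \<open>Suc y\<close>, for the outputs \<open>y\<close> found, exceeds every single output.\<close>
  define G where "G x = (if \<exists>t. of_bool (\<not> good t x) = (0 :: nat)
     then Some (\<Sum>y<cut (lead x). TW (LEAST t. of_bool (\<not> good t x) = (0 :: nat)) y) else None)" for x
  have "partial_recursive G"
    unfolding G_def
  proof (rule partial_recursive_search[where P = "\<lambda>t x. of_bool (\<not> good t x)" and h = "\<lambda>t x. \<Sum>y<cut (lead x). TW t y"])
    show "trec 2 (\<lambda>xs. of_bool (\<not> good (xs ! 0) (xs ! 1)))"
      unfolding good_def
      by (intro trW trR tr\<nu> trlead trrest trcut trec_intros; simp)
    show "trec 2 (\<lambda>xs. \<Sum>y<cut (lead (xs ! 1)). TW (xs ! 0) y)"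
      by (intro trW trlead trcut trec_intros; simp)
  qed
  moreover have "prefix_free {s. G (nat_of_str s) \<noteq> None}"
    unfolding prefix_free_def
  proof (intro ballI impI)
    have form: "length (drop (Suc (length (takeWhile id s))) s) = Suc (\<nu> (length (takeWhile id s)))"
      if "s \<in> {s. G (nat_of_str s) \<noteq> None}" for s
    proof -
      have "\<exists>t. good t (nat_of_str s)"
      proof (rule ccontr)
        assume "\<nexists>t. good t (nat_of_str s)"
        with that show False by (simp add: G_def)
      qed
      then obtain t where "good t (nat_of_str s)" by blast
      then show ?thesis unfolding good_def rest_def lead_def length_takeWhile_id by simp
    qed
    fix s s' assume s: "s \<in> {s. G (nat_of_str s) \<noteq> None}" "s' \<in> {s. G (nat_of_str s) \<noteq> None}" "prefix s s'"
    then obtain u where u: "s' = s @ u" by (auto simp: prefix_def)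
    have "length (takeWhile id s) < length s" using form[OF s(1)] by (cases "length (takeWhile id s) < length s") auto
    then have "\<exists>b\<in>set s. \<not> b" by (metis id_apply less_irrefl takeWhile_eq_all_conv)
    then have "takeWhile id s' = takeWhile id s" unfolding u by (metis id_apply takeWhile_append1)
    then have "length u = 0" using form[OF s(1)] form[OF s(2)] unfolding u by simp
    then show "s = s'" using u by simp
  qed
  ultimately have "computer (\<lambda>s. map_option str_of_nat (G (nat_of_str s)))" by (rule computerI)
  with W obtain d where d: "\<And>p. G (nat_of_str p) \<noteq> None \<Longrightarrow>
      \<exists>q. W q = map_option str_of_nat (G (nat_of_str p)) \<and> length q \<le> length p + d"
    unfolding optimal_def by (fastforce simp: dom_def)
  define k where "k = Suc (d + c)"
  define n where "n = Suc (\<nu> k)"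
  define s where "s = bin_prefix \<alpha> n"
  define p where "p = replicate k True @ False # s"
  define D where "D = restrict_length (dom W) (int n + int (f n) - int c)"
  have lead: "lead (nat_of_str p) = k"
    unfolding lead_def length_takeWhile_id p_def by (simp add: takeWhile_append)
  then have rest: "rest (nat_of_str p) = nat_of_str s"
    unfolding rest_def lead by (simp add: p_def)
  have cut: "cut k = 2 ^ (n + f n + 1 - c) - 1" by (simp add: cut_def n_def)
  have D: "D = {s. nat_of_str s < cut k \<and> str_of_nat (nat_of_str s) \<in> dom W}"
    unfolding D_def restrict_length_eq cut ..
  have lenD: "length (code_set D) = (\<Sum>y<cut k. if str_of_nat y \<in> dom W then 2 * length (str_of_nat y) + 1 else 0)"
    unfolding D by (rule length_code_set_Collect)
  have "otm_output M {str_of_nat (nat_of_str s)} (str_of_nat n) (code_set D)"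
    using out[of n] by (simp add: s_def n_def D_def)
  then obtain t1 where t1: "R t1 (nat_of_str s) n = Suc (nat_of_str (code_set D))"
    using R(3) by blast
  have Rval: "R t (nat_of_str s) n = Suc (nat_of_str (code_set D))" if nz: "R t (nat_of_str s) n \<noteq> 0" for t
  proof -
    obtain y where y: "R t (nat_of_str s) n = Suc y" using nz not0_implies_Suc by blast
    have "R (t + t1) (nat_of_str s) n = Suc y" by (rule R(2)[OF y]) simp
    moreover have "R (t + t1) (nat_of_str s) n = Suc (nat_of_str (code_set D))" by (rule R(2)[OF t1]) simp
    ultimately show ?thesis using y by simp
  qed
  have good: "good t (nat_of_str p) \<longleftrightarrow> R t (nat_of_str s) n \<noteq> 0 \<and>
     (\<Sum>y<cut k. if str_of_nat y \<in> dom W then 2 * length (str_of_nat y) + 1 else 0)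
       = (\<Sum>y<cut k. if TW t y \<noteq> 0 then 2 * length (str_of_nat y) + 1 else 0)" for t
    unfolding good_def lead rest lenD[symmetric] using Rval[of t] by (auto simp: n_def s_def)
  have "\<exists>t. \<forall>t'\<ge>t. \<forall>x\<in>{x. x < cut k \<and> str_of_nat x \<in> dom W}. TW t' x \<noteq> 0"
    by (rule stages_finite[OF TW(2)]) (auto simp: domW)
  then obtain t2 where t2: "\<forall>t'\<ge>t2. \<forall>x\<in>{x. x < cut k \<and> str_of_nat x \<in> dom W}. TW t' x \<noteq> 0" by blast
  have sound: "str_of_nat x \<in> dom W" if "TW t x \<noteq> 0" for t x
    using that domW[of "str_of_nat x"] by auto
  have "good (t1 + t2) (nat_of_str p)"
    unfolding good
  proof
    show "R (t1 + t2) (nat_of_str s) n \<noteq> 0" using R(2)[OF t1, of "t1 + t2"] by simp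
    show "(\<Sum>y<cut k. if str_of_nat y \<in> dom W then 2 * length (str_of_nat y) + 1 else 0)
       = (\<Sum>y<cut k. if TW (t1 + t2) y \<noteq> 0 then 2 * length (str_of_nat y) + 1 else 0)"
    proof (rule sum.cong[OF refl])
      fix y assume "y \<in> {..<cut k}"
      moreover have "t2 \<le> t1 + t2" by simp
      ultimately have "TW (t1 + t2) y \<noteq> 0 \<longleftrightarrow> str_of_nat y \<in> dom W" using t2 sound by blast
      then show "(if str_of_nat y \<in> dom W then 2 * length (str_of_nat y) + 1 else 0)
         = (if TW (t1 + t2) y \<noteq> 0 then 2 * length (str_of_nat y) + 1 else 0)" by simp
    qed
  qed
  then have ex: "\<exists>t. of_bool (\<not> good t (nat_of_str p)) = (0 :: nat)" by auto
  define t where "t = (LEAST t. of_bool (\<not> good t (nat_of_str p)) = (0 :: nat))"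
  have "of_bool (\<not> good t (nat_of_str p)) = (0 :: nat)" unfolding t_def by (rule LeastI_ex[OF ex])
  then have gt: "good t (nat_of_str p)" by simp
  have G: "G (nat_of_str p) = Some (\<Sum>y<cut k. TW t y)"
    using ex unfolding G_def t_def lead by simp
  obtain q where q: "W q = Some (str_of_nat (\<Sum>y<cut k. TW t y))" "length q \<le> length p + d"
    using d[of p] G by auto
  have "length p = Suc (k + n)" by (simp add: p_def s_def)
  moreover have "2 * k \<le> f n" using \<nu>[of k] by (simp add: n_def)
  ultimately have "length q < n + f n + 1 - c" using q(2) by (simp add: k_def)
  then have qcut: "nat_of_str q < cut k" unfolding length_less_iff_nat_of_str cut by simp
  have qW: "q \<in> dom W" using q(1) by blast
  have "TW t (nat_of_str q) \<noteq> 0"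
  proof
    assume 0: "TW t (nat_of_str q) = 0"
    have "(\<Sum>y<cut k. if TW t y \<noteq> 0 then 2 * length (str_of_nat y) + 1 else 0)
       < (\<Sum>y<cut k. if str_of_nat y \<in> dom W then 2 * length (str_of_nat y) + 1 else 0)"
      by (rule sum_strict_mono_ex1) (use sound qcut qW 0 in \<open>auto intro!: bexI[of _ "nat_of_str q"]\<close>)
    then show False using gt unfolding good by simp
  qed
  then obtain y where y: "TW t (nat_of_str q) = Suc y" using not0_implies_Suc by blast
  then have "W q = Some (str_of_nat y)" unfolding TW(3) by (intro exI[of _ t]) simp
  then have "(\<Sum>y<cut k. TW t y) = y" using q(1) by simp
  moreover have "TW t (nat_of_str q) \<le> (\<Sum>y<cut k. TW t y)"
    using qcut by (intro member_le_sum) auto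
  ultimately show False using y by simp
qed

theorem theorem5p1:
  fixes V W :: "bool list \<rightharpoonup> bool list" and f :: "nat \<Rightarrow> nat"
  assumes "optimal V" and "optimal W"
    and "partial_recursive ((Some \<circ> f) |` {1..})"
  shows "(\<exists>M c. oracle_tm M \<and>
            (\<forall>n\<ge>1. otm_output M {bin_prefix (Omega V) n} (str_of_nat n)
               (code_set (restrict_length (dom W) (int n + int (f n) - int c)))))
         \<longleftrightarrow> bdd_above (f ` {1..})"
proof
  assume "bdd_above (f ` {1..})"
  then obtain B where "\<And>n. 1 \<le> n \<Longrightarrow> f n \<le> B" by (auto simp: bdd_above_def)
  then show "\<exists>M c. oracle_tm M \<and>
            (\<forall>n\<ge>1. otm_output M {bin_prefix (Omega V) n} (str_of_nat n)
               (code_set (restrict_length (dom W) (int n + int (f n) - int c))))"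
    by (rule ex_machine_if_bounded[OF assms])
next
  assume "\<exists>M c. oracle_tm M \<and>
            (\<forall>n\<ge>1. otm_output M {bin_prefix (Omega V) n} (str_of_nat n)
               (code_set (restrict_length (dom W) (int n + int (f n) - int c))))"
  then obtain M c where "oracle_tm M" "\<And>n. 1 \<le> n \<Longrightarrow> otm_output M {bin_prefix (Omega V) n} (str_of_nat n)
      (code_set (restrict_length (dom W) (int n + int (f n) - int c)))" by blast
  then show "bdd_above (f ` {1..})" by (rule bounded_if_ex_machine[OF assms(2,3)])
qed

end
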